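(* Let $G_\Gamma$ be a graph product of non-trivial groups over a finite simplicial graph $\Gamma$. Decompose $G_\Gamma\cong G_{\Gamma_1}\times\ldots\times G_{\Gamma_n}$ as a direct product where the factors are directly indecomposable special parabolic subgroups. Assume that $G_{\Gamma_i}\ncong\mathbb{Z}/2\mathbb{Z}*\mathbb{Z}/2\mathbb{Z}$ for all $i=1,\ldots,n$. (i) If $|V(\Gamma_i)|\geq 2$ for $i=1,\ldots,n$, then every non-trivial normal subgroup of $\mathrm{Aut}(G_\Gamma)$ is full-sized. In particular, if $G_\Gamma$ is a centerless graph product of abelian groups, then every non-trivial normal subgroup of $\mathrm{Aut}(G_\Gamma)$ is full-sized. (ii) If all vertex groups are finite, then every normal subgroup of $\mathrm{Aut}(G_\Gamma)$ is finite or full-sized.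
   Context: Given a finite simplicial graph $\Gamma$ and non-trivial groups $\{G_u\mid u\in V(\Gamma)\}$ (the vertex groups), the graph product $G_\Gamma$ is the quotient of the free product $\ast_{u\in V(\Gamma)}G_u$ by the normal closure of all commutators $[g,h]$ with $g\in G_u$, $h\in G_v$, $\{u,v\}\in E(\Gamma)$. For an induced subgraph $\Omega\subseteq\Gamma$, the subgroup $\langle G_v\mid v\in V(\Omega)\rangle$ is canonically isomorphic to $G_\Omega$ and is called a special parabolic subgroup. A graph product is directly decomposable if it is a direct product of proper special parabolic subgroups, equivalently if its defining graph is a join (its vertex set has a partition into two non-empty parts with every vertex of one adjacent to every vertex of the other); otherwise it is directly indecomposable. So the decomposition above corresponds to writing $\Gamma=\Gamma_1*\cdots*\Gamma_n$ as a join of induced subgraphs none of which is itself a join. A group is called full-sized if it contains a non-abelian free group $F_2$ as a subgroup. Centerless means that the center is trivial. *)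

theory Defs
  imports "HOL-Algebra.Algebra"
begin

section \<open>Free products\<close>

definition fp_words :: "'i set \<Rightarrow> ('i \<Rightarrow> ('g, 'm) monoid_scheme) \<Rightarrow> ('i \<times> 'g) list set" where
  "fp_words I G = lists (SIGMA i:I. carrier (G i))"

inductive_set fp_step :: "'i set \<Rightarrow> ('i \<Rightarrow> ('g, 'm) monoid_scheme) \<Rightarrow> ('i \<times> 'g) list rel"
  for I :: "'i set" and G :: "'i \<Rightarrow> ('g, 'm) monoid_scheme" where
  fp_step_one: "\<lbrakk>xs \<in> fp_words I G; ys \<in> fp_words I G; i \<in> I\<rbrakk>
    \<Longrightarrow> (xs @ [(i, \<one>\<^bsub>G i\<^esub>)] @ ys, xs @ ys) \<in> fp_step I G"
| fp_step_mult: "\<lbrakk>xs \<in> fp_words I G; ys \<in> fp_words I G; i \<in> I; g \<in> carrier (G i); h \<in> carrier (G i)\<rbrakk>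
    \<Longrightarrow> (xs @ [(i, g), (i, h)] @ ys, xs @ [(i, g \<otimes>\<^bsub>G i\<^esub> h)] @ ys) \<in> fp_step I G"

definition fp_rel :: "'i set \<Rightarrow> ('i \<Rightarrow> ('g, 'm) monoid_scheme) \<Rightarrow> ('i \<times> 'g) list rel" where
  "fp_rel I G = (fp_step I G \<union> (fp_step I G)\<inverse>)\<^sup>* \<inter> fp_words I G \<times> fp_words I G"

definition free_product ::
  "'i set \<Rightarrow> ('i \<Rightarrow> ('g, 'm) monoid_scheme) \<Rightarrow> ('i \<times> 'g) list set monoid" where
  "free_product I G =
    \<lparr>carrier = fp_words I G // fp_rel I G,
     monoid.mult = (\<lambda>A B. \<Union>a\<in>A. \<Union>b\<in>B. fp_rel I G `` {a @ b}),
     one = fp_rel I G `` {[]}\<rparr>"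

definition fp_incl ::
  "'i set \<Rightarrow> ('i \<Rightarrow> ('g, 'm) monoid_scheme) \<Rightarrow> 'i \<Rightarrow> 'g \<Rightarrow> ('i \<times> 'g) list set" where
  "fp_incl I G i g = fp_rel I G `` {[(i, g)]}"

lemma fp_words_Nil [simp]: "[] \<in> fp_words I G"
  by (simp add: fp_words_def)

lemma fp_words_append [simp]:
  "xs @ ys \<in> fp_words I G \<longleftrightarrow> xs \<in> fp_words I G \<and> ys \<in> fp_words I G"
  by (auto simp: fp_words_def)

lemma fp_words_Cons [simp]:
  "(i, g) # xs \<in> fp_words I G \<longleftrightarrow> i \<in> I \<and> g \<in> carrier (G i) \<and> xs \<in> fp_words I G"
  by (auto simp: fp_words_def)

lemma equiv_fp_rel: "equiv (fp_words I G) (fp_rel I G)"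
proof -
  let ?R = "(fp_step I G \<union> (fp_step I G)\<inverse>)\<^sup>*"
  have "sym ?R" by (intro sym_rtrancl sym_Un_converse)
  then show ?thesis
    unfolding fp_rel_def
    by (auto intro!: equivI refl_onI symI transI dest: symD rtrancl_trans)
qed

lemma fp_step_context:
  assumes "(x, y) \<in> fp_step I G" "a \<in> fp_words I G" "b \<in> fp_words I G"
  shows "(a @ x @ b, a @ y @ b) \<in> fp_step I G"
  using assms(1)
proof cases
  case (fp_step_one xs ys i)
  then show ?thesis
    using fp_step.fp_step_one[of "a @ xs" I G "ys @ b" i] assms by simp
next
  case (fp_step_mult xs ys i g h)
  then show ?thesis
    using fp_step.fp_step_mult[of "a @ xs" I G "ys @ b" i g h] assms by simp
qed

lemma fp_rel_context:
  assumes "(x, y) \<in> fp_rel I G" and a: "a \<in> fp_words I G" and b: "b \<in> fp_words I G"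
  shows "(a @ x @ b, a @ y @ b) \<in> fp_rel I G"
proof -
  have "(x, y) \<in> (fp_step I G \<union> (fp_step I G)\<inverse>)\<^sup>*"
    using assms(1) by (simp add: fp_rel_def)
  then have "(a @ x @ b, a @ y @ b) \<in> (fp_step I G \<union> (fp_step I G)\<inverse>)\<^sup>*"
  proof (induction rule: rtrancl_induct)
    case (step y z)
    then have "(a @ y @ b, a @ z @ b) \<in> fp_step I G \<union> (fp_step I G)\<inverse>"
      using fp_step_context[OF _ a b] by auto
    with step.IH show ?case by (rule rtrancl_into_rtrancl)
  qed simp
  then show ?thesis using assms by (auto simp: fp_rel_def)
qed

lemma fp_rel_append:
  assumes "(x, x') \<in> fp_rel I G" "(y, y') \<in> fp_rel I G"
  shows "(x @ y, x' @ y') \<in> fp_rel I G"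
proof -
  have w: "x \<in> fp_words I G" "x' \<in> fp_words I G" "y \<in> fp_words I G" "y' \<in> fp_words I G"
    using assms by (auto simp: fp_rel_def)
  have "(x @ y, x' @ y) \<in> fp_rel I G"
    using fp_rel_context[OF assms(1), of "[]" y] w by simp
  moreover have "(x' @ y, x' @ y') \<in> fp_rel I G"
    using fp_rel_context[OF assms(2), of x' "[]"] w by simp
  moreover have "trans (fp_rel I G)" using equiv_fp_rel[of I G] by (auto simp: equiv_def)
  ultimately show ?thesis by (blast dest: transD)
qed

lemma fp_mult_classes:
  assumes "x \<in> fp_words I G" "y \<in> fp_words I G"
  shows "fp_rel I G `` {x} \<otimes>\<^bsub>free_product I G\<^esub> fp_rel I G `` {y} = fp_rel I G `` {x @ y}"
proof -
  let ?A = "fp_rel I G `` {x}" and ?B = "fp_rel I G `` {y}"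
  have *: "fp_rel I G `` {a @ b} = fp_rel I G `` {x @ y}" if "a \<in> ?A" "b \<in> ?B" for a b
  proof -
    have "(x @ y, a @ b) \<in> fp_rel I G" using that by (intro fp_rel_append) auto
    then show ?thesis using equiv_class_eq[OF equiv_fp_rel] by blast
  qed
  have "?A \<noteq> {}" "?B \<noteq> {}"
    using assms equiv_class_self[OF equiv_fp_rel] by blast+
  moreover have "(\<Union>a\<in>?A. \<Union>b\<in>?B. fp_rel I G `` {a @ b}) = (\<Union>a\<in>?A. \<Union>b\<in>?B. fp_rel I G `` {x @ y})"
    by (intro SUP_cong refl *)
  ultimately show ?thesis
    by (simp add: free_product_def)
qed

lemma fp_class_closed [simp]:
  "x \<in> fp_words I G \<Longrightarrow> fp_rel I G `` {x} \<in> carrier (free_product I G)"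
  by (simp add: free_product_def quotientI)

lemma fp_carrierE:
  assumes "A \<in> carrier (free_product I G)"
  obtains x where "x \<in> fp_words I G" "A = fp_rel I G `` {x}"
  using assms by (auto simp: free_product_def elim: quotientE)

lemma fp_rel_step: "(x, y) \<in> fp_step I G \<Longrightarrow> x \<in> fp_words I G \<Longrightarrow> y \<in> fp_words I G \<Longrightarrow> (x, y) \<in> fp_rel I G"
  by (auto simp: fp_rel_def)

lemma fp_left_inverse:
  assumes G: "\<And>i. i \<in> I \<Longrightarrow> group (G i)" and "x \<in> fp_words I G"
  shows "\<exists>y \<in> fp_words I G. (y @ x, []) \<in> fp_rel I G"
  using assms(2)
proof (induction x)
  case Nil
  show ?case by (intro bexI[of _ "[]"]) (auto simp: fp_rel_def)
next
  case (Cons p x)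
  obtain i g where p: "p = (i, g)" by force
  with Cons.prems have i: "i \<in> I" "g \<in> carrier (G i)" and x: "x \<in> fp_words I G" by auto
  interpret group "G i" using G i by blast
  obtain y where y: "y \<in> fp_words I G" "(y @ x, []) \<in> fp_rel I G" using Cons.IH x by blast
  have tr: "trans (fp_rel I G)" using equiv_fp_rel[of I G] by (auto simp: equiv_def)
  let ?y = "y @ [(i, inv\<^bsub>G i\<^esub> g)]"
  have "(y @ [(i, inv\<^bsub>G i\<^esub> g), (i, g)] @ x, y @ [(i, inv\<^bsub>G i\<^esub> g \<otimes>\<^bsub>G i\<^esub> g)] @ x) \<in> fp_rel I G"
    using i x y by (intro fp_rel_step fp_step_mult) auto
  moreover have "(y @ [(i, \<one>\<^bsub>G i\<^esub>)] @ x, y @ x) \<in> fp_rel I G"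
    using i x y by (intro fp_rel_step fp_step_one) auto
  ultimately have "(y @ [(i, inv\<^bsub>G i\<^esub> g), (i, g)] @ x, []) \<in> fp_rel I G"
    using i transD[OF tr _ transD[OF tr _ y(2)]] by (metis l_inv)
  then have "(?y @ p # x, []) \<in> fp_rel I G"
    by (simp add: p)
  then show ?case using y i by (intro bexI[of _ ?y]) auto
qed

lemma group_free_product:
  assumes "\<And>i. i \<in> I \<Longrightarrow> group (G i)"
  shows "group (free_product I G)"
proof -
  let ?F = "free_product I G"
  have one: "\<one>\<^bsub>?F\<^esub> = fp_rel I G `` {[]}" by (simp add: free_product_def)
  show ?thesis
  proof (rule groupI)
    fix A B assume "A \<in> carrier ?F" "B \<in> carrier ?F"
    then show "A \<otimes>\<^bsub>?F\<^esub> B \<in> carrier ?F"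
      by (elim fp_carrierE) (simp add: fp_mult_classes)
  next
    fix A B C assume "A \<in> carrier ?F" "B \<in> carrier ?F" "C \<in> carrier ?F"
    then show "A \<otimes>\<^bsub>?F\<^esub> B \<otimes>\<^bsub>?F\<^esub> C = A \<otimes>\<^bsub>?F\<^esub> (B \<otimes>\<^bsub>?F\<^esub> C)"
      by (elim fp_carrierE) (simp add: fp_mult_classes)
  next
    fix A assume A: "A \<in> carrier ?F"
    then show "\<one>\<^bsub>?F\<^esub> \<otimes>\<^bsub>?F\<^esub> A = A"
      by (elim fp_carrierE) (simp add: fp_mult_classes one)
    obtain x where x: "x \<in> fp_words I G" "A = fp_rel I G `` {x}" using A by (rule fp_carrierE)
    obtain y where y: "y \<in> fp_words I G" "(y @ x, []) \<in> fp_rel I G"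
      using fp_left_inverse[OF assms x(1)] by blast
    then have "fp_rel I G `` {y} \<otimes>\<^bsub>?F\<^esub> A = \<one>\<^bsub>?F\<^esub>"
      using x equiv_class_eq[OF equiv_fp_rel y(2)] by (simp add: fp_mult_classes one)
    then show "\<exists>B\<in>carrier ?F. B \<otimes>\<^bsub>?F\<^esub> A = \<one>\<^bsub>?F\<^esub>"
      using y by (intro bexI) auto
  qed (simp add: one)
qed

lemma fp_incl_hom:
  assumes "i \<in> I" "group (G i)"
  shows "fp_incl I G i \<in> hom (G i) (free_product I G)"
proof (rule homI)
  interpret group "G i" by fact
  fix g assume g: "g \<in> carrier (G i)"
  then show "fp_incl I G i g \<in> carrier (free_product I G)"
    using assms by (simp add: fp_incl_def)
  fix h assume h: "h \<in> carrier (G i)"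
  have "([(i, g), (i, h)], [(i, g \<otimes>\<^bsub>G i\<^esub> h)]) \<in> fp_rel I G"
    using fp_step_mult[of "[]" I G "[]" i g h] g h assms by (intro fp_rel_step) auto
  from equiv_class_eq[OF equiv_fp_rel this]
  show "fp_incl I G i (g \<otimes>\<^bsub>G i\<^esub> h) = fp_incl I G i g \<otimes>\<^bsub>free_product I G\<^esub> fp_incl I G i h"
    using g h assms by (simp add: fp_incl_def fp_mult_classes)
qed


section \<open>Graph products\<close>

definition simplicial_graph :: "'v set \<Rightarrow> 'v set set \<Rightarrow> bool" where
  "simplicial_graph V E \<longleftrightarrow> (\<forall>e\<in>E. e \<subseteq> V \<and> card e = 2)"

definition induced_edges :: "'v set set \<Rightarrow> 'v set \<Rightarrow> 'v set set" where
  "induced_edges E W = {e \<in> E. e \<subseteq> W}"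

definition normal_closure :: "('a, 'm) monoid_scheme \<Rightarrow> 'a set \<Rightarrow> 'a set" where
  "normal_closure K S = \<Inter> {N. N \<lhd> K \<and> S \<subseteq> N}"

definition commutator :: "('a, 'm) monoid_scheme \<Rightarrow> 'a \<Rightarrow> 'a \<Rightarrow> 'a" where
  "commutator K x y = x \<otimes>\<^bsub>K\<^esub> y \<otimes>\<^bsub>K\<^esub> inv\<^bsub>K\<^esub> x \<otimes>\<^bsub>K\<^esub> inv\<^bsub>K\<^esub> y"

definition edge_commutators ::
  "'v set \<Rightarrow> 'v set set \<Rightarrow> ('v \<Rightarrow> ('g, 'm) monoid_scheme) \<Rightarrow> ('v \<times> 'g) list set set" where
  "edge_commutators V E G =
    {commutator (free_product V G) (fp_incl V G u g) (fp_incl V G v h) | u v g h.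
      {u, v} \<in> E \<and> g \<in> carrier (G u) \<and> h \<in> carrier (G v)}"

definition graph_product ::
  "'v set \<Rightarrow> 'v set set \<Rightarrow> ('v \<Rightarrow> ('g, 'm) monoid_scheme) \<Rightarrow> ('v \<times> 'g) list set set monoid" where
  "graph_product V E G =
    free_product V G Mod normal_closure (free_product V G) (edge_commutators V E G)"

definition vertex_incl ::
  "'v set \<Rightarrow> 'v set set \<Rightarrow> ('v \<Rightarrow> ('g, 'm) monoid_scheme) \<Rightarrow> 'v \<Rightarrow> 'g \<Rightarrow> ('v \<times> 'g) list set set" where
  "vertex_incl V E G v g =
    normal_closure (free_product V G) (edge_commutators V E G) #>\<^bsub>free_product V G\<^esub> fp_incl V G v g"

definition special_parabolic ::
  "'v set \<Rightarrow> 'v set set \<Rightarrow> ('v \<Rightarrow> ('g, 'm) monoid_scheme) \<Rightarrow> 'v set \<Rightarrow> ('v \<times> 'g) list set set monoid" where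
  "special_parabolic V E G W =
    subgroup_generated (graph_product V E G) (\<Union>v\<in>W. vertex_incl V E G v ` carrier (G v))"

text \<open>\<open>K\<close> is the direct product of the family \<open>H\<close> of its subgroups, via an isomorphism that
  restricts to the inclusion on every factor.\<close>

definition internal_direct_product ::
  "('a, 'm) monoid_scheme \<Rightarrow> 'i set \<Rightarrow> ('i \<Rightarrow> ('a, 'n) monoid_scheme) \<Rightarrow> bool" where
  "internal_direct_product K I H \<longleftrightarrow>
    (\<exists>\<phi> \<in> iso (product_group I H) K.
      \<forall>i\<in>I. \<forall>x\<in>carrier (H i). \<phi> (\<lambda>j\<in>I. if j = i then x else \<one>\<^bsub>H j\<^esub>) = x)"

definition parabolic_decomposition ::
  "'v set \<Rightarrow> 'v set set \<Rightarrow> ('v \<Rightarrow> ('g, 'm) monoid_scheme) \<Rightarrow> nat \<Rightarrow> (nat \<Rightarrow> 'v set) \<Rightarrow> bool" where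
  "parabolic_decomposition V E G n W \<longleftrightarrow>
    (\<forall>i\<in>{1..n}. W i \<subseteq> V) \<and>
    internal_direct_product (graph_product V E G) {1..n} (\<lambda>i. special_parabolic V E G (W i))"

text \<open>By the empty product, the trivial graph product over the empty graph counts as directly
  decomposable, so that no directly indecomposable graph product is trivial.\<close>

definition directly_decomposable ::
  "'v set \<Rightarrow> 'v set set \<Rightarrow> ('v \<Rightarrow> ('g, 'm) monoid_scheme) \<Rightarrow> bool" where
  "directly_decomposable V E G \<longleftrightarrow>
    (\<exists>n W. parabolic_decomposition V E G n W \<and>
      (\<forall>i\<in>{1..n}. carrier (special_parabolic V E G (W i)) \<noteq> carrier (graph_product V E G)))"

lemma (in group) normal_normal_closure:
  assumes "S \<subseteq> carrier G"
  shows "normal_closure G S \<lhd> G"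
proof -
  let ?F = "{N. N \<lhd> G \<and> S \<subseteq> N}"
  have self: "carrier G \<in> ?F"
    using assms normal_self by blast
  have sub: "subgroup (\<Inter> ?F) G"
    using self by (intro subgroups_Inter) (auto simp: normal_def)
  show ?thesis
    unfolding normal_closure_def
  proof (rule normal_invI[OF sub])
    fix x h assume "x \<in> carrier G" "h \<in> \<Inter> ?F"
    then show "x \<otimes> h \<otimes> inv x \<in> \<Inter> ?F"
      using normal.inv_op_closed2 by fastforce
  qed
qed

lemma edge_commutators_subset:
  assumes "simplicial_graph V E" "\<And>v. v \<in> V \<Longrightarrow> group (G v)"
  shows "edge_commutators V E G \<subseteq> carrier (free_product V G)"
proof -
  interpret F: group "free_product V G" using assms group_free_product by blast
  have "commutator (free_product V G) (fp_incl V G u g) (fp_incl V G v h) \<in> carrier (free_product V G)"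
    if "{u, v} \<in> E" "g \<in> carrier (G u)" "h \<in> carrier (G v)" for u v g h
  proof -
    have "u \<in> V" "v \<in> V" using assms(1) that by (auto simp: simplicial_graph_def)
    then have "fp_incl V G u g \<in> carrier (free_product V G)"
      "fp_incl V G v h \<in> carrier (free_product V G)"
      using that by (simp_all add: fp_incl_def)
    then show ?thesis by (simp add: commutator_def)
  qed
  then show ?thesis by (auto simp: edge_commutators_def)
qed

lemma group_graph_product:
  assumes "simplicial_graph V E" "\<And>v. v \<in> V \<Longrightarrow> group (G v)"
  shows "group (graph_product V E G)"
  unfolding graph_product_def
  using assms
  by (intro normal.factorgroup_is_group group.normal_normal_closure group_free_product
      edge_commutators_subset) auto

lemma vertex_incl_hom:
  assumes "simplicial_graph V E" "\<And>v. v \<in> V \<Longrightarrow> group (G v)" "v \<in> V"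
  shows "vertex_incl V E G v \<in> hom (G v) (graph_product V E G)"
proof -
  let ?F = "free_product V G" and ?N = "normal_closure (free_product V G) (edge_commutators V E G)"
  have "?N \<lhd> ?F"
    using assms by (intro group.normal_normal_closure group_free_product edge_commutators_subset) auto
  then have "(\<lambda>a. ?N #>\<^bsub>?F\<^esub> a) \<in> hom ?F (?F Mod ?N)"
    by (rule normal.r_coset_hom_Mod)
  from hom_compose[OF fp_incl_hom[of v V G] this] show ?thesis
    using assms by (simp add: graph_product_def vertex_incl_def[abs_def] comp_def)
qed


section \<open>Full-sized and centerless groups\<close>

definition free_group :: "'i set \<Rightarrow> ('i \<times> int) list set monoid" where
  "free_group S = free_product S (\<lambda>_. integer_group)"

definition infinite_dihedral_group :: "(bool \<times> int) list set monoid" where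
  "infinite_dihedral_group = free_product UNIV (\<lambda>_. integer_mod_group 2)"

definition full_sized :: "('a, 'm) monoid_scheme \<Rightarrow> bool" where
  "full_sized K \<longleftrightarrow> (\<exists>H. subgroup H K \<and> K\<lparr>carrier := H\<rparr> \<cong> free_group (UNIV :: bool set))"

definition group_center :: "('a, 'm) monoid_scheme \<Rightarrow> 'a set" where
  "group_center K = {z \<in> carrier K. \<forall>x\<in>carrier K. z \<otimes>\<^bsub>K\<^esub> x = x \<otimes>\<^bsub>K\<^esub> z}"

definition centerless :: "('a, 'm) monoid_scheme \<Rightarrow> bool" where
  "centerless K \<longleftrightarrow> group_center K = {\<one>\<^bsub>K\<^esub>}"

end

theory Submission
  imports Defs
begin

text \<open>Consider first a normal subgroup \<open>M \<noteq> 1\<close> of a graph product over a graph that is not a join. For a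
  vertex \<open>v\<close>, the kernel of the retraction killing \<open>G v\<close> is the free product of the conjugates of
  \<open>G v\<close> by the cosets of the subgroup of the link of \<open>v\<close>. If \<open>M\<close> meets none of these kernels, it
  commutes with all vertex groups, and the center is trivial. Otherwise \<open>M\<close> contains, up to
  conjugation, a reduced word of such a free product that starts and ends in the same factor; it and
  two of its conjugates play ping-pong on the reduced words, which yields a free subgroup of rank two.

  For \<open>N \<lhd> Aut\<close> and \<open>\<phi> \<in> N\<close>, conjugation by \<open>\<phi>(g) g\<^sup>-\<^sup>1\<close> lies in \<open>N\<close>. If such an element has a
  non-trivial component in a factor with at least two vertices, commutators with that factor produce
  a non-trivial normal subgroup of it whose inner automorphisms lie in \<open>N\<close>. Otherwise, for finite
  vertex groups, all \<open>\<phi>(g) g\<^sup>-\<^sup>1\<close> lie in the finite product of the one-vertex factors, so \<open>N\<close> is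
  finite because the graph product is finitely generated.\<close>

section \<open>Universal properties\<close>

text \<open>Homomorphisms out of the universal property do the work of normal forms: the retractions
  \<open>retr A\<close>, whose fixed points serve as parabolic subgroups, and, for each vertex, one
  action on words, where all the ping-pong takes place. Three players are used because the elements
  at hand may have order two, and two involutions generate only a dihedral group. The two
  conjugating letters must avoid the coset of the first player; for at least two vertices and a
  graph that is not a join, only the infinite dihedral group fails to provide them. Excluding it is
  forced: its automorphism group is infinite dihedral again, so it has infinite normal subgroups but
  no free subgroup of rank two. Trivial centers matter twice: commutators with a factor detect every
  non-trivial component in it only if the factor is centerless, and \<open>inner\<close> is
  injective on a subgroup only if none of its non-trivial elements is central in the whole group.
  One-vertex factors can be arbitrary groups; (i) excludes them, and in (ii) finiteness keeps them
  under control.\<close>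

lemma full_sizedI:
  assumes "group K" and \<theta>: "\<theta> \<in> hom (free_group (UNIV :: bool set)) K"
    and inj: "inj_on \<theta> (carrier (free_group UNIV))"
  shows "full_sized K"
proof -
  have F: "group (free_group (UNIV :: bool set))"
    unfolding free_group_def by (intro group_free_product) simp
  interpret group_hom "free_group (UNIV :: bool set)" K \<theta>
    using assms F by (simp add: group_hom_def group_hom_axioms_def)
  let ?H = "\<theta> ` carrier (free_group UNIV)"
  have "\<theta> \<in> iso (free_group UNIV) (K\<lparr>carrier := ?H\<rparr>)"
    using \<theta> inj by (auto simp: iso_def hom_def bij_betw_def)
  then have "K\<lparr>carrier := ?H\<rparr> \<cong> free_group (UNIV :: bool set)"
    using F group.iso_sym is_isoI by blast
  then show ?thesis
    using img_is_subgroup unfolding full_sized_def by blast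
qed

lemma full_sizedE:
  assumes "full_sized K" "group K"
  obtains \<theta> where "\<theta> \<in> hom (free_group (UNIV :: bool set)) K" "inj_on \<theta> (carrier (free_group UNIV))"
proof -
  obtain H where H: "subgroup H K" "K\<lparr>carrier := H\<rparr> \<cong> free_group (UNIV :: bool set)"
    using assms by (auto simp: full_sized_def)
  then have "free_group (UNIV :: bool set) \<cong> K\<lparr>carrier := H\<rparr>"
    using assms(2) group.iso_sym subgroup.subgroup_is_group by blast
  then obtain \<theta> where \<theta>: "\<theta> \<in> iso (free_group (UNIV :: bool set)) (K\<lparr>carrier := H\<rparr>)"
    by (auto simp: is_iso_def)
  moreover have "H \<subseteq> carrier K" using H subgroup.subset by blast
  ultimately have "\<theta> \<in> hom (free_group (UNIV :: bool set)) K" "inj_on \<theta> (carrier (free_group UNIV))"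
    by (auto simp: iso_def hom_def bij_betw_def)
  then show thesis by (rule that)
qed

lemma full_sized_inj_hom:
  assumes "full_sized K" "group K" "group K'" "j \<in> hom K K'" "inj_on j (carrier K)"
  shows "full_sized K'"
proof -
  obtain \<theta> where \<theta>: "\<theta> \<in> hom (free_group (UNIV :: bool set)) K" "inj_on \<theta> (carrier (free_group UNIV))"
    using full_sizedE assms by metis
  have "j \<circ> \<theta> \<in> hom (free_group UNIV) K'"
    using \<theta>(1) assms(4) by (rule hom_compose)
  moreover have "inj_on (j \<circ> \<theta>) (carrier (free_group UNIV))"
    using \<theta> assms(5) by (intro comp_inj_on) (auto intro: inj_on_subset simp: hom_def)
  ultimately show ?thesis using full_sizedI assms(3) by blast
qed

lemma fp_induct [consumes 1, case_names one incl]: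
  assumes "x \<in> carrier (free_product I G)"
    and one: "P \<one>\<^bsub>free_product I G\<^esub>"
    and incl: "\<And>i g x. \<lbrakk>i \<in> I; g \<in> carrier (G i); x \<in> carrier (free_product I G); P x\<rbrakk>
      \<Longrightarrow> P (fp_incl I G i g \<otimes>\<^bsub>free_product I G\<^esub> x)"
  shows "P x"
proof -
  have "P (fp_rel I G `` {w})" if "w \<in> fp_words I G" for w
    using that
  proof (induction w)
    case Nil
    then show ?case using one by (simp add: free_product_def)
  next
    case (Cons a w)
    obtain i g where a: "a = (i, g)" by force
    have "fp_rel I G `` {a # w} = fp_incl I G i g \<otimes>\<^bsub>free_product I G\<^esub> fp_rel I G `` {w}"
      using Cons.prems a by (simp add: fp_incl_def fp_mult_classes)
    then show ?case using Cons a incl by simp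
  qed
  then show ?thesis using assms(1) by (metis fp_carrierE)
qed

text \<open>Evaluating words in \<open>K\<close> is unchanged by both rewriting steps, hence
  constant on the classes of \<open>fp_rel\<close>.\<close>

lemma free_product_universal:
  assumes "group K" and f: "\<And>i. i \<in> I \<Longrightarrow> f i \<in> hom (G i) K" and G: "\<And>i. i \<in> I \<Longrightarrow> group (G i)"
  obtains \<theta> where "\<theta> \<in> hom (free_product I G) K"
    "\<And>i g. \<lbrakk>i \<in> I; g \<in> carrier (G i)\<rbrakk> \<Longrightarrow> \<theta> (fp_incl I G i g) = f i g"
proof -
  interpret K: group K by fact
  have fc [simp]: "f i g \<in> carrier K" if "i \<in> I" "g \<in> carrier (G i)" for i g
    using f that by (auto simp: hom_def)
  define ev where "ev = (\<lambda>w. foldr (\<lambda>(i, g) x. f i g \<otimes>\<^bsub>K\<^esub> x) w \<one>\<^bsub>K\<^esub>)"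
  have ev_closed [simp]: "ev w \<in> carrier K" if "w \<in> fp_words I G" for w
    using that by (induction w) (auto simp: ev_def)
  have ev_append: "ev (u @ w) = ev u \<otimes>\<^bsub>K\<^esub> ev w" if "u \<in> fp_words I G" "w \<in> fp_words I G" for u w
    using that(1)
  proof (induction u)
    case Nil
    then show ?case using ev_closed[OF that(2)] by (simp add: ev_def)
  next
    case (Cons a u)
    obtain i g where [simp]: "a = (i, g)" by force
    have "ev (a # z) = f i g \<otimes>\<^bsub>K\<^esub> ev z" for z by (simp add: ev_def)
    then show ?case using Cons that by (simp add: K.m_assoc)
  qed
  have ev_single: "ev [(i, g)] = f i g" if "i \<in> I" "g \<in> carrier (G i)" for i g
    using that by (simp add: ev_def)
  have step: "ev x = ev y" if "(x, y) \<in> fp_step I G" for x y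
    using that
  proof cases
    case (fp_step_one xs ys i)
    have "f i \<one>\<^bsub>G i\<^esub> = \<one>\<^bsub>K\<^esub>"
      using fp_step_one f G assms(1) hom_one by blast
    then have "ev [(i, \<one>\<^bsub>G i\<^esub>)] = \<one>\<^bsub>K\<^esub>" by (simp add: ev_def)
    moreover have "[(i, \<one>\<^bsub>G i\<^esub>)] \<in> fp_words I G"
      using fp_step_one G group.is_monoid monoid.one_closed by fastforce
    ultimately show ?thesis
      using fp_step_one by (simp add: ev_append del: append_Cons fp_words_Cons)
  next
    case (fp_step_mult xs ys i g h)
    interpret Gi: group "G i" using G fp_step_mult by blast
    have "ev [(i, g), (i, h)] = ev [(i, g \<otimes>\<^bsub>G i\<^esub> h)]"
      using f[of i] fp_step_mult by (simp add: ev_def hom_mult)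
    then show ?thesis
      using fp_step_mult by (simp add: ev_append del: append_Cons)
  qed
  have rel: "ev x = ev y" if "(x, y) \<in> fp_rel I G" for x y
  proof -
    have "(x, y) \<in> (fp_step I G \<union> (fp_step I G)\<inverse>)\<^sup>*"
      using that by (simp add: fp_rel_def)
    then show ?thesis by (induction rule: rtrancl_induct) (use step in fastforce)+
  qed
  \<comment> \<open>Evaluation is constant on a class, so the image of the class is a
    singleton.\<close>
  define \<theta> where "\<theta> = (\<lambda>A. the_elem (ev ` A))"
  have \<theta>: "\<theta> (fp_rel I G `` {w}) = ev w" if "w \<in> fp_words I G" for w
  proof -
    have "w \<in> fp_rel I G `` {w}" using that equiv_class_self[OF equiv_fp_rel] by blast
    then have "fp_rel I G `` {w} \<noteq> {}" by blast
    moreover have "ev y = ev w" if "y \<in> fp_rel I G `` {w}" for y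
      using rel[of w y] that by simp
    ultimately show ?thesis unfolding \<theta>_def by (rule the_elem_image_unique)
  qed
  show thesis
  proof (rule that[of \<theta>])
    show "\<theta> \<in> hom (free_product I G) K"
      by (rule homI) (auto elim!: fp_carrierE simp: \<theta> fp_mult_classes ev_append)
    show "\<theta> (fp_incl I G i g) = f i g" if "i \<in> I" "g \<in> carrier (G i)" for i g
      using that by (simp add: fp_incl_def \<theta> ev_single)
  qed
qed

lemma (in group) commutator_eq_one_iff:
  assumes "x \<in> carrier G" "y \<in> carrier G"
  shows "commutator G x y = \<one> \<longleftrightarrow> x \<otimes> y = y \<otimes> x"
proof -
  have "commutator G x y = x \<otimes> y \<otimes> inv (y \<otimes> x)"
    using assms by (simp add: commutator_def m_assoc inv_mult_group)
  then show ?thesis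
    using assms inv_solve_right'[of \<one> "x \<otimes> y" "y \<otimes> x"] by simp
qed

section \<open>Graph products: generation by the vertex groups and the universal property\<close>

locale graph_product_data =
  fixes V :: "'v set" and E :: "'v set set" and G :: "'v \<Rightarrow> ('g, 'm) monoid_scheme"
  assumes simplicial: "simplicial_graph V E"
    and vertex_group: "\<And>v. v \<in> V \<Longrightarrow> group (G v)"
begin

abbreviation "\<Gamma> \<equiv> graph_product V E G"
abbreviation "\<iota> \<equiv> vertex_incl V E G"

sublocale GP: group \<Gamma>
  using simplicial vertex_group by (rule group_graph_product)

lemma incl_hom: "v \<in> V \<Longrightarrow> \<iota> v \<in> hom (G v) \<Gamma>"
  by (rule vertex_incl_hom[OF simplicial vertex_group])

lemma incl_closed [simp]: "\<lbrakk>v \<in> V; g \<in> carrier (G v)\<rbrakk> \<Longrightarrow> \<iota> v g \<in> carrier \<Gamma>"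
  using hom_in_carrier[OF incl_hom] .

lemma incl_mult: "\<lbrakk>v \<in> V; g \<in> carrier (G v); h \<in> carrier (G v)\<rbrakk> \<Longrightarrow> \<iota> v (g \<otimes>\<^bsub>G v\<^esub> h) = \<iota> v g \<otimes>\<^bsub>\<Gamma>\<^esub> \<iota> v h"
  using hom_mult[OF incl_hom] .

lemma incl_one [simp]: "v \<in> V \<Longrightarrow> \<iota> v \<one>\<^bsub>G v\<^esub> = \<one>\<^bsub>\<Gamma>\<^esub>"
  using hom_one[OF incl_hom vertex_group GP.is_group] .

lemma normal_edge_closure:
  "normal_closure (free_product V G) (edge_commutators V E G) \<lhd> free_product V G"
  using simplicial vertex_group
  by (intro group.normal_normal_closure group_free_product edge_commutators_subset) auto

text \<open>Inherited from words in the free product. With it, identities between homomorphisms are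
  checked on vertex groups only.\<close>

lemma graph_product_induct [consumes 1, case_names one incl]:
  assumes "x \<in> carrier \<Gamma>" and one: "P \<one>\<^bsub>\<Gamma>\<^esub>"
    and incl: "\<And>v g x. \<lbrakk>v \<in> V; g \<in> carrier (G v); x \<in> carrier \<Gamma>; P x\<rbrakk> \<Longrightarrow> P (\<iota> v g \<otimes>\<^bsub>\<Gamma>\<^esub> x)"
  shows "P x"
proof -
  let ?F = "free_product V G" and ?N = "normal_closure (free_product V G) (edge_commutators V E G)"
  have hom: "(\<lambda>a. ?N #>\<^bsub>?F\<^esub> a) \<in> hom ?F \<Gamma>"
    unfolding graph_product_def using normal_edge_closure by (rule normal.r_coset_hom_Mod)
  have F: "group ?F" using group_free_product vertex_group by blast
  obtain a where a: "a \<in> carrier ?F" "x = ?N #>\<^bsub>?F\<^esub> a"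
    using assms(1) by (auto simp: graph_product_def FactGroup_def RCOSETS_def)
  have "P (?N #>\<^bsub>?F\<^esub> a)" using a(1)
  proof (induction rule: fp_induct)
    case one
    have "?N #>\<^bsub>?F\<^esub> \<one>\<^bsub>?F\<^esub> = \<one>\<^bsub>\<Gamma>\<^esub>" using hom_one[OF hom F GP.is_group] by simp
    then show ?case using assms(2) by simp
  next
    case (incl i g x)
    have "fp_incl V G i g \<in> carrier ?F" using incl by (simp add: fp_incl_def)
    then have "?N #>\<^bsub>?F\<^esub> (fp_incl V G i g \<otimes>\<^bsub>?F\<^esub> x) = \<iota> i g \<otimes>\<^bsub>\<Gamma>\<^esub> (?N #>\<^bsub>?F\<^esub> x)"
      using hom_mult[OF hom] incl by (simp add: vertex_incl_def)
    then show ?case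
      using incl assms(3) hom_in_carrier[OF hom] by simp
  qed
  then show ?thesis using a by simp
qed

lemma edge_commute:
  assumes "{u, v} \<in> E" "g \<in> carrier (G u)" "h \<in> carrier (G v)"
  shows "\<iota> u g \<otimes>\<^bsub>\<Gamma>\<^esub> \<iota> v h = \<iota> v h \<otimes>\<^bsub>\<Gamma>\<^esub> \<iota> u g"
proof -
  let ?F = "free_product V G" and ?N = "normal_closure (free_product V G) (edge_commutators V E G)"
  let ?q = "\<lambda>a. ?N #>\<^bsub>?F\<^esub> a"
  have uv: "u \<in> V" "v \<in> V" using simplicial assms by (auto simp: simplicial_graph_def)
  have hom: "?q \<in> hom ?F \<Gamma>"
    unfolding graph_product_def using normal_edge_closure by (rule normal.r_coset_hom_Mod)
  have F: "group ?F" using group_free_product vertex_group by blast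
  interpret q: group_hom ?F \<Gamma> ?q
    using hom F GP.is_group by (simp add: group_hom_def group_hom_axioms_def)
  have c [simp]: "fp_incl V G u g \<in> carrier ?F" "fp_incl V G v h \<in> carrier ?F"
    using assms uv by (simp_all add: fp_incl_def)
  let ?c = "commutator ?F (fp_incl V G u g) (fp_incl V G v h)"
  have "?c \<in> edge_commutators V E G" using assms by (auto simp: edge_commutators_def)
  then have "?c \<in> ?N" by (auto simp: normal_closure_def)
  then have "?q ?c = \<one>\<^bsub>\<Gamma>\<^esub>"
    using q.G.coset_join2[of ?c ?N] normal_edge_closure
    by (simp add: graph_product_def FactGroup_def normal_imp_subgroup commutator_def)
  then have "commutator \<Gamma> (\<iota> u g) (\<iota> v h) = \<one>\<^bsub>\<Gamma>\<^esub>"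
    unfolding commutator_def vertex_incl_def by simp
  then show ?thesis
    using assms uv by (simp add: GP.commutator_eq_one_iff)
qed

text \<open>The kernel of the map from the free product is normal and contains the edge commutators,
  hence their normal closure. Commutation is demanded only for distinct vertices, so that the images
  of single vertex groups may be non-abelian.\<close>

lemma graph_product_universal:
  assumes K: "group K" and f: "\<And>v. v \<in> V \<Longrightarrow> f v \<in> hom (G v) K"
    and comm: "\<And>u v g h. \<lbrakk>{u, v} \<in> E; u \<in> V; v \<in> V; u \<noteq> v; g \<in> carrier (G u); h \<in> carrier (G v)\<rbrakk>
      \<Longrightarrow> f u g \<otimes>\<^bsub>K\<^esub> f v h = f v h \<otimes>\<^bsub>K\<^esub> f u g"
  obtains \<theta> where "\<theta> \<in> hom \<Gamma> K"
    "\<And>v g. \<lbrakk>v \<in> V; g \<in> carrier (G v)\<rbrakk> \<Longrightarrow> \<theta> (\<iota> v g) = f v g"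
proof -
  let ?F = "free_product V G" and ?N = "normal_closure (free_product V G) (edge_commutators V E G)"
  have F: "group ?F" using group_free_product vertex_group by blast
  obtain \<psi> where \<psi>: "\<psi> \<in> hom ?F K"
    "\<And>v g. \<lbrakk>v \<in> V; g \<in> carrier (G v)\<rbrakk> \<Longrightarrow> \<psi> (fp_incl V G v g) = f v g"
    using free_product_universal[of K V f G] K f vertex_group by blast
  interpret \<psi>: group_hom ?F K \<psi>
    using \<psi>(1) F K by (simp add: group_hom_def group_hom_axioms_def)
  have "edge_commutators V E G \<subseteq> kernel ?F K \<psi>"
  proof
    fix c assume "c \<in> edge_commutators V E G"
    then obtain u v g h where c: "c = commutator ?F (fp_incl V G u g) (fp_incl V G v h)"
      and e: "{u, v} \<in> E" and g: "g \<in> carrier (G u)" "h \<in> carrier (G v)"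
      by (auto simp: edge_commutators_def)
    have uv: "u \<in> V" "v \<in> V" "u \<noteq> v"
      using simplicial e by (auto simp: simplicial_graph_def)
    have cl [simp]: "fp_incl V G u g \<in> carrier ?F" "fp_incl V G v h \<in> carrier ?F"
      using g uv by (simp_all add: fp_incl_def)
    have fcl: "f u g \<in> carrier K" "f v h \<in> carrier K"
      using f g uv by (auto simp: hom_def)
    have "\<psi> c = commutator K (f u g) (f v h)"
      using g uv by (simp add: c commutator_def \<psi>(2))
    also have "\<dots> = \<one>\<^bsub>K\<^esub>"
      using comm[OF e uv g] fcl by (simp add: \<psi>.H.commutator_eq_one_iff)
    finally show "c \<in> kernel ?F K \<psi>"
      by (simp add: kernel_def c commutator_def)
  qed
  then have "?N \<subseteq> kernel ?F K \<psi>"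
    unfolding normal_closure_def using \<psi>.normal_kernel by blast
  then obtain \<theta> where \<theta>: "\<theta> \<in> hom (?F Mod ?N) K" "\<And>x. x \<in> carrier ?F \<Longrightarrow> \<theta> (?N #>\<^bsub>?F\<^esub> x) = \<psi> x"
    using \<psi>.FactGroup_universal_kernel[OF normal_edge_closure] by metis
  show thesis
  proof (rule that[of \<theta>])
    show "\<theta> \<in> hom \<Gamma> K" using \<theta> by (simp add: graph_product_def)
    show "\<theta> (\<iota> v g) = f v g" if "v \<in> V" "g \<in> carrier (G v)" for v g
      using that \<theta>(2)[of "fp_incl V G v g"] by (simp add: vertex_incl_def fp_incl_def[of V G v g] \<psi>(2)[unfolded fp_incl_def])
  qed
qed

end

section \<open>Ping-pong\<close>

locale set_action = group K for K (structure) +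
  fixes \<Omega> :: "'x set" and act :: "'a \<Rightarrow> 'x \<Rightarrow> 'x"
  assumes act_closed: "\<lbrakk>g \<in> carrier K; \<eta> \<in> \<Omega>\<rbrakk> \<Longrightarrow> act g \<eta> \<in> \<Omega>"
    and act_mult: "\<lbrakk>g \<in> carrier K; h \<in> carrier K; \<eta> \<in> \<Omega>\<rbrakk> \<Longrightarrow> act (g \<otimes> h) \<eta> = act g (act h \<eta>)"
    and act_one: "\<eta> \<in> \<Omega> \<Longrightarrow> act \<one> \<eta> = \<eta>"
begin

text \<open>Positive and negative powers get separate targets \<open>D\<close> and
  \<open>D'\<close>, because the products of two players used below attract forwards and backwards
  to different sets.\<close>

lemma act_int_pow:
  fixes n :: int
  assumes x: "x \<in> carrier K" and sub: "S \<subseteq> \<Omega>" "D \<subseteq> \<Omega>" "D' \<subseteq> \<Omega>"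
    and pos: "\<And>\<eta>. \<eta> \<in> S \<union> D \<Longrightarrow> act x \<eta> \<in> D"
    and neg: "\<And>\<eta>. \<eta> \<in> S \<union> D' \<Longrightarrow> act (inv x) \<eta> \<in> D'"
    and "n \<noteq> 0" "\<eta> \<in> S"
  shows "act (x [^] n) \<eta> \<in> D \<union> D'"
proof -
  have iter: "act (y [^] Suc k) \<eta> \<in> C"
    if "y \<in> carrier K" "C \<subseteq> \<Omega>" "\<And>\<eta>. \<eta> \<in> S \<union> C \<Longrightarrow> act y \<eta> \<in> C" for y C and k :: nat
  proof (induction k)
    case 0
    then show ?case using that assms(8) by simp
  next
    case (Suc k)
    have "act (y [^] Suc (Suc k)) \<eta> = act (y \<otimes> y [^] Suc k) \<eta>"
      using nat_pow_Suc2[OF that(1), of "Suc k"] by simp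
    also have "\<dots> = act y (act (y [^] Suc k) \<eta>)"
      using that assms(8) sub by (intro act_mult) auto
    finally show ?case using that Suc by simp
  qed
  show ?thesis
  proof (cases "n > 0")
    case True
    then obtain k where "n = int (Suc k)" using zero_less_imp_eq_int by (metis gr0_implies_Suc)
    then have "x [^] n = x [^] Suc k" by (metis int_pow_int)
    then show ?thesis using iter[OF x sub(2) pos, of k] by simp
  next
    case False
    then have "- n > 0" using \<open>n \<noteq> 0\<close> by simp
    then obtain k where "- n = int (Suc k)" using zero_less_imp_eq_int by (metis gr0_implies_Suc)
    then have "x [^] n = (inv x) [^] Suc k"
      using x by (metis add.inverse_inverse int_pow_neg_int nat_pow_inv)
    then show ?thesis using iter[OF inv_closed[OF x] sub(3) neg, of k] by simp
  qed
qed

end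

text \<open>A property of elements instead of words: some alternating product of non-trivial
  syllables, starting in factor \<open>i\<close>, represents the element. That such elements are
  non-trivial is left to ping-pong.\<close>

inductive fp_alternating for I G where
  "\<lbrakk>i \<in> I; g \<in> carrier (G i); g \<noteq> \<one>\<^bsub>G i\<^esub>; x = \<one>\<^bsub>free_product I G\<^esub> \<or> (j \<noteq> i \<and> fp_alternating I G j x)\<rbrakk>
   \<Longrightarrow> fp_alternating I G i (fp_incl I G i g \<otimes>\<^bsub>free_product I G\<^esub> x)"

lemma fp_alternating_closed:
  assumes "fp_alternating I G i x" "\<And>i. i \<in> I \<Longrightarrow> group (G i)"
  shows "i \<in> I \<and> x \<in> carrier (free_product I G)"
  using assms(1)
proof induction
  case (1 i g x j)
  interpret group "free_product I G" using group_free_product assms by blast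
  have "fp_incl I G i g \<in> carrier (free_product I G)" using 1 by (simp add: fp_incl_def)
  moreover have "x \<in> carrier (free_product I G)"
    using 1(4) by (elim disjE) simp_all
  ultimately show ?case using 1(1) by simp
qed

text \<open>A letter put in front merges with a leading syllable of the same factor, which may
  vanish, or becomes a new syllable.\<close>

lemma fp_alternating_exhaust:
  assumes G: "\<And>i. i \<in> I \<Longrightarrow> group (G i)" and "x \<in> carrier (free_product I G)"
  shows "x = \<one>\<^bsub>free_product I G\<^esub> \<or> (\<exists>i. fp_alternating I G i x)"
  using assms(2)
proof (induction rule: fp_induct)
  case one
  then show ?case by simp
next
  case (incl i g x)
  let ?F = "free_product I G"
  interpret F: group ?F using group_free_product G by blast
  interpret Gi: group "G i" using G incl by blast
  have hom: "fp_incl I G i \<in> hom (G i) ?F"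
    using fp_incl_hom[of i I G] incl(1) G[OF incl(1)] by simp
  have i1: "fp_incl I G i \<one>\<^bsub>G i\<^esub> = \<one>\<^bsub>?F\<^esub>"
    using hom_one[OF hom Gi.is_group F.is_group] .
  show ?case
  proof (cases "g = \<one>\<^bsub>G i\<^esub>")
    case True
    then show ?thesis using incl i1 by simp
  next
    case False
    show ?thesis
    \<comment> \<open>The test ranges over all expressions of \<open>x\<close>, as its first factor
      is not known to be unique; a trivial \<open>g'\<close> covers \<open>x\<close> being the
      identity.\<close>
    proof (cases "\<exists>y g'. x = fp_incl I G i g' \<otimes>\<^bsub>?F\<^esub> y \<and> g' \<in> carrier (G i) \<and>
        (y = \<one>\<^bsub>?F\<^esub> \<or> (\<exists>j. j \<noteq> i \<and> fp_alternating I G j y))")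
      case True
      then obtain y g' where y: "x = fp_incl I G i g' \<otimes>\<^bsub>?F\<^esub> y" "g' \<in> carrier (G i)"
        "y = \<one>\<^bsub>?F\<^esub> \<or> (\<exists>j. j \<noteq> i \<and> fp_alternating I G j y)" by blast
      have yc: "y \<in> carrier ?F" using y(3) fp_alternating_closed[of I G _ y] G by auto
      have "fp_incl I G i g \<otimes>\<^bsub>?F\<^esub> x = fp_incl I G i g \<otimes>\<^bsub>?F\<^esub> fp_incl I G i g' \<otimes>\<^bsub>?F\<^esub> y"
        using y incl yc hom_in_carrier[OF hom] by (simp add: F.m_assoc)
      also have "\<dots> = fp_incl I G i (g \<otimes>\<^bsub>G i\<^esub> g') \<otimes>\<^bsub>?F\<^esub> y"
        using hom_mult[OF hom] incl y by simp
      finally have eq: "fp_incl I G i g \<otimes>\<^bsub>?F\<^esub> x = fp_incl I G i (g \<otimes>\<^bsub>G i\<^esub> g') \<otimes>\<^bsub>?F\<^esub> y" .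
      show ?thesis
      proof (cases "g \<otimes>\<^bsub>G i\<^esub> g' = \<one>\<^bsub>G i\<^esub>")
        case True
        then show ?thesis using eq i1 yc y(3) by auto
      next
        case False
        have "fp_alternating I G i (fp_incl I G i (g \<otimes>\<^bsub>G i\<^esub> g') \<otimes>\<^bsub>?F\<^esub> y)"
          using y(3) incl y(2) False by (auto intro: fp_alternating.intros)
        then show ?thesis using eq by auto
      qed
    next
      case nx: False
      have "x = \<one>\<^bsub>?F\<^esub> \<or> (\<exists>j. j \<noteq> i \<and> fp_alternating I G j x)"
      proof (rule ccontr)
        assume "\<not> ?thesis"
        then have "fp_alternating I G i x" using incl(4) by metis
        then show False using nx by (cases) blast
      qed
      then have "fp_alternating I G i (fp_incl I G i g \<otimes>\<^bsub>?F\<^esub> x)"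
        using incl False by (auto intro: fp_alternating.intros)
      then show ?thesis by blast
    qed
  qed
qed

text \<open>An alternating element carries \<open>b\<close> into the set of its first factor, which
  does not contain \<open>b\<close>; so it is not in the kernel.\<close>

lemma (in set_action) free_product_ping_pong:
  assumes G: "\<And>i. i \<in> I \<Longrightarrow> group (G i)" and \<theta>: "\<theta> \<in> hom (free_product I G) K"
    and D: "\<And>i. i \<in> I \<Longrightarrow> D i \<subseteq> \<Omega>" and b: "b \<in> \<Omega>" "\<And>i. i \<in> I \<Longrightarrow> b \<notin> D i"
    and pp: "\<And>i g \<eta>. \<lbrakk>i \<in> I; g \<in> carrier (G i); g \<noteq> \<one>\<^bsub>G i\<^esub>; \<eta> = b \<or> (\<exists>j\<in>I. j \<noteq> i \<and> \<eta> \<in> D j)\<rbrakk>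
      \<Longrightarrow> act (\<theta> (fp_incl I G i g)) \<eta> \<in> D i"
  shows "inj_on \<theta> (carrier (free_product I G))"
proof -
  let ?F = "free_product I G"
  have F: "group ?F" using group_free_product G by blast
  interpret \<theta>: group_hom ?F K \<theta>
    using F \<theta> is_group by (simp add: group_hom_def group_hom_axioms_def)
  have alt: "act (\<theta> x) b \<in> D i" if "fp_alternating I G i x" for i x
    using that
  proof induction
    case (1 i g x j)
    have c: "fp_incl I G i g \<in> carrier ?F" using 1 by (simp add: fp_incl_def)
    have x: "x \<in> carrier ?F" "x = \<one>\<^bsub>?F\<^esub> \<or> j \<in> I"
      using 1(4) fp_alternating_closed[of I G j x] G by auto
    have "act (\<theta> (fp_incl I G i g \<otimes>\<^bsub>?F\<^esub> x)) b = act (\<theta> (fp_incl I G i g)) (act (\<theta> x) b)"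
      using c x b by (simp add: act_mult)
    moreover have "act (\<theta> x) b = b \<or> (\<exists>j\<in>I. j \<noteq> i \<and> act (\<theta> x) b \<in> D j)"
      using 1(4) x(2) b act_one by auto
    ultimately show ?case using pp 1 by simp
  qed
  have "x = \<one>\<^bsub>?F\<^esub>" if x: "x \<in> carrier ?F" "\<theta> x = \<one>" for x
  proof (rule ccontr)
    assume "x \<noteq> \<one>\<^bsub>?F\<^esub>"
    then obtain i where i: "fp_alternating I G i x" using fp_alternating_exhaust[of I G x] G x by blast
    then have "b \<in> D i" using alt[OF i] x b act_one by simp
    then show False using b fp_alternating_closed[OF i] G by blast
  qed
  then show ?thesis using \<theta>.inj_on_one_iff by blast
qed

text \<open>The pair \<open>p \<otimes> q\<close>, \<open>p \<otimes> r\<close> is free even if \<open>p\<close>, \<open>q\<close>, \<open>r\<close> are involutions.\<close>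

lemma (in set_action) full_sized_ping_pong:
  assumes c: "p \<in> carrier K" "q \<in> carrier K" "r \<in> carrier K"
    and sub: "P \<subseteq> \<Omega>" "Q \<subseteq> \<Omega>" "R \<subseteq> \<Omega>" and disj: "P \<inter> Q = {}" "P \<inter> R = {}" "Q \<inter> R = {}"
    and b: "b \<in> \<Omega>" "b \<notin> P" "b \<notin> Q" "b \<notin> R"
    and p: "\<And>\<eta>. \<eta> \<in> \<Omega> - P \<Longrightarrow> act p \<eta> \<in> P" "\<And>\<eta>. \<eta> \<in> \<Omega> - P \<Longrightarrow> act (inv p) \<eta> \<in> P"
    and q: "\<And>\<eta>. \<eta> \<in> \<Omega> - Q \<Longrightarrow> act q \<eta> \<in> Q" "\<And>\<eta>. \<eta> \<in> \<Omega> - Q \<Longrightarrow> act (inv q) \<eta> \<in> Q"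
    and r: "\<And>\<eta>. \<eta> \<in> \<Omega> - R \<Longrightarrow> act r \<eta> \<in> R" "\<And>\<eta>. \<eta> \<in> \<Omega> - R \<Longrightarrow> act (inv r) \<eta> \<in> R"
  shows "full_sized K"
proof -
  define f where "f = (\<lambda>t (n::int). (if t then p \<otimes> q else p \<otimes> r) [^] n)"
  have f: "f t \<in> hom integer_group K" for t
    using c by (auto simp: f_def hom_def int_pow_mult)
  obtain \<theta> where \<theta>: "\<theta> \<in> hom (free_group (UNIV :: bool set)) K"
    and \<theta>': "\<And>t n. \<lbrakk>t \<in> UNIV; n \<in> carrier integer_group\<rbrakk> \<Longrightarrow> \<theta> (fp_incl UNIV (\<lambda>_. integer_group) t n) = f t n"
    unfolding free_group_def
    using free_product_universal[OF is_group, of "UNIV :: bool set" f "\<lambda>_. integer_group"] f group_integer_group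
    by metis
  \<comment> \<open>Negative powers of \<open>p \<otimes> q\<close> will end in \<open>Q\<close> and
    positive ones in its image under \<open>p\<close>; the same holds with \<open>r\<close> and
    \<open>R\<close>.\<close>
  define D where "D = (\<lambda>t. act p ` (if t then Q else R) \<union> (if t then Q else R))"
  have inv_act: "act (inv p) (act p \<eta>) = \<eta>" if "\<eta> \<in> \<Omega>" for \<eta>
    using that c act_mult[of "inv p" p \<eta>] act_one by simp
  \<comment> \<open>Generalized over \<open>q\<close>, \<open>Q\<close> and \<open>R\<close>, since
    it serves a second time with \<open>r\<close> and \<open>R\<close> in the place of
    \<open>q\<close> and \<open>Q\<close>.\<close>
  have key: "act ((p \<otimes> q) [^] n) \<eta> \<in> act p ` Q \<union> Q"
    if h: "n \<noteq> 0" "\<eta> \<in> act p ` R \<union> R \<union> {b}" and c: "q \<in> carrier K"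
      and sub: "Q \<subseteq> \<Omega>" "R \<subseteq> \<Omega>" and disj: "P \<inter> Q = {}" "P \<inter> R = {}" "Q \<inter> R = {}"
      and b: "b \<notin> Q" "b \<notin> R"
      and q: "\<And>\<eta>. \<eta> \<in> \<Omega> - Q \<Longrightarrow> act q \<eta> \<in> Q" "\<And>\<eta>. \<eta> \<in> \<Omega> - Q \<Longrightarrow> act (inv q) \<eta> \<in> Q"
    for n :: int and q Q R \<eta>
  proof (rule act_int_pow[where S = "act p ` R \<union> R \<union> {b}"])
    show "p \<otimes> q \<in> carrier K" using c \<open>p \<in> carrier K\<close> by simp
    have pQ: "act p ` Q \<subseteq> P" "act p ` R \<subseteq> P" using p(1) disj sub by blast+
    show "act p ` R \<union> R \<union> {b} \<subseteq> \<Omega>" "act p ` Q \<subseteq> \<Omega>" "Q \<subseteq> \<Omega>"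
      using pQ sub assms(4) assms(10) by auto
    fix \<eta>
    {
      assume "\<eta> \<in> act p ` R \<union> R \<union> {b} \<union> act p ` Q"
      then have "\<eta> \<in> \<Omega> - Q" using pQ sub assms(4) assms(10) disj b by auto
      moreover have "act (p \<otimes> q) \<eta> = act p (act q \<eta>)"
        using calculation c \<open>p \<in> carrier K\<close> by (simp add: act_mult)
      ultimately show "act (p \<otimes> q) \<eta> \<in> act p ` Q" using q(1) by auto
    next
      assume \<eta>: "\<eta> \<in> act p ` R \<union> R \<union> {b} \<union> Q"
      have "\<eta> \<in> \<Omega>" using \<eta> pQ sub assms(4) assms(10) by auto
      then have eq: "act (inv (p \<otimes> q)) \<eta> = act (inv q) (act (inv p) \<eta>)"
        using c \<open>p \<in> carrier K\<close> by (simp add: act_mult inv_mult_group)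
      \<comment> \<open>Points in the image of \<open>R\<close> under \<open>p\<close> return to
        \<open>R\<close>; all others lie outside \<open>P\<close>, so \<open>inv p\<close> throws
        them into \<open>P\<close>. Both sets are disjoint from \<open>Q\<close>.\<close>
      have "act (inv p) \<eta> \<in> \<Omega> - Q"
      proof (cases "\<eta> \<in> act p ` R")
        case True
        then have "act (inv p) \<eta> \<in> R" using inv_act sub by auto
        then show ?thesis using sub disj by blast
      next
        case False
        then have "\<eta> \<notin> P" using \<eta> disj assms(11) by blast
        then have "act (inv p) \<eta> \<in> P" using p(2) \<open>\<eta> \<in> \<Omega>\<close> by blast
        then show ?thesis using assms(4) disj by blast
      qed
      then show "act (inv (p \<otimes> q)) \<eta> \<in> Q" using eq q(2) by simp
    }
  qed (use h in auto)
  have "inj_on \<theta> (carrier (free_product UNIV (\<lambda>_::bool. integer_group)))"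
  proof (rule free_product_ping_pong[where D = D and b = b])
    fix t :: bool and n :: int and \<eta>
    assume "n \<in> carrier integer_group" "n \<noteq> \<one>\<^bsub>integer_group\<^esub>"
      and "\<eta> = b \<or> (\<exists>s\<in>UNIV. s \<noteq> t \<and> \<eta> \<in> D s)"
    then have n: "n \<noteq> 0" and \<eta>: "\<eta> \<in> D (\<not> t) \<union> {b}"
      by auto
    have "act (f t n) \<eta> \<in> D t"
    proof (cases t)
      case True
      have "act ((p \<otimes> q) [^] n) \<eta> \<in> act p ` Q \<union> Q"
        by (rule key[OF n _ c(2) sub(2) sub(3) disj b(3) b(4) q]) (use \<eta> True in \<open>auto simp: D_def\<close>)
      then show ?thesis using True by (simp add: f_def D_def)
    next
      case False
      have "act ((p \<otimes> r) [^] n) \<eta> \<in> act p ` R \<union> R"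
        by (rule key[OF n _ c(3) sub(3) sub(2) disj(2) disj(1) _ b(4) b(3) r]) (use \<eta> False disj in \<open>auto simp: D_def\<close>)
      then show ?thesis using False by (simp add: f_def D_def)
    qed
    then show "act (\<theta> (fp_incl UNIV (\<lambda>_. integer_group) t n)) \<eta> \<in> D t"
      using \<theta>' by simp
  next
    show "\<theta> \<in> hom (free_product UNIV (\<lambda>_::bool. integer_group)) K"
      using \<theta> by (simp add: free_group_def)
    have pQ: "act p ` Q \<subseteq> P" "act p ` R \<subseteq> P" using p(1) disj sub by blast+
    then show "D t \<subseteq> \<Omega>" "b \<notin> D t" for t
      using sub b by (auto simp: D_def)
  qed (use b in auto)
  then show ?thesis
    using full_sizedI[OF is_group \<theta>] by (simp add: free_group_def)
qed

section \<open>Retractions and parabolic subgroups\<close>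

context graph_product_data
begin

lemma retraction_exists:
  "\<exists>\<rho> \<in> hom \<Gamma> \<Gamma>. \<forall>v\<in>V. \<forall>g\<in>carrier (G v). \<rho> (\<iota> v g) = (if v \<in> A then \<iota> v g else \<one>\<^bsub>\<Gamma>\<^esub>)"
proof -
  let ?f = "\<lambda>v g. if v \<in> A then \<iota> v g else \<one>\<^bsub>\<Gamma>\<^esub>"
  have hom: "?f v \<in> hom (G v) \<Gamma>" if "v \<in> V" for v
    using that by (auto intro!: homI simp: incl_mult)
  have comm: "?f u g \<otimes>\<^bsub>\<Gamma>\<^esub> ?f v h = ?f v h \<otimes>\<^bsub>\<Gamma>\<^esub> ?f u g"
    if "{u, v} \<in> E" "u \<in> V" "v \<in> V" "g \<in> carrier (G u)" "h \<in> carrier (G v)" for u v g h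
    using that edge_commute[OF that(1,4,5)] by auto
  show ?thesis
  proof (rule graph_product_universal[OF GP.is_group, where f = ?f])
    fix \<rho> assume "\<rho> \<in> hom \<Gamma> \<Gamma>" "\<And>v g. \<lbrakk>v \<in> V; g \<in> carrier (G v)\<rbrakk> \<Longrightarrow> \<rho> (\<iota> v g) = ?f v g"
    then show ?thesis by (intro bexI[of _ \<rho>]) simp_all
  qed (rule hom comm; assumption)+
qed

definition retr :: "'v set \<Rightarrow> ('v \<times> 'g) list set set \<Rightarrow> ('v \<times> 'g) list set set" where
  "retr A = (SOME \<rho>. \<rho> \<in> hom \<Gamma> \<Gamma> \<and>
    (\<forall>v\<in>V. \<forall>g\<in>carrier (G v). \<rho> (\<iota> v g) = (if v \<in> A then \<iota> v g else \<one>\<^bsub>\<Gamma>\<^esub>)))"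

lemma retr: "retr A \<in> hom \<Gamma> \<Gamma> \<and>
    (\<forall>v\<in>V. \<forall>g\<in>carrier (G v). retr A (\<iota> v g) = (if v \<in> A then \<iota> v g else \<one>\<^bsub>\<Gamma>\<^esub>))"
  unfolding retr_def using retraction_exists[of A, unfolded Bex_def] by (rule someI_ex)

lemma retr_incl [simp]:
  "\<lbrakk>v \<in> V; g \<in> carrier (G v)\<rbrakk> \<Longrightarrow> retr A (\<iota> v g) = (if v \<in> A then \<iota> v g else \<one>\<^bsub>\<Gamma>\<^esub>)"
  using retr by simp

sublocale retr: group_hom \<Gamma> \<Gamma> "retr A" for A
  using retr GP.is_group by (simp add: group_hom_def group_hom_axioms_def)

text \<open>Deleting vertices one at a time amounts to deleting them together;
  \<open>central_trivial\<close> exploits this.\<close>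

lemma retr_retr [simp]: "x \<in> carrier \<Gamma> \<Longrightarrow> retr A (retr B x) = retr (A \<inter> B) x"
  by (induction rule: graph_product_induct) simp_all

lemma retr_all: "x \<in> carrier \<Gamma> \<Longrightarrow> V \<subseteq> A \<Longrightarrow> retr A x = x"
  by (induction rule: graph_product_induct) auto

lemma retr_empty [simp]: "x \<in> carrier \<Gamma> \<Longrightarrow> retr {} x = \<one>\<^bsub>\<Gamma>\<^esub>"
  by (induction rule: graph_product_induct) auto

text \<open>Defined by fixed points, so that membership is an equation to which homomorphisms can be
  applied; \<open>par_generate\<close> identifies it with the subgroup generated by the vertex
  groups.\<close>

definition par :: "'v set \<Rightarrow> ('v \<times> 'g) list set set set" where
  "par A = {x \<in> carrier \<Gamma>. retr A x = x}"

lemma subgroup_par: "subgroup (par A) \<Gamma>"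
  by (rule GP.subgroupI) (auto simp: par_def intro!: exI[of _ "\<one>\<^bsub>\<Gamma>\<^esub>"])

lemma par_carrier: "x \<in> par A \<Longrightarrow> x \<in> carrier \<Gamma>"
  by (simp add: par_def)

lemma retr_par [simp]: "x \<in> carrier \<Gamma> \<Longrightarrow> retr A x \<in> par A"
  by (simp add: par_def)

lemma incl_par [simp]: "\<lbrakk>v \<in> V; v \<in> A; g \<in> carrier (G v)\<rbrakk> \<Longrightarrow> \<iota> v g \<in> par A"
  by (simp add: par_def)

text \<open>An element of \<open>par A\<close> equals its own retraction, and retracting a word
  deletes the letters outside \<open>A\<close>.\<close>

lemma par_induct [consumes 1, case_names one incl]:
  assumes "x \<in> par A" and one: "P \<one>\<^bsub>\<Gamma>\<^esub>"
    and incl: "\<And>v g x. \<lbrakk>v \<in> V; v \<in> A; g \<in> carrier (G v); x \<in> par A; P x\<rbrakk> \<Longrightarrow> P (\<iota> v g \<otimes>\<^bsub>\<Gamma>\<^esub> x)"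
  shows "P x"
proof -
  have "P (retr A x)" if "x \<in> carrier \<Gamma>" for x
    using that by (induction rule: graph_product_induct) (auto simp: one incl)
  then have "P (retr A x)" using assms(1) par_carrier by blast
  then show ?thesis using assms(1) by (simp add: par_def)
qed

lemma retr_disjoint: "\<lbrakk>x \<in> par A; A \<inter> B = {}\<rbrakk> \<Longrightarrow> retr B x = \<one>\<^bsub>\<Gamma>\<^esub>"
  using retr_retr[of x B A] retr_empty by (simp add: par_def Int_commute)

lemma par_commute:
  assumes "x \<in> par A" "y \<in> par B" and AB: "\<And>a b. \<lbrakk>a \<in> A; b \<in> B\<rbrakk> \<Longrightarrow> {a, b} \<in> E"
  shows "x \<otimes>\<^bsub>\<Gamma>\<^esub> y = y \<otimes>\<^bsub>\<Gamma>\<^esub> x"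
proof -
  have swap: "(a \<otimes>\<^bsub>\<Gamma>\<^esub> b) \<otimes>\<^bsub>\<Gamma>\<^esub> z = z \<otimes>\<^bsub>\<Gamma>\<^esub> (a \<otimes>\<^bsub>\<Gamma>\<^esub> b)"
    if "a \<otimes>\<^bsub>\<Gamma>\<^esub> z = z \<otimes>\<^bsub>\<Gamma>\<^esub> a" "b \<otimes>\<^bsub>\<Gamma>\<^esub> z = z \<otimes>\<^bsub>\<Gamma>\<^esub> b" "a \<in> carrier \<Gamma>" "b \<in> carrier \<Gamma>" "z \<in> carrier \<Gamma>"
    for a b z
    using that by (metis GP.m_assoc)
  have "x \<otimes>\<^bsub>\<Gamma>\<^esub> \<iota> v h = \<iota> v h \<otimes>\<^bsub>\<Gamma>\<^esub> x" if "v \<in> V" "v \<in> B" "h \<in> carrier (G v)" for v h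
    using assms(1)
  proof (induction rule: par_induct)
    case one
    then show ?case using that by simp
  next
    case (incl u g x)
    then show ?case
      using that edge_commute[of u v g h] AB par_carrier by (intro swap) auto
  qed
  note gen = this
  show ?thesis
    using assms(2)
  proof (induction rule: par_induct)
    case one
    then show ?case using assms(1) par_carrier by simp
  next
    case (incl u g y)
    then show ?case
      using gen assms(1) par_carrier by (intro swap[symmetric]) auto
  qed
qed

lemma par_generate:
  assumes "A \<subseteq> V"
  shows "generate \<Gamma> (\<Union>v\<in>A. \<iota> v ` carrier (G v)) = par A"
proof
  let ?S = "\<Union>v\<in>A. \<iota> v ` carrier (G v)"
  show "generate \<Gamma> ?S \<subseteq> par A"
    using assms by (intro GP.generate_subgroup_incl subgroup_par) auto
  show "par A \<subseteq> generate \<Gamma> ?S"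
  proof
    fix x assume "x \<in> par A"
    then show "x \<in> generate \<Gamma> ?S"
    proof (induction rule: par_induct)
      case one
      then show ?case by (rule generate.one)
    next
      case (incl v g x)
      then have "\<iota> v g \<in> generate \<Gamma> ?S" by (intro generate.incl) blast
      then show ?case using incl by (intro generate.eng)
    qed
  qed
qed

lemma special_parabolic_eq:
  assumes "A \<subseteq> V"
  shows "special_parabolic V E G A = \<Gamma>\<lparr>carrier := par A\<rparr>"
proof -
  have "carrier \<Gamma> \<inter> (\<Union>v\<in>A. \<iota> v ` carrier (G v)) = (\<Union>v\<in>A. \<iota> v ` carrier (G v))"
    using assms by auto
  then show ?thesis
    using par_generate[OF assms] by (simp add: special_parabolic_def subgroup_generated_def)
qed

text \<open>The universal property, with trivial maps on all other vertices. It shows that vertex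
  groups survive in the quotient.\<close>

lemma vertex_projection:
  assumes "v \<in> V"
  obtains \<pi> where "\<pi> \<in> hom \<Gamma> (G v)"
    "\<And>g. g \<in> carrier (G v) \<Longrightarrow> \<pi> (\<iota> v g) = g"
    "\<And>u g. \<lbrakk>u \<in> V; u \<noteq> v; g \<in> carrier (G u)\<rbrakk> \<Longrightarrow> \<pi> (\<iota> u g) = \<one>\<^bsub>G v\<^esub>"
proof -
  interpret v: group "G v" using assms vertex_group by blast
  let ?f = "\<lambda>u g. if u = v then g else \<one>\<^bsub>G v\<^esub>"
  have hom: "?f u \<in> hom (G u) (G v)" for u
    by (cases "u = v") (auto intro!: homI)
  have comm: "?f u g \<otimes>\<^bsub>G v\<^esub> ?f w h = ?f w h \<otimes>\<^bsub>G v\<^esub> ?f u g"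
    if "u \<noteq> w" "g \<in> carrier (G u)" "h \<in> carrier (G w)" for u w g h
    using that by auto
  show thesis
  proof (rule graph_product_universal[OF v.is_group, where f = ?f])
    fix \<pi> assume "\<pi> \<in> hom \<Gamma> (G v)" "\<And>u g. \<lbrakk>u \<in> V; g \<in> carrier (G u)\<rbrakk> \<Longrightarrow> \<pi> (\<iota> u g) = ?f u g"
    then show thesis using assms by (intro that[of \<pi>]) simp_all
  qed (rule hom comm; assumption)+
qed

lemma incl_inj: "v \<in> V \<Longrightarrow> inj_on (\<iota> v) (carrier (G v))"
  by (rule vertex_projection) (auto intro: inj_on_inverseI)

lemma incl_eq_one_iff: "\<lbrakk>v \<in> V; g \<in> carrier (G v)\<rbrakk> \<Longrightarrow> \<iota> v g = \<one>\<^bsub>\<Gamma>\<^esub> \<longleftrightarrow> g = \<one>\<^bsub>G v\<^esub>"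
  using inj_on_eq_iff[OF incl_inj, of v g "\<one>\<^bsub>G v\<^esub>"] vertex_group[of v, THEN group.is_monoid, THEN monoid.one_closed]
  by simp

lemma par_singleton:
  assumes v: "v \<in> V"
  shows "par {v} = \<iota> v ` carrier (G v)"
proof
  interpret v: group "G v" using assms vertex_group by blast
  show "par {v} \<subseteq> \<iota> v ` carrier (G v)"
  proof
    fix x assume "x \<in> par {v}"
    then show "x \<in> \<iota> v ` carrier (G v)"
    proof (induction rule: par_induct)
      case one
      then show ?case using v incl_one[of v] by (metis imageI v.one_closed)
    next
      case (incl u g x)
      then show ?case using v by (auto simp flip: incl_mult)
    qed
  qed
  show "\<iota> v ` carrier (G v) \<subseteq> par {v}" using v by auto
qed

end

section \<open>Joins and the infinite dihedral group\<close>

context graph_product_data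
begin

text \<open>The group is trivial, hence the product of the empty family indexed by
  \<open>{1..0}\<close>, for which properness of the factors is vacuous.\<close>

lemma empty_decomposable:
  assumes "V = {}"
  shows "directly_decomposable V E G"
proof -
  have "x = \<one>\<^bsub>\<Gamma>\<^esub>" if "x \<in> carrier \<Gamma>" for x
    using that by (induction rule: graph_product_induct) (simp_all add: assms)
  then have c: "carrier \<Gamma> = {\<one>\<^bsub>\<Gamma>\<^esub>}" by blast
  have "(\<lambda>_. \<one>\<^bsub>\<Gamma>\<^esub>) \<in> iso (product_group {1..0::nat} (\<lambda>i. special_parabolic V E G {})) \<Gamma>"
    by (auto simp: iso_def hom_def bij_betw_def inj_on_def c)
  then have "internal_direct_product \<Gamma> {1..0::nat} (\<lambda>i. special_parabolic V E G {})"
    unfolding internal_direct_product_def by (intro bexI) auto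
  then show ?thesis
    unfolding directly_decomposable_def parabolic_decomposition_def
    by (intro exI[of _ 0] exI[of _ "\<lambda>_. {}"]) simp
qed

text \<open>The two retractions recover the components, which gives injectivity; surjectivity comes
  from moving letters of \<open>B\<close> past the part in \<open>A\<close>. Both factors are proper
  because the vertex groups on the other side are non-trivial.\<close>

lemma join_decomposable:
  assumes V: "V = A \<union> B" "A \<inter> B = {}" "A \<noteq> {}" "B \<noteq> {}"
    and edges: "\<And>a b. \<lbrakk>a \<in> A; b \<in> B\<rbrakk> \<Longrightarrow> {a, b} \<in> E"
    and nontrivial: "\<And>v. v \<in> V \<Longrightarrow> \<not> trivial_group (G v)"
  shows "directly_decomposable V E G"
proof -
  define W where "W = (\<lambda>i::nat. if i = 1 then A else B)"
  define H where "H = (\<lambda>i. special_parabolic V E G (W i))"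
  have H: "H i = \<Gamma>\<lparr>carrier := par (W i)\<rparr>" for i
    unfolding H_def W_def using V by (intro special_parabolic_eq) auto
  have I: "{1..2} = {1, 2::nat}" by auto
  define \<phi> where "\<phi> = (\<lambda>f::nat \<Rightarrow> _. f 1 \<otimes>\<^bsub>\<Gamma>\<^esub> f 2)"
  have f12: "f 1 \<in> par A" "f 2 \<in> par B" if "f \<in> carrier (product_group {1..2} H)" for f
    using PiE_mem[of f "{1..2}" "\<lambda>i. carrier (H i)" 1] PiE_mem[of f "{1..2}" "\<lambda>i. carrier (H i)" 2] that
    by (simp_all add: H W_def)
  have proper: "par (W i) \<noteq> carrier \<Gamma>" for i
  proof
    assume eq: "par (W i) = carrier \<Gamma>"
    obtain v where v: "v \<in> V" "v \<notin> W i" using V unfolding W_def by (cases "i = 1") auto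
    then obtain g where g: "g \<in> carrier (G v)" "g \<noteq> \<one>\<^bsub>G v\<^esub>"
      using nontrivial[OF v(1)] vertex_group[OF v(1)] unfolding trivial_group_def
      by (metis group.is_monoid insertI1 monoid.one_closed singletonD subsetI subset_antisym)
    have "\<iota> v g \<in> par (W i)" using eq v g by simp
    then show False using v g incl_eq_one_iff by (auto simp: par_def)
  qed
  have "\<phi> \<in> hom (product_group {1..2} H) \<Gamma>"
  proof (rule homI)
    fix f assume f: "f \<in> carrier (product_group {1..2} H)"
    note f' = f12[OF f] f12[OF f, THEN par_carrier]
    then show "\<phi> f \<in> carrier \<Gamma>" by (simp add: \<phi>_def)
    fix h assume h: "h \<in> carrier (product_group {1..2} H)"
    note h' = f12[OF h] f12[OF h, THEN par_carrier]
    have "\<phi> (f \<otimes>\<^bsub>product_group {1..2} H\<^esub> h) = f 1 \<otimes>\<^bsub>\<Gamma>\<^esub> (h 1 \<otimes>\<^bsub>\<Gamma>\<^esub> f 2) \<otimes>\<^bsub>\<Gamma>\<^esub> h 2"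
      using f' h' by (simp add: \<phi>_def H GP.m_assoc)
    also have "h 1 \<otimes>\<^bsub>\<Gamma>\<^esub> f 2 = f 2 \<otimes>\<^bsub>\<Gamma>\<^esub> h 1"
      using par_commute[OF h'(1) f'(2) edges] .
    finally show "\<phi> (f \<otimes>\<^bsub>product_group {1..2} H\<^esub> h) = \<phi> f \<otimes>\<^bsub>\<Gamma>\<^esub> \<phi> h"
      using f' h' by (simp add: \<phi>_def GP.m_assoc)
  qed
  moreover have "inj_on \<phi> (carrier (product_group {1..2} H))"
  proof (rule inj_onI)
    fix f h assume f: "f \<in> carrier (product_group {1..2} H)" and h: "h \<in> carrier (product_group {1..2} H)"
      and eq: "\<phi> f = \<phi> h"
    note f' = f12[OF f] f12[OF f, THEN par_carrier]
    note h' = f12[OF h] f12[OF h, THEN par_carrier]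
    have l: "retr A (x \<otimes>\<^bsub>\<Gamma>\<^esub> y) = x" and r: "retr B (x \<otimes>\<^bsub>\<Gamma>\<^esub> y) = y" if "x \<in> par A" "y \<in> par B" for x y
    proof -
      have "retr B x = \<one>\<^bsub>\<Gamma>\<^esub>" "retr A y = \<one>\<^bsub>\<Gamma>\<^esub>"
        using retr_disjoint that V(2) by (simp_all add: Int_commute)
      then show "retr A (x \<otimes>\<^bsub>\<Gamma>\<^esub> y) = x" "retr B (x \<otimes>\<^bsub>\<Gamma>\<^esub> y) = y"
        using that by (simp_all add: par_def)
    qed
    have "retr A (\<phi> f) = f 1" "retr A (\<phi> h) = h 1" "retr B (\<phi> f) = f 2" "retr B (\<phi> h) = h 2"
      unfolding \<phi>_def by (rule l r; rule f' h')+
    then have "f 1 = h 1" "f 2 = h 2" using eq by simp_all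
    moreover have "i = 1 \<or> i = 2" if "i \<in> {1..2}" for i :: nat using that by auto
    ultimately have "f i = h i" if "i \<in> {1..2}" for i using that by metis
    then show "f = h"
      using f h unfolding carrier_product_group by (intro PiE_ext)
  qed
  moreover have "\<phi> ` carrier (product_group {1..2} H) = carrier \<Gamma>"
  proof
    show "\<phi> ` carrier (product_group {1..2} H) \<subseteq> carrier \<Gamma>"
      using \<open>\<phi> \<in> hom (product_group {1..2} H) \<Gamma>\<close> by (rule hom_carrier)
    show "carrier \<Gamma> \<subseteq> \<phi> ` carrier (product_group {1..2} H)"
    proof
      fix x assume "x \<in> carrier \<Gamma>"
      then have "x = retr A x \<otimes>\<^bsub>\<Gamma>\<^esub> retr B x"
      proof (induction rule: graph_product_induct)
        case one
        then show ?case by simp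
      next
        case (incl v g x)
        show ?case
        proof (cases "v \<in> A")
          case True
          then have "v \<notin> B" using V by blast
          then show ?thesis using incl True by (simp add: GP.m_assoc)
        next
          case False
          then have v: "v \<in> B" using V incl by blast
          have "retr A x \<otimes>\<^bsub>\<Gamma>\<^esub> \<iota> v g = \<iota> v g \<otimes>\<^bsub>\<Gamma>\<^esub> retr A x"
            using par_commute[of "retr A x" A "\<iota> v g" B] edges incl v by simp
          then have "retr A x \<otimes>\<^bsub>\<Gamma>\<^esub> (\<iota> v g \<otimes>\<^bsub>\<Gamma>\<^esub> retr B x) = \<iota> v g \<otimes>\<^bsub>\<Gamma>\<^esub> (retr A x \<otimes>\<^bsub>\<Gamma>\<^esub> retr B x)"
            using incl(1-3) by (simp flip: GP.m_assoc)
          then show ?thesis using incl False v by simp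
        qed
      qed
      moreover have "(\<lambda>i\<in>{1..2}. retr (W i) x) \<in> carrier (product_group {1..2} H)"
        using \<open>x \<in> carrier \<Gamma>\<close> by (auto simp: H)
      moreover have "\<phi> (\<lambda>i\<in>{1..2}. retr (W i) x) = retr A x \<otimes>\<^bsub>\<Gamma>\<^esub> retr B x"
        by (simp add: \<phi>_def W_def)
      ultimately show "x \<in> \<phi> ` carrier (product_group {1..2} H)" by (metis image_eqI)
    qed
  qed
  ultimately have iso: "\<phi> \<in> iso (product_group {1..2} H) \<Gamma>"
    by (simp add: iso_def bij_betw_def)
  have "\<phi> (\<lambda>j\<in>{1..2}. if j = i then x else \<one>\<^bsub>H j\<^esub>) = x" if "i \<in> {1..2}" "x \<in> carrier (H i)" for i x
    using that par_carrier by (auto simp: I \<phi>_def H)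
  then have "internal_direct_product \<Gamma> {1..2} H"
    unfolding internal_direct_product_def using iso by (intro bexI[of _ \<phi>]) auto
  then have "parabolic_decomposition V E G 2 W"
    unfolding parabolic_decomposition_def H_def using V by (auto simp: W_def)
  moreover have "carrier (special_parabolic V E G (W i)) \<noteq> carrier \<Gamma>" for i
    using proper[of i] H[of i] unfolding H_def by simp
  ultimately show ?thesis
    unfolding directly_decomposable_def by blast
qed

text \<open>Both groups are free products of two groups of order two; the two universal properties
  yield mutually inverse homomorphisms.\<close>

lemma iso_infinite_dihedral:
  assumes V: "V = {u, v}" "u \<noteq> v" "{u, v} \<notin> E"
    and card: "card (carrier (G u)) = 2" "card (carrier (G v)) = 2"
  shows "\<Gamma> \<cong> infinite_dihedral_group"
proof -
  let ?Z = "integer_mod_group 2"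
  \<comment> \<open>The copies in \<open>infinite_dihedral_group\<close> are indexed by
    \<open>bool\<close>; \<open>True\<close> is matched with \<open>u\<close>.\<close>
  define w where "w = (\<lambda>t. if t then u else v)"
  have wV: "w t \<in> V" for t using V by (simp add: w_def)
  have w_ex: "\<exists>t. x = w t" if "x \<in> V" for x
    using that V by (intro exI[of _ "x = u"]) (auto simp: w_def)
  have "\<exists>a. carrier (G (w t)) = {\<one>\<^bsub>G (w t)\<^esub>, a} \<and> a \<noteq> \<one>\<^bsub>G (w t)\<^esub> \<and> a \<otimes>\<^bsub>G (w t)\<^esub> a = \<one>\<^bsub>G (w t)\<^esub>" for t
  proof -
    interpret w: group "G (w t)" using vertex_group wV by blast
    have "card (carrier (G (w t))) = 2" using card by (simp add: w_def)
    then obtain x y where xy: "carrier (G (w t)) = {x, y}" "x \<noteq> y" unfolding card_2_iff by blast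
    then obtain a where a: "carrier (G (w t)) = {\<one>\<^bsub>G (w t)\<^esub>, a}" "a \<noteq> \<one>\<^bsub>G (w t)\<^esub>"
      using w.one_closed by (metis insertE insert_commute singletonD)
    have ac: "a \<in> carrier (G (w t))" using a by simp
    have "a \<otimes>\<^bsub>G (w t)\<^esub> a \<in> {\<one>\<^bsub>G (w t)\<^esub>, a}" using w.m_closed[OF ac ac] a by simp
    moreover have "a \<otimes>\<^bsub>G (w t)\<^esub> a \<noteq> a" using w.r_cancel_one[OF ac ac] a by simp
    ultimately show ?thesis using a by blast
  qed
  then obtain a where a: "\<And>t. carrier (G (w t)) = {\<one>\<^bsub>G (w t)\<^esub>, a t}"
    "\<And>t. a t \<noteq> \<one>\<^bsub>G (w t)\<^esub>" "\<And>t. a t \<otimes>\<^bsub>G (w t)\<^esub> a t = \<one>\<^bsub>G (w t)\<^esub>"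
    by metis
  have w1: "monoid (G (w t))" for t using vertex_group[OF wV, THEN group.is_monoid] .
  have aw [simp]: "a t \<in> carrier (G (w t))" for t using a(1) by blast
  have c2: "carrier ?Z = {0, 1}" by (auto simp: carrier_integer_mod_group)
  let ?D = infinite_dihedral_group
  have D: "group ?D" unfolding infinite_dihedral_group_def by (intro group_free_product) simp
  have ihom: "fp_incl UNIV (\<lambda>_. ?Z) t \<in> hom ?Z ?D" for t :: bool
    unfolding infinite_dihedral_group_def by (rule fp_incl_hom) simp_all
  have i0: "fp_incl UNIV (\<lambda>_. ?Z) t 0 = \<one>\<^bsub>?D\<^esub>" for t :: bool
    using hom_one[OF ihom _ D, of t] by simp
  have i1: "fp_incl UNIV (\<lambda>_. ?Z) t 1 \<otimes>\<^bsub>?D\<^esub> fp_incl UNIV (\<lambda>_. ?Z) t 1 = \<one>\<^bsub>?D\<^esub>" for t :: bool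
    using hom_mult[OF ihom, of 1 1 t] i0[of t] by (simp add: c2 mult_integer_mod_group)
  have i1c [simp]: "fp_incl UNIV (\<lambda>_. ?Z) t 1 \<in> carrier ?D" for t :: bool
    using hom_in_carrier[OF ihom, of 1 t] by (simp add: c2)
  define f where "f = (\<lambda>x g. if g = \<one>\<^bsub>G x\<^esub> then \<one>\<^bsub>?D\<^esub> else fp_incl UNIV (\<lambda>_. ?Z) (x = u) 1)"
  define k where "k = (\<lambda>t (i::int). if i = 0 then \<one>\<^bsub>\<Gamma>\<^esub> else \<iota> (w t) (a t))"
  have w_eq: "(w t = u) = t" for t using V by (simp add: w_def)
  interpret D: group ?D by (rule D)
  have fhom: "f x \<in> hom (G x) ?D" if "x \<in> V" for x
  proof -
    obtain t where t: "x = w t" using w_ex[OF \<open>x \<in> V\<close>] by blast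
    show ?thesis
      unfolding t by (rule homI) (auto simp: a f_def w_eq i1 monoid.l_one[OF w1] monoid.r_one[OF w1])
  qed
  have fcomm: "f x g \<otimes>\<^bsub>?D\<^esub> f y h = f y h \<otimes>\<^bsub>?D\<^esub> f x g"
    if "{x, y} \<in> E" "x \<in> V" "y \<in> V" "x \<noteq> y" for x y g h
    using that V by (auto simp: insert_commute)
  have aa: "\<iota> (w t) (a t) \<otimes>\<^bsub>\<Gamma>\<^esub> \<iota> (w t) (a t) = \<one>\<^bsub>\<Gamma>\<^esub>" for t
    using incl_mult[of "w t" "a t" "a t"] wV a by simp
  have khom: "k t \<in> hom ?Z \<Gamma>" for t
    using aa[of t] wV by (intro homI) (auto simp: c2 k_def mult_integer_mod_group)
  have "\<exists>\<theta>. \<theta> \<in> hom \<Gamma> ?D \<and> (\<forall>v\<in>V. \<forall>g\<in>carrier (G v). \<theta> (\<iota> v g) = f v g)"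
  proof (rule graph_product_universal[OF D, where f = f])
    fix \<theta> assume "\<theta> \<in> hom \<Gamma> ?D" "\<And>v g. \<lbrakk>v \<in> V; g \<in> carrier (G v)\<rbrakk> \<Longrightarrow> \<theta> (\<iota> v g) = f v g"
    then show ?thesis by (intro exI[of _ \<theta>]) simp
  qed (rule fhom fcomm; assumption)+
  then obtain \<theta> where \<theta>: "\<theta> \<in> hom \<Gamma> ?D" "\<And>v g. \<lbrakk>v \<in> V; g \<in> carrier (G v)\<rbrakk> \<Longrightarrow> \<theta> (\<iota> v g) = f v g"
    by metis
  have "\<exists>\<psi>. \<psi> \<in> hom (free_product UNIV (\<lambda>_. ?Z)) \<Gamma> \<and>
      (\<forall>t\<in>UNIV. \<forall>i\<in>carrier ?Z. \<psi> (fp_incl UNIV (\<lambda>_. ?Z) t i) = k t i)"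
  proof (rule free_product_universal[OF GP.is_group, where f = k and G = "\<lambda>_. ?Z" and I = UNIV])
    fix \<psi> assume "\<psi> \<in> hom (free_product UNIV (\<lambda>_. ?Z)) \<Gamma>"
      "\<And>t i. \<lbrakk>t \<in> UNIV; i \<in> carrier ?Z\<rbrakk> \<Longrightarrow> \<psi> (fp_incl UNIV (\<lambda>_. ?Z) t i) = k t i"
    then show ?thesis by (intro exI[of _ \<psi>]) simp
  qed (rule khom group_integer_mod_group)+
  then obtain \<psi> where \<psi>: "\<psi> \<in> hom ?D \<Gamma>"
    "\<And>t i. i \<in> carrier ?Z \<Longrightarrow> \<psi> (fp_incl UNIV (\<lambda>_. ?Z) t i) = k t i"
    unfolding infinite_dihedral_group_def by blast
  interpret \<theta>: group_hom \<Gamma> ?D \<theta>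
    using \<theta> D GP.is_group by (simp add: group_hom_def group_hom_axioms_def)
  interpret \<psi>: group_hom ?D \<Gamma> \<psi>
    using \<psi> D GP.is_group by (simp add: group_hom_def group_hom_axioms_def)
  have "\<psi> (\<theta> x) = x" if "x \<in> carrier \<Gamma>" for x
    using that
  proof (induction rule: graph_product_induct)
    case one
    then show ?case by simp
  next
    case (incl x g y)
    obtain t where t: "x = w t" using w_ex[OF incl(1)] by blast
    have "\<psi> (f x g) = \<iota> x g"
      using incl a(1)[of t] a(2)[of t] \<psi>(2)[of 1 t] wV by (auto simp: t f_def w_eq c2 k_def)
    then show ?case using incl \<theta>(2)[of x g] fhom[OF incl(1), THEN hom_in_carrier] by simp
  qed
  moreover have "\<theta> (\<psi> x) = x" if "x \<in> carrier ?D" for x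
    using that unfolding infinite_dihedral_group_def
  proof (induction rule: fp_induct)
    case one
    then show ?case using \<psi>.hom_one \<theta>.hom_one unfolding infinite_dihedral_group_def by simp
  next
    case (incl t i x)
    have i: "i = 0 \<or> i = 1" using incl by (simp add: c2)
    have "\<theta> (k t i) = fp_incl UNIV (\<lambda>_. ?Z) t i"
      using i \<theta>(2)[of "w t" "a t"] wV a(2)[of t] i0 by (auto simp: k_def f_def w_eq)
    moreover have "\<psi> (fp_incl UNIV (\<lambda>_. ?Z) t i) = k t i" using \<psi>(2) incl by simp
    moreover have "fp_incl UNIV (\<lambda>_. ?Z) t i \<in> carrier ?D" using incl ihom hom_in_carrier by metis
    moreover have "x \<in> carrier ?D" using incl unfolding infinite_dihedral_group_def by simp
    moreover have "k t i \<in> carrier \<Gamma>" using incl khom hom_in_carrier by metis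
    ultimately show ?case
      using incl \<psi>.hom_mult \<theta>.hom_mult \<psi>.hom_closed
      unfolding infinite_dihedral_group_def[symmetric] by simp
  qed
  ultimately have "group_isomorphisms \<Gamma> ?D \<theta> \<psi>"
    using \<theta>(1) \<psi>(1) by (simp add: group_isomorphisms_def)
  then show ?thesis using group_isomorphisms_imp_iso is_isoI by blast
qed

end

section \<open>The action on reduced words\<close>

text \<open>Inverse elements act as inverse maps, so the action laws on \<open>\<Omega>\<close>
  already give bijections. The restriction is there because members of \<open>BijGroup\<close> are
  extensional.\<close>

lemma hom_BijGroupI:
  assumes "group H" and closed: "\<And>g w. \<lbrakk>g \<in> carrier H; w \<in> \<Omega>\<rbrakk> \<Longrightarrow> f g w \<in> \<Omega>"
    and mult: "\<And>g h w. \<lbrakk>g \<in> carrier H; h \<in> carrier H; w \<in> \<Omega>\<rbrakk> \<Longrightarrow> f (g \<otimes>\<^bsub>H\<^esub> h) w = f g (f h w)"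
    and one: "\<And>w. w \<in> \<Omega> \<Longrightarrow> f \<one>\<^bsub>H\<^esub> w = w"
  shows "(\<lambda>g. restrict (f g) \<Omega>) \<in> hom H (BijGroup \<Omega>)"
proof -
  interpret group H by fact
  have bij: "restrict (f g) \<Omega> \<in> Bij \<Omega>" if g: "g \<in> carrier H" for g
  proof -
    have "f (inv\<^bsub>H\<^esub> g) (f g w) = w" "f g (f (inv\<^bsub>H\<^esub> g) w) = w" if "w \<in> \<Omega>" for w
      using that g mult[of "inv\<^bsub>H\<^esub> g" g w] mult[of g "inv\<^bsub>H\<^esub> g" w] one by simp_all
    then have "bij_betw (f g) \<Omega> \<Omega>"
      using g closed by (intro bij_betw_byWitness[where f' = "f (inv\<^bsub>H\<^esub> g)"]) auto
    then show ?thesis by (simp add: Bij_def bij_betw_restrict_eq)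
  qed
  show ?thesis
  proof (rule homI)
    fix g assume g: "g \<in> carrier H"
    then show "restrict (f g) \<Omega> \<in> carrier (BijGroup \<Omega>)" using bij by (simp add: BijGroup_def)
    fix h assume h: "h \<in> carrier H"
    have "restrict (f (g \<otimes>\<^bsub>H\<^esub> h)) \<Omega> w = compose \<Omega> (restrict (f g) \<Omega>) (restrict (f h) \<Omega>) w" for w
      using g h closed mult by (cases "w \<in> \<Omega>") (simp_all add: compose_def)
    then show "restrict (f (g \<otimes>\<^bsub>H\<^esub> h)) \<Omega> = restrict (f g) \<Omega> \<otimes>\<^bsub>BijGroup \<Omega>\<^esub> restrict (f h) \<Omega>"
      using g h bij by (auto simp: BijGroup_def)
  qed
qed

lemma set_action_BijGroup:
  assumes "group K" "\<Phi> \<in> hom K (BijGroup \<Omega>)"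
  shows "set_action K \<Omega> \<Phi>"
proof -
  have B: "\<Phi> g \<in> Bij \<Omega>" if "g \<in> carrier K" for g
    using hom_in_carrier[OF assms(2) that] by (simp add: BijGroup_def)
  have one: "\<Phi> \<one>\<^bsub>K\<^esub> = (\<lambda>w\<in>\<Omega>. w)"
    using hom_one[OF assms(2) assms(1) group_BijGroup] by (simp add: BijGroup_def)
  show ?thesis
  proof (intro set_action.intro set_action_axioms.intro assms(1))
    show "\<Phi> g \<eta> \<in> \<Omega>" if "g \<in> carrier K" "\<eta> \<in> \<Omega>" for g \<eta>
      using Bij_imp_funcset[OF B[OF that(1)]] that(2) by (rule funcset_mem)
    show "\<Phi> (g \<otimes>\<^bsub>K\<^esub> h) \<eta> = \<Phi> g (\<Phi> h \<eta>)" if "g \<in> carrier K" "h \<in> carrier K" "\<eta> \<in> \<Omega>" for g h \<eta>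
      using hom_mult[OF assms(2) that(1,2)] B that by (simp add: BijGroup_def compose_def)
    show "\<Phi> \<one>\<^bsub>K\<^esub> \<eta> = \<eta>" if "\<eta> \<in> \<Omega>" for \<eta>
      using one that by simp
  qed
qed

text \<open>The kernel of the retraction onto \<open>V - {v}\<close> is the free product of the conjugates of the
  group of \<open>v\<close> by the left cosets of the link of \<open>v\<close>. The graph product acts on the reduced words
  of that free product: the group of \<open>v\<close> multiplies on the left by a letter at the trivial
  coset, and the other vertex groups translate the cosets.\<close>

locale graph_product_vertex = graph_product_data V E G
  for V :: "'v set" and E :: "'v set set" and G :: "'v \<Rightarrow> ('g, 'm) monoid_scheme" +
  fixes v :: 'v
  assumes v: "v \<in> V"
begin

section \<open>Cosets of the link subgroup and reduced words over them\<close>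

sublocale Gv: group "G v" using vertex_group v by blast

definition link where "link = {u \<in> V. {u, v} \<in> E}"
abbreviation "B \<equiv> par (V - {v})"
abbreviation "C \<equiv> par link"
abbreviation "\<rho> \<equiv> retr (V - {v})"
definition transl (infixr "\<bullet>" 70) where "transl b x = b <#\<^bsub>\<Gamma>\<^esub> x"
definition \<Xi> where "\<Xi> = (\<lambda>b. b \<bullet> C) ` B"
text \<open>The letter \<open>(b \<bullet> C, h)\<close> stands for the conjugate of
  \<open>\<iota> v h\<close> by \<open>b\<close>; see \<open>elt_coset\<close>.\<close>

definition \<Lambda> where "\<Lambda> = \<Xi> \<times> (carrier (G v) - {\<one>\<^bsub>G v\<^esub>})"
definition \<Omega> where "\<Omega> = {w \<in> lists \<Lambda>. distinct_adj (map fst w)}"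

lemma v_link: "v \<notin> link"
  using simplicial by (auto simp: link_def simplicial_graph_def)

lemma B_mult [simp]: "\<lbrakk>a \<in> B; b \<in> B\<rbrakk> \<Longrightarrow> a \<otimes>\<^bsub>\<Gamma>\<^esub> b \<in> B"
  using subgroup.m_closed[OF subgroup_par] .

lemma B_inv [simp]: "a \<in> B \<Longrightarrow> inv\<^bsub>\<Gamma>\<^esub> a \<in> B"
  using subgroup.m_inv_closed[OF subgroup_par] .

lemma par_one [simp]: "\<one>\<^bsub>\<Gamma>\<^esub> \<in> par A"
  using subgroup.one_closed[OF subgroup_par] .

lemma C_sub: "C \<subseteq> carrier \<Gamma>"
  using par_carrier by blast

lemma Xi_sub: "x \<in> \<Xi> \<Longrightarrow> x \<subseteq> carrier \<Gamma>"
  unfolding \<Xi>_def transl_def using GP.l_coset_subset_G[OF C_sub] par_carrier by blast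

lemma trans_mult: "\<lbrakk>a \<in> B; b \<in> B; x \<in> \<Xi>\<rbrakk> \<Longrightarrow> (a \<otimes>\<^bsub>\<Gamma>\<^esub> b) \<bullet> x = a \<bullet> b \<bullet> x"
  unfolding transl_def using GP.lcos_m_assoc Xi_sub par_carrier by metis

lemma trans_one: "x \<in> \<Xi> \<Longrightarrow> \<one>\<^bsub>\<Gamma>\<^esub> \<bullet> x = x"
  unfolding transl_def using GP.lcos_mult_one Xi_sub by blast

lemma C_Xi [simp]: "C \<in> \<Xi>"
  unfolding \<Xi>_def transl_def using GP.lcos_mult_one[OF C_sub] by (intro image_eqI[of _ _ "\<one>\<^bsub>\<Gamma>\<^esub>"]) simp_all

lemma trans_C [simp]: "b \<in> B \<Longrightarrow> b \<bullet> C \<in> \<Xi>"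
  by (simp add: \<Xi>_def)

lemma trans_Xi [simp]:
  assumes "b \<in> B" "x \<in> \<Xi>"
  shows "b \<bullet> x \<in> \<Xi>"
proof -
  obtain a where a: "a \<in> B" "x = a \<bullet> C" using assms(2) by (auto simp: \<Xi>_def)
  then have "b \<bullet> x = (b \<otimes>\<^bsub>\<Gamma>\<^esub> a) \<bullet> C" using trans_mult[OF assms(1) a(1) C_Xi] by simp
  then show ?thesis using assms(1) a(1) by simp
qed

lemma trans_eq_iff: "\<lbrakk>b \<in> B; x \<in> \<Xi>; y \<in> \<Xi>\<rbrakk> \<Longrightarrow> b \<bullet> x = b \<bullet> y \<longleftrightarrow> x = y"
  using trans_mult[of "inv\<^bsub>\<Gamma>\<^esub> b" b] trans_one by (metis B_inv GP.l_inv par_carrier)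

lemma link_trans: "c \<in> C \<Longrightarrow> c \<bullet> C = C"
  unfolding transl_def using GP.coset_join3[OF _ subgroup_par] par_carrier by blast

lemma coset_eqD:
  assumes "a \<in> B" "b \<in> B" "a \<bullet> C = b \<bullet> C"
  obtains c where "c \<in> C" "b = a \<otimes>\<^bsub>\<Gamma>\<^esub> c"
proof -
  have "b \<otimes>\<^bsub>\<Gamma>\<^esub> \<one>\<^bsub>\<Gamma>\<^esub> \<in> b \<bullet> C" unfolding transl_def l_coset_def using par_one by blast
  then have "b \<in> a \<bullet> C" using assms par_carrier[OF assms(2)] by simp
  then show thesis using that unfolding transl_def l_coset_def by blast
qed

text \<open>Representatives of a coset differ by an element of \<open>C\<close>, which dies under a
  retraction that avoids the link. Such retractions are therefore invariants of cosets and are used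
  to tell them apart.\<close>

lemma coset_retr:
  assumes "a \<in> B" "b \<in> B" "a \<bullet> C = b \<bullet> C" "A \<inter> link = {}"
  shows "retr A a = retr A b"
proof -
  obtain c where c: "c \<in> C" "b = a \<otimes>\<^bsub>\<Gamma>\<^esub> c" using coset_eqD[OF assms(1-3)] by blast
  have "retr A c = \<one>\<^bsub>\<Gamma>\<^esub>" using retr_disjoint[OF c(1)] assms(4) by blast
  then show ?thesis using c par_carrier[OF assms(1)] par_carrier[OF c(1)] by simp
qed

definition lmult where
  "lmult x h w = (if h = \<one>\<^bsub>G v\<^esub> then w else
    case w of [] \<Rightarrow> [(x, h)] | (y, k) # z \<Rightarrow>
      if y = x then (if h \<otimes>\<^bsub>G v\<^esub> k = \<one>\<^bsub>G v\<^esub> then z else (x, h \<otimes>\<^bsub>G v\<^esub> k) # z) else (x, h) # w)"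

definition shift where "shift b = map (\<lambda>(x, h). (b \<bullet> x, h))"

lemma \<Omega>_Nil [simp]: "[] \<in> \<Omega>"
  by (simp add: \<Omega>_def)

lemma \<Omega>_Cons: "(x, h) # w \<in> \<Omega> \<longleftrightarrow>
    x \<in> \<Xi> \<and> h \<in> carrier (G v) \<and> h \<noteq> \<one>\<^bsub>G v\<^esub> \<and> w \<in> \<Omega> \<and> (w = [] \<or> fst (hd w) \<noteq> x)"
  by (cases w) (auto simp: \<Omega>_def \<Lambda>_def)

lemma lmult_one [simp]: "lmult x \<one>\<^bsub>G v\<^esub> w = w"
  by (simp add: lmult_def)

lemma lmult_Cons: "(x, h) # w \<in> \<Omega> \<Longrightarrow> lmult x h w = (x, h) # w"
  by (cases w) (auto simp: \<Omega>_Cons lmult_def del: equalityI)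

lemma lmult_closed: "\<lbrakk>x \<in> \<Xi>; h \<in> carrier (G v); w \<in> \<Omega>\<rbrakk> \<Longrightarrow> lmult x h w \<in> \<Omega>"
  by (cases w) (auto simp: \<Omega>_Cons lmult_def del: equalityI)

text \<open>Associativity at the head of the word, the one genuine computation behind the action.
  The cases are whether \<open>w\<close> begins at \<open>x\<close> and which products
  cancel.\<close>

lemma lmult_mult:
  assumes "g \<in> carrier (G v)" "h \<in> carrier (G v)" "x \<in> \<Xi>" "w \<in> \<Omega>"
  shows "lmult x (g \<otimes>\<^bsub>G v\<^esub> h) w = lmult x g (lmult x h w)"
proof (cases "w \<noteq> [] \<and> fst (hd w) = x")
  case False
  consider "g = \<one>\<^bsub>G v\<^esub>" | "h = \<one>\<^bsub>G v\<^esub>" | "g \<noteq> \<one>\<^bsub>G v\<^esub>" "h \<noteq> \<one>\<^bsub>G v\<^esub>" by blast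
  then show ?thesis
  proof cases
    case 3
    then have hw: "lmult x h w = (x, h) # w"
      using assms False by (intro lmult_Cons) (simp add: \<Omega>_Cons)
    show ?thesis
    proof (cases "g \<otimes>\<^bsub>G v\<^esub> h = \<one>\<^bsub>G v\<^esub>")
      case True
      then show ?thesis using 3 hw by (simp add: lmult_def)
    next
      case False
      then have "lmult x (g \<otimes>\<^bsub>G v\<^esub> h) w = (x, g \<otimes>\<^bsub>G v\<^esub> h) # w"
        using assms \<open>\<not> (w \<noteq> [] \<and> fst (hd w) = x)\<close> by (intro lmult_Cons) (simp add: \<Omega>_Cons)
      then show ?thesis using 3 hw False by (simp add: lmult_def)
    qed
  qed (use assms in simp_all)
next
  case True
  then obtain k z where w: "w = (x, k) # z" by (cases w) auto
  then have k: "k \<in> carrier (G v)" "k \<noteq> \<one>\<^bsub>G v\<^esub>" "z = [] \<or> fst (hd z) \<noteq> x" "z \<in> \<Omega>"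
    using assms by (auto simp: \<Omega>_Cons)
  have *: "lmult x a ((x, k) # z) = (if a \<otimes>\<^bsub>G v\<^esub> k = \<one>\<^bsub>G v\<^esub> then z else (x, a \<otimes>\<^bsub>G v\<^esub> k) # z)"
    if "a \<in> carrier (G v)" "k \<in> carrier (G v)" "k \<noteq> \<one>\<^bsub>G v\<^esub>" for a k
    using that by (simp add: lmult_def)
  show ?thesis
  proof (cases "h \<otimes>\<^bsub>G v\<^esub> k = \<one>\<^bsub>G v\<^esub>")
    case True
    then have "lmult x g (lmult x h w) = lmult x g z" using w k assms by (simp add: *)
    moreover have "g \<otimes>\<^bsub>G v\<^esub> h \<otimes>\<^bsub>G v\<^esub> k = g" using True k assms by (simp add: Gv.m_assoc)
    moreover have "lmult x g z = (if g = \<one>\<^bsub>G v\<^esub> then z else (x, g) # z)"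
      using k assms lmult_Cons[of x g z] by (auto simp: \<Omega>_Cons)
    ultimately show ?thesis using w k assms by (simp add: *)
  next
    case False
    then show ?thesis using w k assms by (simp add: * Gv.m_assoc)
  qed
qed

lemma shift_Nil [simp]: "shift b [] = []" by (simp add: shift_def)

lemma shift_Cons [simp]: "shift b ((x, h) # w) = (b \<bullet> x, h) # shift b w" by (simp add: shift_def)

lemma shift_closed: "\<lbrakk>b \<in> B; w \<in> \<Omega>\<rbrakk> \<Longrightarrow> shift b w \<in> \<Omega>"
proof (induction w)
  case (Cons a w)
  obtain x h where a: "a = (x, h)" by force
  show ?case
  proof (cases w)
    case (Cons a' w')
    obtain y k where "a' = (y, k)" by force
    then show ?thesis using Cons.IH Cons.prems a Cons by (simp add: \<Omega>_Cons trans_eq_iff)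
  qed (use Cons.prems a in \<open>simp add: \<Omega>_Cons\<close>)
qed simp

lemma shift_mult: "\<lbrakk>a \<in> B; b \<in> B; w \<in> \<Omega>\<rbrakk> \<Longrightarrow> shift (a \<otimes>\<^bsub>\<Gamma>\<^esub> b) w = shift a (shift b w)"
  by (induction w) (auto simp: \<Omega>_Cons trans_mult)

lemma shift_one: "w \<in> \<Omega> \<Longrightarrow> shift \<one>\<^bsub>\<Gamma>\<^esub> w = w"
  by (induction w) (auto simp: \<Omega>_Cons trans_one)

text \<open>This equivariance is behind both the relation between \<open>v\<close> and its link and
  the formula for the action of conjugates.\<close>

lemma shift_lmult: "\<lbrakk>b \<in> B; x \<in> \<Xi>; w \<in> \<Omega>\<rbrakk> \<Longrightarrow> shift b (lmult x h w) = lmult (b \<bullet> x) h (shift b w)"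
  by (cases w) (auto simp: \<Omega>_Cons lmult_def trans_eq_iff del: equalityI)

definition gen where
  "gen u g = restrict (if u = v then lmult C g else shift (\<iota> u g)) \<Omega>"

lemma gen_hom:
  assumes "u \<in> V"
  shows "gen u \<in> hom (G u) (BijGroup \<Omega>)"
proof (cases "u = v")
  case True
  then have "gen u = (\<lambda>g. restrict (lmult C g) \<Omega>)" by (simp add: gen_def fun_eq_iff)
  then show ?thesis
    using hom_BijGroupI[of "G v" \<Omega> "lmult C"] lmult_closed lmult_mult Gv.is_group True by simp
next
  case False
  then have "gen u = (\<lambda>g. restrict (shift (\<iota> u g)) \<Omega>)" by (simp add: gen_def fun_eq_iff)
  then show ?thesis
    using hom_BijGroupI[of "G u" \<Omega> "\<lambda>g. shift (\<iota> u g)"] assms False vertex_group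
    by (simp add: shift_closed shift_mult shift_one incl_mult)
qed

text \<open>Away from \<open>v\<close> both sides are shifts by commuting elements of
  \<open>B\<close>. If the other end is \<open>v\<close>, then \<open>u\<close> is in the link, so
  its group fixes the coset \<open>C\<close>, and equivariance moves the shift past the
  letter.\<close>

lemma gen_edge:
  assumes "{u, w} \<in> E" "u \<in> V" "w \<in> V" "u \<noteq> w" "g \<in> carrier (G u)" "h \<in> carrier (G w)"
  shows "gen u g \<otimes>\<^bsub>BijGroup \<Omega>\<^esub> gen w h = gen w h \<otimes>\<^bsub>BijGroup \<Omega>\<^esub> gen u g"
proof -
  have key: "gen u g (gen w h \<eta>) = gen w h (gen u g \<eta>)"
    if "{u, w} \<in> E" "u \<in> V" "w \<in> V" "u \<noteq> v" "g \<in> carrier (G u)" "h \<in> carrier (G w)" "\<eta> \<in> \<Omega>" for u w g h \<eta>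
  proof (cases "w = v")
    case True
    have "u \<in> link" using that True by (simp add: link_def)
    then have "\<iota> u g \<bullet> C = C" using that by (intro link_trans) simp
    then show ?thesis
      using that True by (simp add: gen_def lmult_closed shift_closed shift_lmult)
  next
    case False
    then have "gen u g (gen w h \<eta>) = shift (\<iota> u g \<otimes>\<^bsub>\<Gamma>\<^esub> \<iota> w h) \<eta>"
      using that by (simp add: gen_def shift_closed shift_mult)
    also have "\<dots> = shift (\<iota> w h \<otimes>\<^bsub>\<Gamma>\<^esub> \<iota> u g) \<eta>" using edge_commute[OF that(1,5,6)] by simp
    also have "\<dots> = gen w h (gen u g \<eta>)"
      using that False by (simp add: gen_def shift_closed shift_mult)
    finally show ?thesis .
  qed
  have Bij: "gen u g \<in> Bij \<Omega>" "gen w h \<in> Bij \<Omega>"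
    using gen_hom[OF assms(2)] gen_hom[OF assms(3)] assms(5,6) hom_in_carrier
    by (fastforce simp: BijGroup_def)+
  have "gen u g (gen w h \<eta>) = gen w h (gen u g \<eta>)" if "\<eta> \<in> \<Omega>" for \<eta>
  proof (cases "u = v")
    case True
    then have "w \<noteq> v" "{w, u} \<in> E" using assms by (auto simp: insert_commute)
    then show ?thesis using key[of w u h g \<eta>] assms that by simp
  next
    case False
    then show ?thesis using key[of u w g h \<eta>] assms that by simp
  qed
  then have "compose \<Omega> (gen u g) (gen w h) = compose \<Omega> (gen w h) (gen u g)"
    by (simp add: compose_def fun_eq_iff restrict_def)
  then show ?thesis using Bij by (simp add: BijGroup_def)
qed

definition act where
  "act = (SOME \<Phi>. \<Phi> \<in> hom \<Gamma> (BijGroup \<Omega>) \<and> (\<forall>u\<in>V. \<forall>g\<in>carrier (G u). \<Phi> (\<iota> u g) = gen u g))"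

lemma act: "act \<in> hom \<Gamma> (BijGroup \<Omega>) \<and> (\<forall>u\<in>V. \<forall>g\<in>carrier (G u). act (\<iota> u g) = gen u g)"
proof -
  have "\<exists>\<Phi>. \<Phi> \<in> hom \<Gamma> (BijGroup \<Omega>) \<and> (\<forall>u\<in>V. \<forall>g\<in>carrier (G u). \<Phi> (\<iota> u g) = gen u g)"
  proof (rule graph_product_universal[OF group_BijGroup, where f = gen])
    fix \<Phi> assume "\<Phi> \<in> hom \<Gamma> (BijGroup \<Omega>)" "\<And>u g. \<lbrakk>u \<in> V; g \<in> carrier (G u)\<rbrakk> \<Longrightarrow> \<Phi> (\<iota> u g) = gen u g"
    then show ?thesis by (intro exI[of _ \<Phi>]) simp
  qed (rule gen_hom gen_edge; assumption)+
  then show ?thesis unfolding act_def by (rule someI_ex)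
qed

sublocale act: set_action \<Gamma> \<Omega> act
  using act by (intro set_action_BijGroup GP.is_group) simp

lemma act_v: "\<lbrakk>h \<in> carrier (G v); w \<in> \<Omega>\<rbrakk> \<Longrightarrow> act (\<iota> v h) w = lmult C h w"
  using act v by (simp add: gen_def)

lemma act_B:
  assumes "b \<in> B" "w \<in> \<Omega>"
  shows "act b w = shift b w"
  using assms(1)
proof (induction rule: par_induct)
  case one
  then show ?case using act.act_one shift_one assms by simp
next
  case (incl u g x)
  then have "act (\<iota> u g) z = shift (\<iota> u g) z" if "z \<in> \<Omega>" for z
    using act that by (simp add: gen_def)
  then show ?case
    using incl assms(2) by (simp add: act.act_mult par_carrier shift_mult shift_closed)
qed

section \<open>Letters as conjugates, evaluation of words, and the splitting over the
  retraction\<close>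

definition elt where
  "elt x h = (let r = (SOME r. r \<in> B \<and> x = r \<bullet> C) in r \<otimes>\<^bsub>\<Gamma>\<^esub> \<iota> v h \<otimes>\<^bsub>\<Gamma>\<^esub> inv\<^bsub>\<Gamma>\<^esub> r)"

text \<open>The chosen representative differs from \<open>b\<close> by an element of
  \<open>C\<close>, which commutes with the group of \<open>v\<close>.\<close>

lemma elt_coset:
  assumes b: "b \<in> B" and h: "h \<in> carrier (G v)"
  shows "elt (b \<bullet> C) h = b \<otimes>\<^bsub>\<Gamma>\<^esub> \<iota> v h \<otimes>\<^bsub>\<Gamma>\<^esub> inv\<^bsub>\<Gamma>\<^esub> b"
proof -
  define r where "r = (SOME r. r \<in> B \<and> b \<bullet> C = r \<bullet> C)"
  have r: "r \<in> B" "b \<bullet> C = r \<bullet> C"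
    using someI[of "\<lambda>r. r \<in> B \<and> b \<bullet> C = r \<bullet> C" b] b unfolding r_def by auto
  obtain c where c: "c \<in> C" "r = b \<otimes>\<^bsub>\<Gamma>\<^esub> c" using coset_eqD[OF b r(1,2)] by blast
  have cc: "c \<in> carrier \<Gamma>" "b \<in> carrier \<Gamma>" "\<iota> v h \<in> carrier \<Gamma>"
    using c(1) b h v par_carrier by auto
  have "c \<otimes>\<^bsub>\<Gamma>\<^esub> \<iota> v h = \<iota> v h \<otimes>\<^bsub>\<Gamma>\<^esub> c"
    using par_commute[OF c(1), of "\<iota> v h" "{v}"] v h by (simp add: link_def)
  then have "c \<otimes>\<^bsub>\<Gamma>\<^esub> \<iota> v h \<otimes>\<^bsub>\<Gamma>\<^esub> inv\<^bsub>\<Gamma>\<^esub> c = \<iota> v h"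
    using cc by (simp add: GP.m_assoc)
  then have "b \<otimes>\<^bsub>\<Gamma>\<^esub> (c \<otimes>\<^bsub>\<Gamma>\<^esub> \<iota> v h \<otimes>\<^bsub>\<Gamma>\<^esub> inv\<^bsub>\<Gamma>\<^esub> c) \<otimes>\<^bsub>\<Gamma>\<^esub> inv\<^bsub>\<Gamma>\<^esub> b = b \<otimes>\<^bsub>\<Gamma>\<^esub> \<iota> v h \<otimes>\<^bsub>\<Gamma>\<^esub> inv\<^bsub>\<Gamma>\<^esub> b"
    by simp
  then have "r \<otimes>\<^bsub>\<Gamma>\<^esub> \<iota> v h \<otimes>\<^bsub>\<Gamma>\<^esub> inv\<^bsub>\<Gamma>\<^esub> r = b \<otimes>\<^bsub>\<Gamma>\<^esub> \<iota> v h \<otimes>\<^bsub>\<Gamma>\<^esub> inv\<^bsub>\<Gamma>\<^esub> b"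
    using cc by (simp add: c(2) GP.m_assoc GP.inv_mult_group)
  then show ?thesis by (simp add: elt_def r_def)
qed

lemma \<Xi>E:
  assumes "x \<in> \<Xi>"
  obtains b where "b \<in> B" "b \<in> carrier \<Gamma>" "x = b \<bullet> C"
  using assms par_carrier by (auto simp: \<Xi>_def)

lemma elt_closed [simp]: "\<lbrakk>x \<in> \<Xi>; h \<in> carrier (G v)\<rbrakk> \<Longrightarrow> elt x h \<in> carrier \<Gamma>"
  using v by (elim \<Xi>E) (simp add: elt_coset)

lemma elt_one [simp]: "x \<in> \<Xi> \<Longrightarrow> elt x \<one>\<^bsub>G v\<^esub> = \<one>\<^bsub>\<Gamma>\<^esub>"
  using v by (elim \<Xi>E) (simp add: elt_coset)

lemma elt_mult:
  assumes "x \<in> \<Xi>" "g \<in> carrier (G v)" "h \<in> carrier (G v)"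
  shows "elt x (g \<otimes>\<^bsub>G v\<^esub> h) = elt x g \<otimes>\<^bsub>\<Gamma>\<^esub> elt x h"
proof -
  obtain b where b: "b \<in> B" "b \<in> carrier \<Gamma>" "x = b \<bullet> C" using assms(1) by (rule \<Xi>E)
  have "inv\<^bsub>\<Gamma>\<^esub> b \<otimes>\<^bsub>\<Gamma>\<^esub> (b \<otimes>\<^bsub>\<Gamma>\<^esub> y) = y" if "y \<in> carrier \<Gamma>" for y
    using b that by (simp flip: GP.m_assoc)
  then show ?thesis using assms b v by (simp add: elt_coset incl_mult GP.m_assoc)
qed

lemma elt_inv: "\<lbrakk>x \<in> \<Xi>; h \<in> carrier (G v)\<rbrakk> \<Longrightarrow> elt x (inv\<^bsub>G v\<^esub> h) = inv\<^bsub>\<Gamma>\<^esub> elt x h"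
  using elt_mult[of x "inv\<^bsub>G v\<^esub> h" h] by (intro GP.inv_equality[symmetric]) simp_all

lemma elt_conj:
  assumes "b \<in> B" "x \<in> \<Xi>" "h \<in> carrier (G v)"
  shows "b \<otimes>\<^bsub>\<Gamma>\<^esub> elt x h = elt (b \<bullet> x) h \<otimes>\<^bsub>\<Gamma>\<^esub> b"
proof -
  obtain a where a: "a \<in> B" "a \<in> carrier \<Gamma>" "x = a \<bullet> C" using assms(2) by (rule \<Xi>E)
  have b: "b \<in> carrier \<Gamma>" using assms(1) par_carrier by blast
  have "b \<bullet> x = (b \<otimes>\<^bsub>\<Gamma>\<^esub> a) \<bullet> C" using trans_mult[OF assms(1) a(1) C_Xi] a by simp
  then have "elt (b \<bullet> x) h = b \<otimes>\<^bsub>\<Gamma>\<^esub> a \<otimes>\<^bsub>\<Gamma>\<^esub> \<iota> v h \<otimes>\<^bsub>\<Gamma>\<^esub> inv\<^bsub>\<Gamma>\<^esub> (b \<otimes>\<^bsub>\<Gamma>\<^esub> a)"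
    using assms a by (simp add: elt_coset)
  then show ?thesis
    using assms a b v by (simp add: elt_coset GP.m_assoc GP.inv_mult_group)
qed

text \<open>The conjugate shifts back by \<open>b\<close>, multiplies at the coset \<open>C\<close>
  and shifts forward; equivariance turns this into multiplication at \<open>x\<close>.\<close>

lemma act_elt:
  assumes "x \<in> \<Xi>" "h \<in> carrier (G v)" "w \<in> \<Omega>"
  shows "act (elt x h) w = lmult x h w"
proof -
  obtain b where b: "b \<in> B" "b \<in> carrier \<Gamma>" "x = b \<bullet> C" using assms(1) by (rule \<Xi>E)
  have "act (elt x h) w = shift b (lmult C h (shift (inv\<^bsub>\<Gamma>\<^esub> b) w))"
    using assms b v by (simp add: elt_coset act.act_mult act.act_closed act_B act_v shift_closed lmult_closed)
  also have "\<dots> = lmult x h (shift b (shift (inv\<^bsub>\<Gamma>\<^esub> b) w))"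
    using assms b by (simp add: shift_lmult shift_closed)
  also have "shift b (shift (inv\<^bsub>\<Gamma>\<^esub> b) w) = w"
    using shift_mult[of b "inv\<^bsub>\<Gamma>\<^esub> b" w] b assms by (simp add: shift_one)
  finally show ?thesis .
qed

definition ev where
  "ev w = foldr (\<lambda>(x, h) z. elt x h \<otimes>\<^bsub>\<Gamma>\<^esub> z) w \<one>\<^bsub>\<Gamma>\<^esub>"

lemma ev_Nil [simp]: "ev [] = \<one>\<^bsub>\<Gamma>\<^esub>" by (simp add: ev_def)

lemma ev_Cons [simp]: "ev ((x, h) # w) = elt x h \<otimes>\<^bsub>\<Gamma>\<^esub> ev w" by (simp add: ev_def)

lemma ev_closed [simp]: "w \<in> \<Omega> \<Longrightarrow> ev w \<in> carrier \<Gamma>"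
  by (induction w) (auto simp: \<Omega>_Cons)

lemma \<Omega>_append: "u @ w \<in> \<Omega> \<longleftrightarrow>
    u \<in> \<Omega> \<and> w \<in> \<Omega> \<and> (u = [] \<or> w = [] \<or> fst (last u) \<noteq> fst (hd w))"
  by (auto simp: \<Omega>_def distinct_adj_append_iff last_map hd_map)

lemma ev_append: "\<lbrakk>u \<in> \<Omega>; w \<in> \<Omega>\<rbrakk> \<Longrightarrow> ev (u @ w) = ev u \<otimes>\<^bsub>\<Gamma>\<^esub> ev w"
  by (induction u) (auto simp: \<Omega>_Cons GP.m_assoc)

lemma ev_lmult:
  assumes "x \<in> \<Xi>" "h \<in> carrier (G v)" "w \<in> \<Omega>"
  shows "ev (lmult x h w) = elt x h \<otimes>\<^bsub>\<Gamma>\<^esub> ev w"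
proof (cases "w \<noteq> [] \<and> fst (hd w) = x")
  case True
  then obtain k z where w: "w = (x, k) # z" by (cases w) auto
  then have "elt x h \<otimes>\<^bsub>\<Gamma>\<^esub> ev w = elt x (h \<otimes>\<^bsub>G v\<^esub> k) \<otimes>\<^bsub>\<Gamma>\<^esub> ev z"
    using assms by (simp add: \<Omega>_Cons elt_mult GP.m_assoc)
  then show ?thesis using w assms by (auto simp: lmult_def \<Omega>_Cons)
next
  case False
  then show ?thesis
    using assms lmult_Cons[of x h w] by (cases "h = \<one>\<^bsub>G v\<^esub>") (simp_all add: \<Omega>_Cons)
qed

text \<open>Moving \<open>b\<close> to the right conjugates every letter, that is, translates its
  coset. This and \<open>ev_lmult\<close> are the two cases of the induction in
  \<open>decompose\<close>.\<close>

lemma ev_shift: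
  assumes "b \<in> B" "w \<in> \<Omega>"
  shows "b \<otimes>\<^bsub>\<Gamma>\<^esub> ev w = ev (shift b w) \<otimes>\<^bsub>\<Gamma>\<^esub> b"
  using assms(2)
proof (induction w)
  case Nil
  then show ?case using assms(1) par_carrier by simp
next
  case (Cons a w)
  obtain x h where a: "a = (x, h)" by force
  have w: "x \<in> \<Xi>" "h \<in> carrier (G v)" "w \<in> \<Omega>" using Cons.prems a by (simp_all add: \<Omega>_Cons)
  have c: "b \<in> carrier \<Gamma>" "ev w \<in> carrier \<Gamma>" "elt x h \<in> carrier \<Gamma>" "elt (b \<bullet> x) h \<in> carrier \<Gamma>"
    "ev (shift b w) \<in> carrier \<Gamma>"
    using w assms(1) par_carrier shift_closed by auto
  have "b \<otimes>\<^bsub>\<Gamma>\<^esub> ev (a # w) = b \<otimes>\<^bsub>\<Gamma>\<^esub> elt x h \<otimes>\<^bsub>\<Gamma>\<^esub> ev w"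
    using c a by (simp add: GP.m_assoc)
  also have "\<dots> = elt (b \<bullet> x) h \<otimes>\<^bsub>\<Gamma>\<^esub> (b \<otimes>\<^bsub>\<Gamma>\<^esub> ev w)"
    using elt_conj[OF assms(1) w(1,2)] c by (simp add: GP.m_assoc)
  also have "\<dots> = ev (shift b (a # w)) \<otimes>\<^bsub>\<Gamma>\<^esub> b"
    using Cons.IH w c a by (simp add: GP.m_assoc)
  finally show ?case .
qed

text \<open>Van der Waerden's trick: the orbit map of the empty word inverts evaluation.\<close>

lemma decompose: "g \<in> carrier \<Gamma> \<Longrightarrow> g = ev (act g []) \<otimes>\<^bsub>\<Gamma>\<^esub> \<rho> g"
proof (induction rule: graph_product_induct)
  case one
  then show ?case by (simp add: act.act_one)
next
  case (incl u h g)
  define w where "w = act g []"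
  have w: "w \<in> \<Omega>" unfolding w_def using incl by (intro act.act_closed) simp_all
  have g: "g = ev w \<otimes>\<^bsub>\<Gamma>\<^esub> \<rho> g" using incl(4) by (simp add: w_def)
  have ag: "act (\<iota> u h \<otimes>\<^bsub>\<Gamma>\<^esub> g) [] = act (\<iota> u h) w"
    using incl(1-3) by (simp add: act.act_mult w_def)
  have c: "\<iota> u h \<in> carrier \<Gamma>" "ev w \<in> carrier \<Gamma>" "\<rho> g \<in> carrier \<Gamma>"
    using incl(1-3) w by simp_all
  have eq: "\<iota> u h \<otimes>\<^bsub>\<Gamma>\<^esub> g = \<iota> u h \<otimes>\<^bsub>\<Gamma>\<^esub> ev w \<otimes>\<^bsub>\<Gamma>\<^esub> \<rho> g"
    using g c GP.m_assoc by metis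
  show ?case
  proof (cases "u = v")
    case True
    have "elt C h = \<iota> v h"
      using elt_coset[of "\<one>\<^bsub>\<Gamma>\<^esub>" h] incl(2) True v trans_one[OF C_Xi] by simp
    then have "ev (act (\<iota> u h) w) = \<iota> u h \<otimes>\<^bsub>\<Gamma>\<^esub> ev w"
      using w incl(2) True by (simp add: act_v ev_lmult)
    moreover have "\<rho> (\<iota> u h \<otimes>\<^bsub>\<Gamma>\<^esub> g) = \<rho> g" using incl(1-3) True by simp
    ultimately show ?thesis using eq ag by simp
  next
    case False
    have "\<iota> u h \<otimes>\<^bsub>\<Gamma>\<^esub> ev w = ev (act (\<iota> u h) w) \<otimes>\<^bsub>\<Gamma>\<^esub> \<iota> u h"
      using w incl(1,2) False by (simp add: act_B ev_shift)
    moreover have "\<rho> (\<iota> u h \<otimes>\<^bsub>\<Gamma>\<^esub> g) = \<iota> u h \<otimes>\<^bsub>\<Gamma>\<^esub> \<rho> g" using incl(1-3) False by simp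
    moreover have "ev (act (\<iota> u h) w) \<in> carrier \<Gamma>" using c w act.act_closed by simp
    ultimately show ?thesis using eq ag c by (simp add: GP.m_assoc)
  qed
qed

text \<open>The letters of \<open>u\<close> are prepended from right to left; every intermediate
  word is a suffix of a reduced word, so nothing merges.\<close>

lemma act_ev: "u @ w \<in> \<Omega> \<Longrightarrow> act (ev u) w = u @ w"
proof (induction u)
  case Nil
  then show ?case by (simp add: act.act_one)
next
  case (Cons a u)
  obtain x h where a: "a = (x, h)" by force
  have *: "(x, h) # (u @ w) \<in> \<Omega>" using Cons.prems a by simp
  then have "x \<in> \<Xi>" "h \<in> carrier (G v)" "u @ w \<in> \<Omega>" "u \<in> \<Omega>" "w \<in> \<Omega>"
    by (simp_all add: \<Omega>_Cons \<Omega>_append)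
  then show ?case
    using Cons.IH a lmult_Cons[OF *] by (simp add: act.act_mult act_elt)
qed

text \<open>Let \<open>w\<close> be the word of \<open>m\<close>. If it is non-empty, take a letter
  at a coset other than its first. On the empty word, the letter after \<open>m\<close> yields
  \<open>w\<close> with that letter in front, while \<open>m\<close> after the letter multiplies
  \<open>w\<close> on the right by a translated letter; the results cannot agree.\<close>

lemma central_retr:
  assumes m: "m \<in> carrier \<Gamma>" and central: "\<And>g. g \<in> carrier \<Gamma> \<Longrightarrow> m \<otimes>\<^bsub>\<Gamma>\<^esub> g = g \<otimes>\<^bsub>\<Gamma>\<^esub> m"
    and two: "\<And>z. z \<in> \<Xi> \<Longrightarrow> \<exists>l\<in>\<Lambda>. fst l \<noteq> z"
  shows "\<rho> m = m"
proof -
  define w where "w = act m []"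
  have w: "w \<in> \<Omega>" unfolding w_def using m by (intro act.act_closed) simp_all
  have dec: "m = ev w \<otimes>\<^bsub>\<Gamma>\<^esub> \<rho> m" using decompose[OF m] by (simp add: w_def)
  have "w = []"
  proof (rule ccontr)
    assume ne: "w \<noteq> []"
    then have "fst (hd w) \<in> \<Xi>" using w by (cases w) (auto simp: \<Omega>_Cons)
    then obtain y h where l: "y \<in> \<Xi>" "h \<in> carrier (G v)" "h \<noteq> \<one>\<^bsub>G v\<^esub>" "y \<noteq> fst (hd w)"
      using two[of "fst (hd w)"] by (auto simp: \<Lambda>_def)
    have 1: "act (elt y h \<otimes>\<^bsub>\<Gamma>\<^esub> m) [] = (y, h) # w"
      using l m w ne lmult_Cons[of y h w] by (simp add: act.act_mult act_elt \<Omega>_Cons flip: w_def)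
    have b: "\<rho> m \<in> B" "\<rho> m \<in> carrier \<Gamma>" using m by simp_all
    define z where "z = \<rho> m \<bullet> y"
    have z: "z \<in> \<Xi>" unfolding z_def using b l by simp
    have s: "[(y, h)] \<in> \<Omega>" "[(z, h)] \<in> \<Omega>" using l z by (simp_all add: \<Omega>_Cons)
    have "act (m \<otimes>\<^bsub>\<Gamma>\<^esub> elt y h) [] = act m (act (elt y h) [])"
      using l m by (simp add: act.act_mult)
    also have "act (elt y h) [] = [(y, h)]" using l by (simp add: act_elt lmult_def)
    also have "act m [(y, h)] = act (ev w) (act (\<rho> m) [(y, h)])"
      using s w b by (subst dec) (simp add: act.act_mult)
    also have "act (\<rho> m) [(y, h)] = [(z, h)]" using s b by (simp add: act_B z_def)
    finally have 2: "act (ev w) [(z, h)] = (y, h) # w"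
      using 1 central[of "elt y h"] l by simp
    obtain w' x k where w': "w = w' @ [(x, k)]" using ne by (metis rev_exhaust surj_pair)
    have xk: "x \<in> \<Xi>" "k \<in> carrier (G v)" "w' \<in> \<Omega>" "[(x, k)] \<in> \<Omega>" "k \<noteq> \<one>\<^bsub>G v\<^esub>"
      "w' = [] \<or> fst (last w') \<noteq> x"
      using w w' by (simp_all add: \<Omega>_append \<Omega>_Cons)
    \<comment> \<open>Either the translated letter is appended, and the first cosets disagree, or it
      merges with or cancels the last letter, and the word is too short.\<close>
    show False
    proof (cases "x = z")
      case False
      then have "w @ [(z, h)] \<in> \<Omega>" using xk s w' False l z by (simp add: \<Omega>_append \<Omega>_Cons)
      then have "w @ [(z, h)] = (y, h) # w" using act_ev 2 by simp
      then show False using ne l by (cases w) auto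
    next
      case True
      have "act (ev w) [(z, h)] = act (ev w') (act (elt x k) [(z, h)])"
        using w' xk s by (simp add: ev_append act.act_mult)
      also have "act (elt x k) [(z, h)] = (if k \<otimes>\<^bsub>G v\<^esub> h = \<one>\<^bsub>G v\<^esub> then [] else [(x, k \<otimes>\<^bsub>G v\<^esub> h)])"
        using xk s True by (simp add: act_elt lmult_def)
      also have "act (ev w') \<dots> = w' @ \<dots>"
        using xk l by (intro act_ev) (auto simp: \<Omega>_append \<Omega>_Cons)
      finally have "length (act (ev w) [(z, h)]) \<le> length w" using w' by (simp split: if_splits)
      then show False using 2 by simp
    qed
  qed
  then show ?thesis using dec m by simp
qed

end

section \<open>Normal subgroups of irreducible graph products\<close>

context graph_product_vertex
begin

text \<open>The word is reversed and its letters inverted. Only the cosets of the result are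
  recorded, because ping-pong looks only at the cosets of the two ends.\<close>

lemma ev_inv:
  assumes "w \<in> \<Omega>"
  obtains w' where "w' \<in> \<Omega>" "ev w' = inv\<^bsub>\<Gamma>\<^esub> ev w" "map fst w' = rev (map fst w)"
proof -
  have "\<exists>w'\<in>\<Omega>. ev w' = inv\<^bsub>\<Gamma>\<^esub> ev w \<and> map fst w' = rev (map fst w)"
    using assms
  proof (induction w)
    case Nil
    show ?case by (intro bexI[of _ "[]"]) simp_all
  next
    case (Cons a w)
    obtain x h where a: "a = (x, h)" by force
    have x: "x \<in> \<Xi>" "h \<in> carrier (G v)" "h \<noteq> \<one>\<^bsub>G v\<^esub>" "w \<in> \<Omega>" "w = [] \<or> fst (hd w) \<noteq> x"
      using Cons.prems by (simp_all add: a \<Omega>_Cons)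
    obtain w' where w': "w' \<in> \<Omega>" "ev w' = inv\<^bsub>\<Gamma>\<^esub> ev w" "map fst w' = rev (map fst w)"
      using Cons.IH x by blast
    have last: "w' = [] \<or> fst (last w') \<noteq> x"
    proof (cases "w = []")
      case False
      then have "w' \<noteq> []" using w'(3) by auto
      then have "fst (last w') = last (map fst w')" by (simp add: last_map)
      also have "\<dots> = fst (hd w)" using w'(3) False by (simp add: last_rev hd_map)
      finally show ?thesis using x False by simp
    qed (use w'(3) in simp)
    have s: "[(x, inv\<^bsub>G v\<^esub> h)] \<in> \<Omega>" using x by (simp add: \<Omega>_Cons)
    have "w' @ [(x, inv\<^bsub>G v\<^esub> h)] \<in> \<Omega>" using w' s last by (simp add: \<Omega>_append)
    moreover have "ev (w' @ [(x, inv\<^bsub>G v\<^esub> h)]) = inv\<^bsub>\<Gamma>\<^esub> ev (a # w)"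
      using x w' s a by (simp add: ev_append elt_inv GP.inv_mult_group)
    ultimately show ?case using w'(3) a by (intro bexI[of _ "w' @ [(x, inv\<^bsub>G v\<^esub> h)]"]) simp_all
  qed
  then show thesis using that by blast
qed

text \<open>The ping-pong domains. A set of letters is allowed so that a domain can be a whole
  factor, \<open>{z} \<times> UNIV\<close>, or a single letter.\<close>

definition starts :: "(('v \<times> 'g) list set set set \<times> 'g) set \<Rightarrow> _" where
  "starts L = {\<eta> \<in> \<Omega>. \<eta> \<noteq> [] \<and> hd \<eta> \<in> L}"

text \<open>Nothing merges when a word ending at \<open>z\<close> is put before one that does not
  start at \<open>z\<close>, and the result starts at \<open>z\<close>.\<close>

lemma ev_starts:
  assumes "w \<in> \<Omega>" "w \<noteq> []" "fst (hd w) = z" "fst (last w) = z" "\<eta> \<in> \<Omega> - starts ({z} \<times> UNIV)"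
  shows "act (ev w) \<eta> \<in> starts ({z} \<times> UNIV)"
proof -
  have "\<eta> = [] \<or> fst (hd \<eta>) \<noteq> z" using assms(5) by (cases "hd \<eta>") (auto simp: starts_def)
  then have "w @ \<eta> \<in> \<Omega>" using assms by (auto simp: \<Omega>_append)
  then show ?thesis
    using act_ev[of w \<eta>] assms by (cases "hd w") (auto simp: starts_def)
qed

text \<open>Off the domain, the inverse letter does not cancel against the first letter of
  \<open>\<eta>\<close>, so the word then starts at \<open>y\<close>; \<open>p\<close> moves it to
  \<open>z\<close>, and the letter is put in front. The domain is one letter instead of the factor
  at \<open>y\<close>, so that two letters at the same coset still have disjoint domains.\<close>

lemma conj_starts:
  assumes l: "(y, h) \<in> \<Lambda>" "y \<noteq> z" and p: "p \<in> carrier \<Gamma>"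
    "\<And>\<eta>. \<eta> \<in> \<Omega> - starts ({z} \<times> UNIV) \<Longrightarrow> act p \<eta> \<in> starts ({z} \<times> UNIV)"
    and \<eta>: "\<eta> \<in> \<Omega> - starts {(y, h)}"
  shows "act (elt y h \<otimes>\<^bsub>\<Gamma>\<^esub> p \<otimes>\<^bsub>\<Gamma>\<^esub> inv\<^bsub>\<Gamma>\<^esub> elt y h) \<eta> \<in> starts {(y, h)}"
proof -
  have l': "y \<in> \<Xi>" "h \<in> carrier (G v)" "h \<noteq> \<one>\<^bsub>G v\<^esub>" using l by (simp_all add: \<Lambda>_def)
  define \<zeta> where "\<zeta> = lmult y (inv\<^bsub>G v\<^esub> h) \<eta>"
  have "\<zeta> \<in> \<Omega>" unfolding \<zeta>_def using l' \<eta> by (intro lmult_closed) simp_all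
  moreover have "\<zeta> \<noteq> [] \<and> fst (hd \<zeta>) = y"
  proof (cases "\<eta> \<noteq> [] \<and> fst (hd \<eta>) = y")
    case True
    then obtain k \<eta>' where k: "\<eta> = (y, k) # \<eta>'" by (cases \<eta>) auto
    then have kc: "k \<in> carrier (G v)" "k \<noteq> h" using \<eta> by (auto simp: starts_def \<Omega>_Cons)
    then have "inv\<^bsub>G v\<^esub> h \<otimes>\<^bsub>G v\<^esub> k \<noteq> \<one>\<^bsub>G v\<^esub>"
      using Gv.inv_solve_left'[of "\<one>\<^bsub>G v\<^esub>" h k] l' by auto
    then show ?thesis using k l' by (simp add: \<zeta>_def lmult_def)
  next
    case False
    then have "\<zeta> = (y, inv\<^bsub>G v\<^esub> h) # \<eta>"
      unfolding \<zeta>_def using l' \<eta> by (intro lmult_Cons) (auto simp: \<Omega>_Cons)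
    then show ?thesis by simp
  qed
  ultimately have "\<zeta> \<in> \<Omega> - starts ({z} \<times> UNIV)" using l by (auto simp: starts_def)
  then have pz: "act p \<zeta> \<in> starts ({z} \<times> UNIV)" by (rule p)
  have "act (elt y h \<otimes>\<^bsub>\<Gamma>\<^esub> p \<otimes>\<^bsub>\<Gamma>\<^esub> inv\<^bsub>\<Gamma>\<^esub> elt y h) \<eta> = lmult y h (act p \<zeta>)"
    using l' p(1) \<eta> pz
    by (simp add: act.act_mult act.act_closed act_elt lmult_closed \<zeta>_def starts_def flip: elt_inv)
  also have "\<dots> = (y, h) # act p \<zeta>"
    using pz l l' by (intro lmult_Cons) (auto simp: starts_def \<Omega>_Cons)
  finally show ?thesis using pz l l' by (auto simp: starts_def \<Omega>_Cons)
qed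

text \<open>The new letter is prepended at a coset other than the first, and its inverse is appended
  or merges with the last letter. Excluding \<open>last w\<close> prevents cancellation there, so
  both ends lie at \<open>y\<close>.\<close>

lemma conj_word:
  assumes w: "w \<in> \<Omega>" "w \<noteq> []" and ends: "fst (hd w) \<noteq> fst (last w)"
    and l: "(y, h) \<in> \<Lambda>" "y \<noteq> fst (hd w)" "(y, h) \<noteq> last w"
  obtains w' where "w' \<in> \<Omega>" "w' \<noteq> []" "fst (hd w') = y" "fst (last w') = y"
    "ev w' = elt y h \<otimes>\<^bsub>\<Gamma>\<^esub> ev w \<otimes>\<^bsub>\<Gamma>\<^esub> inv\<^bsub>\<Gamma>\<^esub> elt y h"
proof -
  have l': "y \<in> \<Xi>" "h \<in> carrier (G v)" "h \<noteq> \<one>\<^bsub>G v\<^esub>" using l by (simp_all add: \<Lambda>_def)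
  obtain u x k where u: "w = u @ [(x, k)]" using w(2) by (metis rev_exhaust surj_pair)
  have "u \<noteq> []" using ends u by auto
  then have hd: "hd w = hd u" using u by simp
  have xk: "x \<in> \<Xi>" "k \<in> carrier (G v)" "k \<noteq> \<one>\<^bsub>G v\<^esub>" "u \<in> \<Omega>" "fst (last u) \<noteq> x"
    using w(1) u \<open>u \<noteq> []\<close> by (simp_all add: \<Omega>_append \<Omega>_Cons)
  have s: "[(y, inv\<^bsub>G v\<^esub> h)] \<in> \<Omega>" using l' by (simp add: \<Omega>_Cons)
  show thesis
  proof (cases "y = x")
    case False
    have "w @ [(y, inv\<^bsub>G v\<^esub> h)] \<in> \<Omega>" using w(1) s False by (subst \<Omega>_append) (simp add: u)
    moreover from this have "(y, h) # w @ [(y, inv\<^bsub>G v\<^esub> h)] \<in> \<Omega>"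
      using l l' w by (simp add: \<Omega>_Cons)
    moreover have "ev ((y, h) # w @ [(y, inv\<^bsub>G v\<^esub> h)]) = elt y h \<otimes>\<^bsub>\<Gamma>\<^esub> ev w \<otimes>\<^bsub>\<Gamma>\<^esub> inv\<^bsub>\<Gamma>\<^esub> elt y h"
      using w s l' by (simp add: ev_append elt_inv GP.m_assoc)
    ultimately show thesis by (intro that[of "(y, h) # w @ [(y, inv\<^bsub>G v\<^esub> h)]"]) simp_all
  next
    case True
    then have "k \<noteq> h" using l(3) u by simp
    then have kh: "k \<otimes>\<^bsub>G v\<^esub> inv\<^bsub>G v\<^esub> h \<noteq> \<one>\<^bsub>G v\<^esub>"
      using Gv.inv_solve_right'[of "\<one>\<^bsub>G v\<^esub>" k h] xk l' by auto
    have s': "[(y, k \<otimes>\<^bsub>G v\<^esub> inv\<^bsub>G v\<^esub> h)] \<in> \<Omega>" "[(x, k)] \<in> \<Omega>" using l' xk kh by (simp_all add: \<Omega>_Cons)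
    have "u @ [(y, k \<otimes>\<^bsub>G v\<^esub> inv\<^bsub>G v\<^esub> h)] \<in> \<Omega>"
      using xk s' True \<open>u \<noteq> []\<close> by (simp add: \<Omega>_append)
    moreover from this have "(y, h) # u @ [(y, k \<otimes>\<^bsub>G v\<^esub> inv\<^bsub>G v\<^esub> h)] \<in> \<Omega>"
      using l l' hd \<open>u \<noteq> []\<close> by (simp add: \<Omega>_Cons)
    moreover have "ev ((y, h) # u @ [(y, k \<otimes>\<^bsub>G v\<^esub> inv\<^bsub>G v\<^esub> h)]) = elt y h \<otimes>\<^bsub>\<Gamma>\<^esub> ev w \<otimes>\<^bsub>\<Gamma>\<^esub> inv\<^bsub>\<Gamma>\<^esub> elt y h"
      using xk s' l' True by (simp add: u ev_append elt_inv elt_mult GP.m_assoc)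
    ultimately show thesis
      by (intro that[of "(y, h) # u @ [(y, k \<otimes>\<^bsub>G v\<^esub> inv\<^bsub>G v\<^esub> h)]"]) simp_all
  qed
qed

text \<open>The players are an element \<open>p\<close> of \<open>N\<close> whose word has both ends
  at one coset, and its conjugates by two letters away from that coset.\<close>

lemma full_sized_normal:
  assumes N: "N \<lhd> \<Gamma>" and m: "m \<in> N" "m \<noteq> \<one>\<^bsub>\<Gamma>\<^esub>" "\<rho> m = \<one>\<^bsub>\<Gamma>\<^esub>"
    and letters: "\<And>z. z \<in> \<Xi> \<Longrightarrow> \<exists>l\<in>\<Lambda>. \<exists>l'\<in>\<Lambda>. l \<noteq> l' \<and> fst l \<noteq> z \<and> fst l' \<noteq> z"
  shows "full_sized (\<Gamma>\<lparr>carrier := N\<rparr>)"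
proof -
  have sub: "subgroup N \<Gamma>" using N by (rule normal_imp_subgroup)
  then have Nc: "x \<in> carrier \<Gamma>" if "x \<in> N" for x using that subgroup.subset by blast
  have conj: "x \<otimes>\<^bsub>\<Gamma>\<^esub> n \<otimes>\<^bsub>\<Gamma>\<^esub> inv\<^bsub>\<Gamma>\<^esub> x \<in> N" if "x \<in> carrier \<Gamma>" "n \<in> N" for x n
    using normal.inv_op_closed2[OF N that] .
  define w0 where "w0 = act m []"
  have w0: "w0 \<in> \<Omega>" unfolding w0_def using m Nc by (intro act.act_closed) simp_all
  \<comment> \<open>As the retraction of \<open>m\<close> is trivial, the decomposition consists of
    the word alone.\<close>
  have m_ev: "m = ev w0" using decompose[OF Nc[OF m(1)]] m w0 by (simp add: w0_def)
  have ne: "w0 \<noteq> []" using m(2) by (auto simp: m_ev)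
  have "\<exists>w\<in>\<Omega>. w \<noteq> [] \<and> fst (hd w) = fst (last w) \<and> ev w \<in> N"
  proof (cases "fst (hd w0) = fst (last w0)")
    case True
    then show ?thesis using w0 ne m m_ev by blast
  next
    case False
    have "fst (hd w0) \<in> \<Xi>" using w0 ne by (cases w0) (auto simp: \<Omega>_Cons)
    \<comment> \<open>Of two letters avoiding the first coset, at least one is not the last letter
      of \<open>w0\<close>.\<close>
    then obtain l where l: "l \<in> \<Lambda>" "fst l \<noteq> fst (hd w0)" "l \<noteq> last w0" using letters by metis
    obtain y h where yh: "l = (y, h)" by force
    have l': "(y, h) \<in> \<Lambda>" "y \<noteq> fst (hd w0)" "(y, h) \<noteq> last w0" using l by (simp_all add: yh)
    obtain w where w: "w \<in> \<Omega>" "w \<noteq> []" "fst (hd w) = y" "fst (last w) = y"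
      "ev w = elt y h \<otimes>\<^bsub>\<Gamma>\<^esub> ev w0 \<otimes>\<^bsub>\<Gamma>\<^esub> inv\<^bsub>\<Gamma>\<^esub> elt y h"
      by (rule conj_word[OF w0 ne False l'])
    have "elt y h \<in> carrier \<Gamma>" using l yh by (simp add: \<Lambda>_def)
    then have "ev w \<in> N" unfolding w(5) m_ev[symmetric] using m(1) by (rule conj)
    then show ?thesis using w(1-4) by (intro bexI[of _ w]) simp_all
  qed
  then obtain w where w: "w \<in> \<Omega>" "w \<noteq> []" "fst (hd w) = fst (last w)" "ev w \<in> N" by blast
  define z where "z = fst (hd w)"
  define P where "P = starts ({z} \<times> UNIV)"
  have "z \<in> \<Xi>" unfolding z_def using w(1,2) by (cases w) (auto simp: \<Omega>_Cons)
  then obtain y h y' h' where l: "(y, h) \<in> \<Lambda>" "(y', h') \<in> \<Lambda>" "(y, h) \<noteq> (y', h')" "y \<noteq> z" "y' \<noteq> z"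
    using letters[of z] by (metis prod.collapse)
  define p where "p = ev w"
  have pN: "p \<in> N" using w by (simp add: p_def)
  have pc: "p \<in> carrier \<Gamma>" using pN by (rule Nc)
  have p1: "act p \<eta> \<in> P" if "\<eta> \<in> \<Omega> - P" for \<eta>
    unfolding p_def P_def
    by (rule ev_starts) (use w(1,2) that in \<open>simp_all add: z_def P_def flip: w(3)\<close>)
  have p2: "act (inv\<^bsub>\<Gamma>\<^esub> p) \<eta> \<in> P" if "\<eta> \<in> \<Omega> - P" for \<eta>
  proof -
    obtain w' where w': "w' \<in> \<Omega>" "ev w' = inv\<^bsub>\<Gamma>\<^esub> ev w" "map fst w' = rev (map fst w)"
      using ev_inv w(1) by blast
    have ne': "w' \<noteq> []" using w'(3) w(2) by auto
    have "fst (hd w') = hd (map fst w')" "fst (last w') = last (map fst w')"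
      using ne' by (simp_all add: hd_map last_map)
    then have "fst (hd w') = z" "fst (last w') = z"
      unfolding w'(3) using w(2) by (simp_all add: hd_rev last_rev hd_map last_map z_def w(3))
    then show ?thesis
      using ev_starts[of w' z \<eta>] w'(1) ne' that unfolding p_def P_def w'(2)[symmetric] by blast
  qed
  define c where "c = (\<lambda>y h. elt y h \<otimes>\<^bsub>\<Gamma>\<^esub> p \<otimes>\<^bsub>\<Gamma>\<^esub> inv\<^bsub>\<Gamma>\<^esub> elt y h)"
  have e: "elt y h \<in> carrier \<Gamma>" if "(y, h) \<in> \<Lambda>" for y h using that by (simp add: \<Lambda>_def)
  have cN: "c y h \<in> N" if "(y, h) \<in> \<Lambda>" for y h
    unfolding c_def using conj[OF e[OF that] pN] .
  have c1: "act (c y h) \<eta> \<in> starts {(y, h)}" if "(y, h) \<in> \<Lambda>" "y \<noteq> z" "\<eta> \<in> \<Omega> - starts {(y, h)}" for y h \<eta>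
    unfolding c_def using conj_starts[OF that(1,2) pc _ that(3)] p1 unfolding P_def by blast
  have c2: "act (inv\<^bsub>\<Gamma>\<^esub> c y h) \<eta> \<in> starts {(y, h)}" if "(y, h) \<in> \<Lambda>" "y \<noteq> z" "\<eta> \<in> \<Omega> - starts {(y, h)}" for y h \<eta>
  proof -
    have "inv\<^bsub>\<Gamma>\<^esub> c y h = elt y h \<otimes>\<^bsub>\<Gamma>\<^esub> inv\<^bsub>\<Gamma>\<^esub> p \<otimes>\<^bsub>\<Gamma>\<^esub> inv\<^bsub>\<Gamma>\<^esub> elt y h"
      using e[OF that(1)] pc by (simp add: c_def GP.inv_mult_group GP.m_assoc)
    then show ?thesis
      using conj_starts[OF that(1,2) GP.inv_closed[OF pc] _ that(3)] p2 unfolding P_def by simp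
  qed
  interpret NA: set_action "\<Gamma>\<lparr>carrier := N\<rparr>" \<Omega> act
  proof (intro set_action.intro set_action_axioms.intro)
    show "group (\<Gamma>\<lparr>carrier := N\<rparr>)" using sub GP.is_group subgroup.subgroup_is_group by blast
  qed (simp_all add: Nc act.act_closed act.act_mult act.act_one)
  have inv: "inv\<^bsub>\<Gamma>\<lparr>carrier := N\<rparr>\<^esub> x = inv\<^bsub>\<Gamma>\<^esub> x" if "x \<in> N" for x
    using GP.m_inv_consistent[OF sub that] .
  show ?thesis
  proof (rule NA.full_sized_ping_pong[where p = p and q = "c y h" and r = "c y' h'"
        and P = P and Q = "starts {(y, h)}" and R = "starts {(y', h')}" and b = "[]"])
    show "P \<subseteq> \<Omega>" "starts {(y, h)} \<subseteq> \<Omega>" "starts {(y', h')} \<subseteq> \<Omega>"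
      by (auto simp: P_def starts_def)
    show "P \<inter> starts {(y, h)} = {}" "P \<inter> starts {(y', h')} = {}" "starts {(y, h)} \<inter> starts {(y', h')} = {}"
      using l by (auto simp: P_def starts_def)
    show "[] \<notin> P" "[] \<notin> starts {(y, h)}" "[] \<notin> starts {(y', h')}" by (simp_all add: P_def starts_def)
  qed (use l p1 p2 c1 c2 pN cN in \<open>simp_all add: inv\<close>)
qed

text \<open>The vertex \<open>u\<close> lies outside the link, so \<open>retr {u}\<close> is an
  invariant of cosets, and it does not kill \<open>\<iota> u g\<close>.\<close>

lemma coset_ne:
  assumes u: "u \<in> V" "u \<noteq> v" "{u, v} \<notin> E" and g: "g \<in> carrier (G u)" "g \<noteq> \<one>\<^bsub>G u\<^esub>"
  shows "\<iota> u g \<bullet> C \<noteq> C"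
proof
  assume eq: "\<iota> u g \<bullet> C = C"
  have "\<one>\<^bsub>\<Gamma>\<^esub> \<bullet> C = C" using trans_one by simp
  then have "retr {u} (\<iota> u g) = retr {u} \<one>\<^bsub>\<Gamma>\<^esub>"
    using eq u g by (intro coset_retr) (simp_all add: link_def)
  then show False using u g incl_eq_one_iff by simp
qed

text \<open>Applied to the empty word, the two products give one-letter words at different
  cosets.\<close>

lemma nonadjacent_noncommuting:
  assumes u: "u \<in> V" "u \<noteq> v" "{u, v} \<notin> E" and g: "g \<in> carrier (G u)" "g \<noteq> \<one>\<^bsub>G u\<^esub>"
    and h: "h \<in> carrier (G v)" "h \<noteq> \<one>\<^bsub>G v\<^esub>"
  shows "\<iota> u g \<otimes>\<^bsub>\<Gamma>\<^esub> \<iota> v h \<noteq> \<iota> v h \<otimes>\<^bsub>\<Gamma>\<^esub> \<iota> u g"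
proof
  assume eq: "\<iota> u g \<otimes>\<^bsub>\<Gamma>\<^esub> \<iota> v h = \<iota> v h \<otimes>\<^bsub>\<Gamma>\<^esub> \<iota> u g"
  have gB: "\<iota> u g \<in> B" using u g by simp
  have s: "[(C, h)] \<in> \<Omega>" "lmult C h [] = [(C, h)]" using h by (simp_all add: \<Omega>_Cons lmult_def)
  have "act (\<iota> u g \<otimes>\<^bsub>\<Gamma>\<^esub> \<iota> v h) [] = [(\<iota> u g \<bullet> C, h)]"
    using u v g h s act_B[OF gB s(1)] by (simp add: act.act_mult act_v)
  moreover have "act (\<iota> v h \<otimes>\<^bsub>\<Gamma>\<^esub> \<iota> u g) [] = [(C, h)]"
    using u v g h s act_B[OF gB \<Omega>_Nil] by (simp add: act.act_mult act_v)
  ultimately show False using eq coset_ne[OF u g] by simp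
qed

end

section \<open>Graph products over at least two vertices that are neither joins nor infinite
  dihedral\<close>

locale irreducible_graph_product = graph_product_data V E G
  for V :: "'v set" and E :: "'v set set" and G :: "'v \<Rightarrow> ('g, 'm) monoid_scheme" +
  assumes finite_V: "finite V" and card_V: "card V \<ge> 2"
    and nontrivial: "\<And>v. v \<in> V \<Longrightarrow> \<not> trivial_group (G v)"
    and indecomposable: "\<not> directly_decomposable V E G"
    and not_dihedral: "\<not> \<Gamma> \<cong> infinite_dihedral_group"
begin

lemma nontrivial_elt:
  assumes "v \<in> V"
  obtains g where "g \<in> carrier (G v)" "g \<noteq> \<one>\<^bsub>G v\<^esub>"
proof -
  interpret Gv: group "G v" using assms vertex_group by blast
  have "carrier (G v) \<noteq> {\<one>\<^bsub>G v\<^esub>}"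
    using nontrivial[OF assms] Gv.is_group by (simp add: trivial_group_def)
  then show thesis using that Gv.one_closed by blast
qed

text \<open>A vertex adjacent to all others would split off as a join factor.\<close>

lemma nonneighbour:
  assumes "v \<in> V"
  obtains u where "u \<in> V" "u \<noteq> v" "{u, v} \<notin> E"
proof -
  have "\<exists>u. u \<in> V \<and> u \<noteq> v \<and> {u, v} \<notin> E"
  proof (rule ccontr)
    assume "\<not> ?thesis"
    then have E: "{v, u} \<in> E" if "u \<in> V - {v}" for u
      using that by (auto simp: insert_commute)
    have "card (V - {v}) > 0" using card_V assms finite_V by simp
    then have "V - {v} \<noteq> {}" by (metis card.empty less_irrefl)
    then have "directly_decomposable V E G"
      using assms E nontrivial by (intro join_decomposable[of "{v}" "V - {v}"]) auto
    then show False using indecomposable by simp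
  qed
  then show thesis using that by blast
qed

text \<open>Two letters outside a given coset are missing only if the link has index two and the group of
  \<open>v\<close> has order two; then \<open>v\<close> has a single non-neighbour \<open>u\<close>, the graph is the join of \<open>{u, v}\<close>
  with the link of \<open>v\<close>, and irreducibility leaves the infinite dihedral group.\<close>

lemma two_letters:
  assumes "v \<in> V"
  defines "\<Lambda> \<equiv> graph_product_vertex.\<Lambda> V E G v" and "\<Xi> \<equiv> graph_product_vertex.\<Xi> V E G v"
  assumes z: "z \<in> \<Xi>"
  shows "\<exists>l\<in>\<Lambda>. \<exists>l'\<in>\<Lambda>. l \<noteq> l' \<and> fst l \<noteq> z \<and> fst l' \<noteq> z"
proof -
  interpret vx: graph_product_vertex V E G v by unfold_locales (rule assms)
  obtain u where u: "u \<in> V" "u \<noteq> v" "{u, v} \<notin> E" using nonneighbour assms by blast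
  obtain g where g: "g \<in> carrier (G u)" "g \<noteq> \<one>\<^bsub>G u\<^esub>" using nontrivial_elt u by blast
  obtain h where h: "h \<in> carrier (G v)" "h \<noteq> \<one>\<^bsub>G v\<^esub>" using nontrivial_elt assms by blast
  let ?x = "vx.transl (\<iota> u g) vx.C"
  have x: "?x \<in> \<Xi>" "?x \<noteq> vx.C" "vx.C \<in> \<Xi>"
    using u g vx.coset_ne[OF u g] by (simp_all add: \<Xi>_def)
  have L: "(y, k) \<in> \<Lambda> \<longleftrightarrow> y \<in> \<Xi> \<and> k \<in> carrier (G v) \<and> k \<noteq> \<one>\<^bsub>G v\<^esub>" for y k
    by (simp add: \<Lambda>_def \<Xi>_def vx.\<Lambda>_def)
  show ?thesis
  \<comment> \<open>A second non-trivial element of the group of \<open>v\<close> gives two letters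
    at one coset other than \<open>z\<close>.\<close>
  proof (cases "\<exists>k \<in> carrier (G v). k \<noteq> \<one>\<^bsub>G v\<^esub> \<and> k \<noteq> h")
    case True
    then obtain k where k: "k \<in> carrier (G v)" "k \<noteq> \<one>\<^bsub>G v\<^esub>" "k \<noteq> h" by blast
    obtain y where y: "y \<in> \<Xi>" "y \<noteq> z" using x by metis
    have "(y, h) \<in> \<Lambda>" "(y, k) \<in> \<Lambda>" using y h k by (simp_all add: L)
    then show ?thesis
      using y(2) k(3) by (intro bexI[of _ "(y, h)"] bexI[of _ "(y, k)"]) simp_all
  next
    case two: False
    then have card_v: "carrier (G v) = {\<one>\<^bsub>G v\<^esub>, h}" using h by blast
    show ?thesis
    \<comment> \<open>Now each coset carries a single letter, so two cosets other than
      \<open>z\<close> are required, hence three in all.\<close>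
    proof (cases "\<exists>y\<in>\<Xi>. y \<noteq> vx.C \<and> y \<noteq> ?x")
      case True
      then obtain y where y: "y \<in> \<Xi>" "y \<noteq> vx.C" "y \<noteq> ?x" by blast
      obtain a b where ab: "a \<in> \<Xi>" "b \<in> \<Xi>" "a \<noteq> b" "a \<noteq> z" "b \<noteq> z" using x y by metis
      have "(a, h) \<in> \<Lambda>" "(b, h) \<in> \<Lambda>" using ab h by (simp_all add: L)
      then show ?thesis
        using ab by (intro bexI[of _ "(a, h)"] bexI[of _ "(b, h)"]) simp_all
    next
      case False
      have only: "vx.transl b vx.C = vx.C \<or> vx.transl b vx.C = ?x" if "b \<in> vx.B" for b
      proof -
        have "vx.transl b vx.C \<in> \<Xi>" unfolding \<Xi>_def using that by (rule vx.trans_C)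
        then show ?thesis using False by metis
      qed
      have C1: "vx.transl \<one>\<^bsub>\<Gamma>\<^esub> vx.C = vx.C" using vx.trans_one by simp
      have only_retr: "retr A b = \<one>\<^bsub>\<Gamma>\<^esub> \<or> retr A b = retr A (\<iota> u g)"
        if "b \<in> vx.B" "A \<inter> vx.link = {}" for b A
        using only[OF that(1)]
      proof
        assume "vx.transl b vx.C = vx.C"
        then have "retr A b = retr A \<one>\<^bsub>\<Gamma>\<^esub>" using that C1 by (intro vx.coset_retr) simp_all
        then show ?thesis by simp
      next
        assume "vx.transl b vx.C = ?x"
        then have "retr A b = retr A (\<iota> u g)" using that u g by (intro vx.coset_retr) simp_all
        then show ?thesis by simp
      qed
      have u_link: "u \<notin> vx.link" using u by (simp add: vx.link_def)
      \<comment> \<open>With only two cosets, \<open>retr {u}\<close> takes only the values of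
        \<open>1\<close> and \<open>g\<close>, yet it is injective on the group of
        \<open>u\<close>.\<close>
      have card_u: "carrier (G u) = {\<one>\<^bsub>G u\<^esub>, g}"
      proof -
        have "k = \<one>\<^bsub>G u\<^esub> \<or> k = g" if k: "k \<in> carrier (G u)" for k
        proof -
          have "retr {u} (\<iota> u k) = \<one>\<^bsub>\<Gamma>\<^esub> \<or> retr {u} (\<iota> u k) = retr {u} (\<iota> u g)"
            using k u u_link by (intro only_retr) simp_all
          then show ?thesis using k u g incl_eq_one_iff inj_on_eq_iff[OF incl_inj] by simp
        qed
        moreover have "\<one>\<^bsub>G u\<^esub> \<in> carrier (G u)"
          using vertex_group[OF u(1), THEN group.is_monoid] by (rule monoid.one_closed)
        ultimately show ?thesis using g by blast
      qed
      \<comment> \<open>A non-trivial element at any other vertex \<open>w\<close> would survive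
        under \<open>retr {w}\<close>, whereas both cosets have trivial value there.\<close>
      have V: "V = {u, v} \<union> vx.link"
      proof -
        have "w = u \<or> w = v \<or> w \<in> vx.link" if w: "w \<in> V" for w
        proof (rule ccontr)
          assume n: "\<not> ?thesis"
          obtain k where k: "k \<in> carrier (G w)" "k \<noteq> \<one>\<^bsub>G w\<^esub>" using nontrivial_elt w by blast
          have "retr {w} (\<iota> w k) = \<one>\<^bsub>\<Gamma>\<^esub> \<or> retr {w} (\<iota> w k) = retr {w} (\<iota> u g)"
            using k w n by (intro only_retr) simp_all
          moreover have "u \<noteq> w" using n by blast
          ultimately show False using k w g u incl_eq_one_iff by simp
        qed
        then show ?thesis using u \<open>v \<in> V\<close> by (auto simp: vx.link_def)
      qed
      have uw: "{u, w} \<in> E" if w: "w \<in> vx.link" for w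
      proof (rule ccontr)
        assume n: "{u, w} \<notin> E"
        have wV: "w \<in> V" "w \<noteq> v" "w \<noteq> u" using w vx.v_link u_link by (auto simp: vx.link_def)
        obtain k where k: "k \<in> carrier (G w)" "k \<noteq> \<one>\<^bsub>G w\<^esub>" using nontrivial_elt wV by blast
        have kC: "\<iota> w k \<in> vx.C" using k w wV by simp
        have c: "\<iota> w k \<in> carrier \<Gamma>" "\<iota> u g \<in> carrier \<Gamma>" "\<iota> u g \<in> vx.B" "\<iota> w k \<in> vx.B"
          using k g u wV by simp_all
        have kg: "\<iota> w k \<otimes>\<^bsub>\<Gamma>\<^esub> \<iota> u g \<in> vx.B" using c by simp
        have "vx.transl (\<iota> w k \<otimes>\<^bsub>\<Gamma>\<^esub> \<iota> u g) vx.C \<noteq> vx.C"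
        proof
          assume "vx.transl (\<iota> w k \<otimes>\<^bsub>\<Gamma>\<^esub> \<iota> u g) vx.C = vx.C"
          then have "retr {u} (\<iota> w k \<otimes>\<^bsub>\<Gamma>\<^esub> \<iota> u g) = retr {u} \<one>\<^bsub>\<Gamma>\<^esub>"
            using kg C1 u_link by (intro vx.coset_retr) simp_all
          then show False using c k g u wV incl_eq_one_iff by simp
        qed
        \<comment> \<open>Only the coset of \<open>g\<close> is left, so the product is
          \<open>\<iota> u g\<close> times some \<open>d\<close> in \<open>C\<close>. Retracting
          onto the link identifies \<open>d\<close> with \<open>\<iota> w k\<close>; thus elements
          of two non-adjacent vertex groups would commute.\<close>
        then have "vx.transl (\<iota> u g) vx.C = vx.transl (\<iota> w k \<otimes>\<^bsub>\<Gamma>\<^esub> \<iota> u g) vx.C" using only[OF kg] by simp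
        then obtain d where d: "d \<in> vx.C" "\<iota> w k \<otimes>\<^bsub>\<Gamma>\<^esub> \<iota> u g = \<iota> u g \<otimes>\<^bsub>\<Gamma>\<^esub> d"
          using vx.coset_eqD[OF c(3) kg] by blast
        have dc: "d \<in> carrier \<Gamma>" "retr vx.link d = d" using d(1) by (simp_all add: par_def)
        have "retr vx.link (\<iota> w k \<otimes>\<^bsub>\<Gamma>\<^esub> \<iota> u g) = \<iota> w k" using c k g u wV w u_link by simp
        moreover have "retr vx.link (\<iota> u g \<otimes>\<^bsub>\<Gamma>\<^esub> d) = d" using c g u u_link dc by simp
        ultimately have "d = \<iota> w k" using d(2) by simp
        then have "\<iota> w k \<otimes>\<^bsub>\<Gamma>\<^esub> \<iota> u g = \<iota> u g \<otimes>\<^bsub>\<Gamma>\<^esub> \<iota> w k" using d(2) by simp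
        moreover interpret wx: graph_product_vertex V E G w by unfold_locales (rule wV)
        have "\<iota> u g \<otimes>\<^bsub>\<Gamma>\<^esub> \<iota> w k \<noteq> \<iota> w k \<otimes>\<^bsub>\<Gamma>\<^esub> \<iota> u g"
          using wV by (intro wx.nonadjacent_noncommuting u n g k) simp
        ultimately show False by simp
      qed
      have "vx.link = {}"
      proof (rule ccontr)
        assume "vx.link \<noteq> {}"
        then have "directly_decomposable V E G"
          using V uw u_link vx.v_link nontrivial
          by (intro join_decomposable[of "{u, v}" vx.link]) (auto simp: vx.link_def insert_commute)
        then show False using indecomposable by simp
      qed
      then have "V = {u, v}" using V by simp
      moreover have "card (carrier (G u)) = 2" using card_u g by simp
      moreover have "card (carrier (G v)) = 2" using card_v h by simp
      ultimately have "\<Gamma> \<cong> infinite_dihedral_group" using u by (intro iso_infinite_dihedral[of u v])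
      then show ?thesis using not_dihedral by simp
    qed
  qed
qed

text \<open>A central element survives the deletion of each single vertex, hence of all vertices in
  turn, and the retraction onto the empty set is trivial.\<close>

lemma central_trivial:
  assumes m: "m \<in> carrier \<Gamma>" and central: "\<And>g. g \<in> carrier \<Gamma> \<Longrightarrow> m \<otimes>\<^bsub>\<Gamma>\<^esub> g = g \<otimes>\<^bsub>\<Gamma>\<^esub> m"
  shows "m = \<one>\<^bsub>\<Gamma>\<^esub>"
proof -
  have \<rho>: "retr (V - {v}) m = m" if "v \<in> V" for v
  proof -
    interpret vx: graph_product_vertex V E G v by unfold_locales (rule that)
    show ?thesis
    proof (rule vx.central_retr[OF m central])
      show "\<exists>l\<in>vx.\<Lambda>. fst l \<noteq> z" if "z \<in> vx.\<Xi>" for z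
        using two_letters[OF \<open>v \<in> V\<close> that] by blast
    qed
  qed
  have "retr (V - A) m = m" if "finite A" "A \<subseteq> V" for A
    using that
  proof (induction A rule: finite_induct)
    case empty
    then show ?case using m by (simp add: retr_all)
  next
    case (insert v A)
    then have "retr (V - A) (retr (V - {v}) m) = m" using \<rho> by simp
    moreover have "(V - A) \<inter> (V - {v}) = V - insert v A" by blast
    ultimately show ?case using retr_retr[OF m, of "V - A" "V - {v}"] by simp
  qed
  from this[OF finite_V] show ?thesis using m by simp
qed

theorem normal_subgroup_full_sized:
  assumes N: "N \<lhd> \<Gamma>" and ne: "N \<noteq> {\<one>\<^bsub>\<Gamma>\<^esub>}"
  shows "full_sized (\<Gamma>\<lparr>carrier := N\<rparr>)"
proof -
  have sub: "subgroup N \<Gamma>" using N by (rule normal_imp_subgroup)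
  then obtain m where m: "m \<in> N" "m \<noteq> \<one>\<^bsub>\<Gamma>\<^esub>" using ne subgroup.one_closed[OF sub] by blast
  have mc: "m \<in> carrier \<Gamma>" using m sub subgroup.subset by blast
  have "\<exists>v\<in>V. \<exists>n\<in>N. n \<noteq> \<one>\<^bsub>\<Gamma>\<^esub> \<and> retr (V - {v}) n = \<one>\<^bsub>\<Gamma>\<^esub>"
  proof (rule ccontr)
    assume triv: "\<not> ?thesis"
    have gen: "m \<otimes>\<^bsub>\<Gamma>\<^esub> \<iota> v h = \<iota> v h \<otimes>\<^bsub>\<Gamma>\<^esub> m" if v: "v \<in> V" "h \<in> carrier (G v)" for v h
    proof -
      let ?c = "commutator \<Gamma> m (\<iota> v h)"
      have "?c = m \<otimes>\<^bsub>\<Gamma>\<^esub> (\<iota> v h \<otimes>\<^bsub>\<Gamma>\<^esub> inv\<^bsub>\<Gamma>\<^esub> m \<otimes>\<^bsub>\<Gamma>\<^esub> inv\<^bsub>\<Gamma>\<^esub> \<iota> v h)"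
        using mc v by (simp add: commutator_def GP.m_assoc)
      moreover have "\<iota> v h \<otimes>\<^bsub>\<Gamma>\<^esub> inv\<^bsub>\<Gamma>\<^esub> m \<otimes>\<^bsub>\<Gamma>\<^esub> inv\<^bsub>\<Gamma>\<^esub> \<iota> v h \<in> N"
        using normal.inv_op_closed2[OF N] subgroup.m_inv_closed[OF sub m(1)] v by simp
      ultimately have "?c \<in> N" using subgroup.m_closed[OF sub m(1)] by simp
      \<comment> \<open>The retraction kills \<open>\<iota> v h\<close>, hence every commutator with
        it.\<close>
      moreover have "retr (V - {v}) ?c = \<one>\<^bsub>\<Gamma>\<^esub>" using mc v by (simp add: commutator_def)
      ultimately have "?c = \<one>\<^bsub>\<Gamma>\<^esub>" using triv v by blast
      then show ?thesis using mc v by (simp add: GP.commutator_eq_one_iff)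
    qed
    have "m \<otimes>\<^bsub>\<Gamma>\<^esub> g = g \<otimes>\<^bsub>\<Gamma>\<^esub> m" if "g \<in> carrier \<Gamma>" for g
      using that
    proof (induction rule: graph_product_induct)
      case one
      then show ?case using mc by simp
    next
      case (incl v h g)
      have "m \<otimes>\<^bsub>\<Gamma>\<^esub> (\<iota> v h \<otimes>\<^bsub>\<Gamma>\<^esub> g) = \<iota> v h \<otimes>\<^bsub>\<Gamma>\<^esub> (m \<otimes>\<^bsub>\<Gamma>\<^esub> g)"
        using gen[OF incl(1,2)] incl(1-3) mc by (metis GP.m_assoc incl_closed)
      then show ?case using incl mc by (simp add: GP.m_assoc)
    qed
    then show False using central_trivial mc m(2) by blast
  qed
  then obtain v n where v: "v \<in> V" and n: "n \<in> N" "n \<noteq> \<one>\<^bsub>\<Gamma>\<^esub>" "retr (V - {v}) n = \<one>\<^bsub>\<Gamma>\<^esub>" by blast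
  interpret vx: graph_product_vertex V E G v by unfold_locales (rule v)
  show ?thesis using vx.full_sized_normal[OF N n] two_letters[OF v] by blast
qed

end

section \<open>Products and inner automorphisms\<close>

lemma (in group_hom) normal_preimage:
  assumes "N \<lhd> H"
  shows "{x \<in> carrier G. h x \<in> N} \<lhd> G"
proof (rule G.normal_invI)
  have N: "subgroup N H" using assms by (rule normal_imp_subgroup)
  show "subgroup {x \<in> carrier G. h x \<in> N} G"
    by (rule G.subgroupI)
      (auto simp: subgroup.m_inv_closed[OF N] subgroup.m_closed[OF N] subgroup.one_closed[OF N]
        intro!: exI[of _ "\<one>"])
  show "x \<otimes> y \<otimes> inv x \<in> {x \<in> carrier G. h x \<in> N}"
    if "x \<in> carrier G" "y \<in> {x \<in> carrier G. h x \<in> N}" for x y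
    using that normal.inv_op_closed2[OF assms] by simp
qed

context graph_product_data
begin

text \<open>Results on the abstract graph product over \<open>A\<close> reach the subgroup
  \<open>par A\<close> through this map. Injectivity comes from a left inverse, again given by the
  universal property.\<close>

lemma parabolic_embedding:
  assumes A: "A \<subseteq> V"
  obtains j where "j \<in> hom (graph_product A (induced_edges E A) G) \<Gamma>"
    "inj_on j (carrier (graph_product A (induced_edges E A) G))"
    "j ` carrier (graph_product A (induced_edges E A) G) = par A"
proof -
  let ?E = "induced_edges E A"
  let ?\<Gamma> = "graph_product A ?E G"
  interpret A: graph_product_data A ?E G
  proof (rule graph_product_data.intro)
    show "simplicial_graph A ?E"
      using simplicial by (auto simp: simplicial_graph_def induced_edges_def)
    show "group (G v)" if "v \<in> A" for v using that A vertex_group by blast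
  qed
  have "\<exists>j. j \<in> hom ?\<Gamma> \<Gamma> \<and> (\<forall>v\<in>A. \<forall>g\<in>carrier (G v). j (A.\<iota> v g) = \<iota> v g)"
  proof (rule A.graph_product_universal[OF GP.is_group, where f = \<iota>])
    show "\<iota> v \<in> hom (G v) \<Gamma>" if "v \<in> A" for v
      using that A by (intro incl_hom) blast
    show "\<iota> u g \<otimes>\<^bsub>\<Gamma>\<^esub> \<iota> v h = \<iota> v h \<otimes>\<^bsub>\<Gamma>\<^esub> \<iota> u g"
      if "{u, v} \<in> ?E" "g \<in> carrier (G u)" "h \<in> carrier (G v)" for u v g h
      using edge_commute[of u v g h] that by (simp add: induced_edges_def)
    fix j assume "j \<in> hom ?\<Gamma> \<Gamma>" "\<And>v g. \<lbrakk>v \<in> A; g \<in> carrier (G v)\<rbrakk> \<Longrightarrow> j (A.\<iota> v g) = \<iota> v g"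
    then show ?thesis by (intro exI[of _ j]) simp
  qed
  then obtain j where j: "j \<in> hom ?\<Gamma> \<Gamma>" "\<And>v g. \<lbrakk>v \<in> A; g \<in> carrier (G v)\<rbrakk> \<Longrightarrow> j (A.\<iota> v g) = \<iota> v g"
    by blast
  \<comment> \<open>The left inverse forgets all vertices outside \<open>A\<close>.\<close>
  let ?f = "\<lambda>v g. if v \<in> A then A.\<iota> v g else \<one>\<^bsub>?\<Gamma>\<^esub>"
  have "\<exists>r. r \<in> hom \<Gamma> ?\<Gamma> \<and> (\<forall>v\<in>V. \<forall>g\<in>carrier (G v). r (\<iota> v g) = ?f v g)"
  proof (rule graph_product_universal[OF A.GP.is_group, where f = ?f])
    show "?f v \<in> hom (G v) ?\<Gamma>" if "v \<in> V" for v
      by (auto intro!: homI simp: A.incl_mult)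
    show "?f u g \<otimes>\<^bsub>?\<Gamma>\<^esub> ?f v h = ?f v h \<otimes>\<^bsub>?\<Gamma>\<^esub> ?f u g"
      if "{u, v} \<in> E" "g \<in> carrier (G u)" "h \<in> carrier (G v)" for u v g h
    proof -
      have "\<lbrakk>u \<in> A; v \<in> A\<rbrakk> \<Longrightarrow> {u, v} \<in> ?E" using that(1) by (simp add: induced_edges_def)
      then show ?thesis using that(2,3) A.edge_commute[of u v g h] by simp
    qed
    fix r assume "r \<in> hom \<Gamma> ?\<Gamma>" "\<And>v g. \<lbrakk>v \<in> V; g \<in> carrier (G v)\<rbrakk> \<Longrightarrow> r (\<iota> v g) = ?f v g"
    then show ?thesis by (intro exI[of _ r]) simp
  qed
  then obtain r where r: "r \<in> hom \<Gamma> ?\<Gamma>" "\<And>v g. \<lbrakk>v \<in> V; g \<in> carrier (G v)\<rbrakk> \<Longrightarrow> r (\<iota> v g) = ?f v g"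
    by blast
  interpret j: group_hom ?\<Gamma> \<Gamma> j
    using j A.GP.is_group GP.is_group by (simp add: group_hom_def group_hom_axioms_def)
  interpret r: group_hom \<Gamma> ?\<Gamma> r
    using r A.GP.is_group GP.is_group by (simp add: group_hom_def group_hom_axioms_def)
  have "r (j x) = x" if "x \<in> carrier ?\<Gamma>" for x
    using that
  proof (induction rule: A.graph_product_induct)
    case (incl v g x)
    then have "v \<in> V" using A by blast
    then show ?case using incl j(2) r(2) by simp
  qed simp
  then have inj: "inj_on j (carrier ?\<Gamma>)" by (rule inj_on_inverseI)
  have "j x \<in> par A" if "x \<in> carrier ?\<Gamma>" for x
    using that
  proof (induction rule: A.graph_product_induct)
    case (incl v g x)
    then have "v \<in> V" using A by blast
    then show ?case
      using incl j(2) subgroup.m_closed[OF subgroup_par, of "\<iota> v g" A "j x"] by simp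
  qed (simp add: par_def)
  moreover have "x \<in> j ` carrier ?\<Gamma>" if "x \<in> par A" for x
    using that
  proof (induction rule: par_induct)
    case one
    then show ?case by (intro image_eqI[of _ _ "\<one>\<^bsub>?\<Gamma>\<^esub>"]) simp_all
  next
    case (incl v g x)
    then obtain y where y: "y \<in> carrier ?\<Gamma>" "x = j y" by blast
    then show ?case
      using incl(1-3) j(2) by (intro image_eqI[of _ _ "A.\<iota> v g \<otimes>\<^bsub>?\<Gamma>\<^esub> y"]) simp_all
  qed
  ultimately have "j ` carrier ?\<Gamma> = par A" by blast
  then show thesis using that j(1) inj by blast
qed

end

text \<open>The commutator of \<open>m\<close> with an element of the factor \<open>P\<close> only sees the component \<open>\<pi> i m\<close>, so a
  normal subgroup that is not killed by \<open>\<pi> i\<close> meets a centerless \<open>P i\<close> non-trivially.\<close>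

locale group_projections = group K for K (structure) +
  fixes I :: "'i set" and P :: "'i \<Rightarrow> 'a set" and \<pi> :: "'i \<Rightarrow> 'a \<Rightarrow> 'a"
  assumes subgroup_P: "i \<in> I \<Longrightarrow> subgroup (P i) K"
    and proj_hom: "i \<in> I \<Longrightarrow> \<pi> i \<in> hom K K"
    and proj_mem: "\<lbrakk>i \<in> I; x \<in> carrier K\<rbrakk> \<Longrightarrow> \<pi> i x \<in> P i"
    and proj_id: "\<lbrakk>i \<in> I; x \<in> P i\<rbrakk> \<Longrightarrow> \<pi> i x = x"
    and proj_other: "\<lbrakk>i \<in> I; j \<in> I; i \<noteq> j; x \<in> P j\<rbrakk> \<Longrightarrow> \<pi> i x = \<one>"
    and proj_ext: "\<lbrakk>x \<in> carrier K; y \<in> carrier K; \<And>i. i \<in> I \<Longrightarrow> \<pi> i x = \<pi> i y\<rbrakk> \<Longrightarrow> x = y"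
begin

lemma P_carrier: "\<lbrakk>i \<in> I; x \<in> P i\<rbrakk> \<Longrightarrow> x \<in> carrier K"
  using subgroup_P subgroup.subset by blast

lemma proj_group_hom: "i \<in> I \<Longrightarrow> group_hom K K (\<pi> i)"
  using proj_hom is_group by (simp add: group_hom_def group_hom_axioms_def)

lemma commutator_proj:
  assumes i: "i \<in> I" and m: "m \<in> carrier K" and x: "x \<in> P i"
  shows "commutator K m x = commutator K (\<pi> i m) x"
proof (rule proj_ext)
  have xc: "x \<in> carrier K" and pm: "\<pi> i m \<in> P i" and pc: "\<pi> i m \<in> carrier K"
    using P_carrier i x m proj_mem by auto
  show "commutator K m x \<in> carrier K" "commutator K (\<pi> i m) x \<in> carrier K"
    using m xc pc by (simp_all add: commutator_def)
  fix k assume k: "k \<in> I"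
  interpret k: group_hom K K "\<pi> k" using k by (rule proj_group_hom)
  show "\<pi> k (commutator K m x) = \<pi> k (commutator K (\<pi> i m) x)"
  proof (cases "k = i")
    case True
    then show ?thesis using proj_id[OF i pm] m xc pc by (simp add: commutator_def flip: True)
  next
    case False
    then show ?thesis using proj_other[OF k i False x] m xc pc by (simp add: commutator_def)
  qed
qed

lemma normal_inter_nontrivial:
  assumes M: "M \<lhd> K" and i: "i \<in> I" and m: "m \<in> M" "\<pi> i m \<noteq> \<one>"
    and centerless: "\<And>z. \<lbrakk>z \<in> P i; \<And>x. x \<in> P i \<Longrightarrow> z \<otimes> x = x \<otimes> z\<rbrakk> \<Longrightarrow> z = \<one>"
  shows "M \<inter> P i \<noteq> {\<one>}"
proof -
  have sub: "subgroup M K" using M by (rule normal_imp_subgroup)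
  have mc: "m \<in> carrier K" using m(1) subgroup.subset[OF sub] by blast
  have pm: "\<pi> i m \<in> P i" using proj_mem[OF i mc] .
  then obtain x where x: "x \<in> P i" "\<pi> i m \<otimes> x \<noteq> x \<otimes> \<pi> i m" using centerless m(2) by blast
  have xc: "x \<in> carrier K" "\<pi> i m \<in> carrier K" using P_carrier[OF i] x pm by auto
  let ?c = "commutator K m x"
  have eq: "?c = commutator K (\<pi> i m) x" using commutator_proj[OF i mc x(1)] .
  then have "?c \<noteq> \<one>" using x(2) xc commutator_eq_one_iff by simp
  moreover have "?c \<in> P i"
    unfolding eq unfolding commutator_def using subgroup_P[OF i] pm x(1)
    by (simp add: subgroup.m_closed subgroup.m_inv_closed)
  moreover have "?c \<in> M"
  proof -
    have "?c = m \<otimes> (x \<otimes> inv m \<otimes> inv x)" using mc xc by (simp add: commutator_def m_assoc)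
    then show ?thesis
      using normal.inv_op_closed2[OF M xc(1)] subgroup.m_inv_closed[OF sub m(1)] subgroup.m_closed[OF sub m(1)]
      by simp
  qed
  ultimately show ?thesis by blast
qed

end

text \<open>The projections are the coordinates of the inverse isomorphism.\<close>

lemma (in group) internal_direct_product_projections:
  assumes P: "\<And>i. i \<in> I \<Longrightarrow> subgroup (P i) G"
    and prod: "internal_direct_product G I (\<lambda>i. G\<lparr>carrier := P i\<rparr>)"
  obtains \<pi> where "group_projections G I P \<pi>"
proof -
  let ?H = "\<lambda>i. G\<lparr>carrier := P i\<rparr>"
  let ?D = "product_group I ?H"
  obtain \<phi> where \<phi>: "\<phi> \<in> iso ?D G" "\<And>i x. \<lbrakk>i \<in> I; x \<in> P i\<rbrakk> \<Longrightarrow> \<phi> (\<lambda>j\<in>I. if j = i then x else \<one>) = x"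
    using prod unfolding internal_direct_product_def by (auto cong: if_cong)
  have D: "group ?D" using P is_group subgroup.subgroup_is_group by (intro product_group) blast
  define \<psi> where "\<psi> = inv_into (carrier ?D) \<phi>"
  have \<psi>: "\<psi> \<in> iso G ?D" unfolding \<psi>_def using group.iso_set_sym[OF D \<phi>(1)] .
  then have \<psi>_hom: "\<psi> \<in> hom G ?D" and \<psi>_inj: "inj_on \<psi> (carrier G)" by (simp_all add: iso_def bij_betw_def)
  have \<psi>_mem: "\<psi> x \<in> (\<Pi>\<^sub>E i\<in>I. P i)" if "x \<in> carrier G" for x
    using hom_in_carrier[OF \<psi>_hom that] by simp
  have P1: "\<one> \<in> P i" if "i \<in> I" for i using subgroup.one_closed[OF P[OF that]] .
  \<comment> \<open>The requirement that the isomorphism restrict to the inclusions enters here: it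
    fixes the coordinates of elements of a single factor.\<close>
  have single: "\<psi> x = (\<lambda>j\<in>I. if j = i then x else \<one>)" if "i \<in> I" "x \<in> P i" for i x
  proof -
    have "(\<lambda>j\<in>I. if j = i then x else \<one>) \<in> carrier ?D" using that P1 by simp
    moreover have "inj_on \<phi> (carrier ?D)" using \<phi>(1) by (simp add: iso_def bij_betw_def)
    ultimately show ?thesis unfolding \<psi>_def using \<phi>(2)[OF that] inv_into_f_f by metis
  qed
  show thesis
  proof (rule that[of "\<lambda>i x. \<psi> x i"], intro group_projections.intro group_projections_axioms.intro is_group P)
    fix i assume i: "i \<in> I"
    show mem: "\<psi> x i \<in> P i" if "x \<in> carrier G" for x using \<psi>_mem[OF that] i by (rule PiE_mem)
    show "(\<lambda>x. \<psi> x i) \<in> hom G G"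
    proof (rule homI)
      show "\<psi> x i \<in> carrier G" if "x \<in> carrier G" for x
        using mem[OF that] subgroup.subset[OF P[OF i]] by blast
      show "\<psi> (x \<otimes> y) i = \<psi> x i \<otimes> \<psi> y i" if "x \<in> carrier G" "y \<in> carrier G" for x y
        using hom_mult[OF \<psi>_hom that] i by simp
    qed
    show "\<psi> x i = x" if "x \<in> P i" for x using single[OF i that] i by simp
    show "\<psi> x i = \<one>" if "j \<in> I" "i \<noteq> j" "x \<in> P j" for j x using single[OF that(1,3)] i that(2) by simp
  next
    fix x y assume x: "x \<in> carrier G" and y: "y \<in> carrier G" and eq: "\<And>i. i \<in> I \<Longrightarrow> \<psi> x i = \<psi> y i"
    have "\<psi> x = \<psi> y" using \<psi>_mem[OF x] \<psi>_mem[OF y] eq by (rule PiE_ext)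
    then show "x = y" using \<psi>_inj x y by (simp add: inj_on_eq_iff)
  qed
qed

section \<open>Inner automorphisms inside normal subgroups of the automorphism group\<close>

context group
begin

definition inner :: "'a \<Rightarrow> 'a \<Rightarrow> 'a" where
  "inner g = (\<lambda>x\<in>carrier G. g \<otimes> x \<otimes> inv g)"

lemma auto_mult:
  "\<lbrakk>\<phi> \<in> auto G; \<psi> \<in> auto G\<rbrakk> \<Longrightarrow> \<phi> \<otimes>\<^bsub>AutoGroup G\<^esub> \<psi> = compose (carrier G) \<phi> \<psi>"
  by (simp add: AutoGroup_def BijGroup_def auto_def)

lemma auto_one: "\<one>\<^bsub>AutoGroup G\<^esub> = (\<lambda>x\<in>carrier G. x)"
  by (simp add: AutoGroup_def BijGroup_def)

lemma auto_carrier [simp]: "carrier (AutoGroup G) = auto G"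
  by (simp add: AutoGroup_def)

lemma auto_hom: "\<phi> \<in> auto G \<Longrightarrow> group_hom G G \<phi>"
  using is_group by (simp add: auto_def group_hom_def group_hom_axioms_def)

lemma conj_comp: "\<lbrakk>g \<in> carrier G; h \<in> carrier G; x \<in> carrier G\<rbrakk>
    \<Longrightarrow> g \<otimes> h \<otimes> x \<otimes> inv (g \<otimes> h) = g \<otimes> (h \<otimes> x \<otimes> inv h) \<otimes> inv g"
  by (simp add: m_assoc inv_mult_group)

lemma inner_auto:
  assumes g: "g \<in> carrier G"
  shows "inner g \<in> auto G"
proof -
  have "(\<lambda>g. inner g) \<in> hom G (BijGroup (carrier G))"
    unfolding inner_def using is_group by (rule hom_BijGroupI) (simp_all add: conj_comp)
  then have "inner g \<in> Bij (carrier G)" using g hom_in_carrier by (fastforce simp: BijGroup_def)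
  moreover have "inner g \<in> hom G G"
  proof (rule homI)
    fix x y assume x: "x \<in> carrier G" and y: "y \<in> carrier G"
    have "inv g \<otimes> (g \<otimes> z) = z" if "z \<in> carrier G" for z using g that by (simp flip: m_assoc)
    then show "inner g (x \<otimes> y) = inner g x \<otimes> inner g y"
      using g x y by (simp add: inner_def m_assoc)
  qed (simp add: inner_def g)
  ultimately show ?thesis by (simp add: auto_def)
qed

lemma inner_hom: "inner \<in> hom G (AutoGroup G)"
proof (rule homI)
  fix g h assume g: "g \<in> carrier G" and h: "h \<in> carrier G"
  have "inner (g \<otimes> h) = compose (carrier G) (inner g) (inner h)"
    using g h by (auto simp: compose_def inner_def conj_comp fun_eq_iff)
  then show "inner (g \<otimes> h) = inner g \<otimes>\<^bsub>AutoGroup G\<^esub> inner h"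
    using g h inner_auto auto_mult by simp
qed (simp add: inner_auto)

lemma inner_group_hom: "group_hom G (AutoGroup G) inner"
  using inner_hom AutoGroup is_group by (simp add: group_hom_def group_hom_axioms_def)

text \<open>Since \<open>inner (\<phi> g)\<close> is the conjugate of \<open>inner g\<close> by
  \<open>\<phi>\<close>, the displacement is sent to the commutator of \<open>\<phi>\<close> and
  \<open>inner g\<close>, which normality puts into \<open>N\<close>.\<close>

lemma inner_displacement:
  assumes N: "N \<lhd> AutoGroup G" and \<phi>: "\<phi> \<in> N" and g: "g \<in> carrier G"
  shows "\<phi> g \<otimes> inv g \<in> {g \<in> carrier G. inner g \<in> N}"
proof -
  have sub: "subgroup N (AutoGroup G)" using N by (rule normal_imp_subgroup)
  have \<phi>a: "\<phi> \<in> auto G" using subgroup.subset[OF sub] \<phi> by auto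
  interpret A: group "AutoGroup G" by (rule AutoGroup)
  interpret inner: group_hom G "AutoGroup G" inner by (rule inner_group_hom)
  interpret \<phi>: group_hom G G \<phi> using \<phi>a by (rule auto_hom)
  have "\<phi> \<otimes>\<^bsub>AutoGroup G\<^esub> inner g = inner (\<phi> g) \<otimes>\<^bsub>AutoGroup G\<^esub> \<phi>"
  proof -
    have "compose (carrier G) \<phi> (inner g) = compose (carrier G) (inner (\<phi> g)) \<phi>"
      using g by (auto simp: compose_def inner_def fun_eq_iff)
    then show ?thesis using g \<phi>a inner_auto by (simp add: auto_mult)
  qed
  moreover have c: "\<phi> \<in> carrier (AutoGroup G)" "inner g \<in> carrier (AutoGroup G)"
      "inner (\<phi> g) \<in> carrier (AutoGroup G)"
    using \<phi>a g inner_auto by simp_all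
  ultimately have eq: "inner (\<phi> g) = \<phi> \<otimes>\<^bsub>AutoGroup G\<^esub> inner g \<otimes>\<^bsub>AutoGroup G\<^esub> inv\<^bsub>AutoGroup G\<^esub> \<phi>"
    by (intro iffD2[OF A.inv_solve_right] A.m_closed)
  have "inner (\<phi> g \<otimes> inv g) = inner (\<phi> g) \<otimes>\<^bsub>AutoGroup G\<^esub> inv\<^bsub>AutoGroup G\<^esub> inner g"
    using g by simp
  also have "\<dots> =
      \<phi> \<otimes>\<^bsub>AutoGroup G\<^esub> (inner g \<otimes>\<^bsub>AutoGroup G\<^esub> inv\<^bsub>AutoGroup G\<^esub> \<phi> \<otimes>\<^bsub>AutoGroup G\<^esub> inv\<^bsub>AutoGroup G\<^esub> inner g)"
    unfolding eq using c(1,2) by (simp add: A.m_assoc del: auto_carrier)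
  also have "\<dots> \<in> N"
    using subgroup.m_closed[OF sub \<phi>] normal.inv_op_closed2[OF N, of "inner g" "inv\<^bsub>AutoGroup G\<^esub> \<phi>"]
      subgroup.m_inv_closed[OF sub \<phi>] g inner_auto by simp
  finally show ?thesis using g by simp
qed

text \<open>The kernel of \<open>inner\<close> on \<open>L\<close> consists of the elements of
  \<open>L\<close> that are central in the whole group, so \<open>inner\<close> embeds
  \<open>L\<close> into \<open>N\<close>.\<close>

lemma inner_full_sized:
  assumes N: "N \<lhd> AutoGroup G" and L: "subgroup L G" "full_sized (G\<lparr>carrier := L\<rparr>)"
    and LN: "\<And>x. x \<in> L \<Longrightarrow> inner x \<in> N"
    and centerless: "\<And>z. \<lbrakk>z \<in> L; \<And>x. x \<in> carrier G \<Longrightarrow> z \<otimes> x = x \<otimes> z\<rbrakk> \<Longrightarrow> z = \<one>"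
  shows "full_sized (AutoGroup G\<lparr>carrier := N\<rparr>)"
proof (rule full_sized_inj_hom[OF L(2)])
  have sub: "subgroup N (AutoGroup G)" using N by (rule normal_imp_subgroup)
  have Lc: "x \<in> carrier G" if "x \<in> L" for x using that subgroup.subset[OF L(1)] by blast
  show g: "group (G\<lparr>carrier := L\<rparr>)" "group (AutoGroup G\<lparr>carrier := N\<rparr>)"
    using subgroup.subgroup_is_group[OF L(1) is_group] subgroup.subgroup_is_group[OF sub AutoGroup] .
  show hom: "inner \<in> hom (G\<lparr>carrier := L\<rparr>) (AutoGroup G\<lparr>carrier := N\<rparr>)"
    by (rule homI) (simp_all add: LN Lc hom_mult[OF inner_hom])
  interpret r: group_hom "G\<lparr>carrier := L\<rparr>" "AutoGroup G\<lparr>carrier := N\<rparr>" inner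
    using g hom by (simp add: group_hom_def group_hom_axioms_def)
  have "z = \<one>" if z: "z \<in> L" "inner z = \<one>\<^bsub>AutoGroup G\<^esub>" for z
  proof (rule centerless[OF z(1)])
    fix x assume x: "x \<in> carrier G"
    have "z \<otimes> x \<otimes> inv z = x" using fun_cong[OF z(2), of x] x by (simp add: inner_def auto_one)
    then show "z \<otimes> x = x \<otimes> z" using x Lc[OF z(1)] by (simp add: inv_solve_right')
  qed
  then show "inj_on inner (carrier (G\<lparr>carrier := L\<rparr>))"
    using r.inj_on_one_iff by simp
qed

end

context graph_product_data
begin

text \<open>Normal subgroups of \<open>par A\<close> are pulled back along the embedding, and the
  free subgroup found there is pushed forward.\<close>

lemma irreducible_parabolic:
  assumes A: "A \<subseteq> V" and irr: "irreducible_graph_product A (induced_edges E A) G"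
  shows parabolic_normal_full_sized:
      "\<lbrakk>N \<lhd> \<Gamma>\<lparr>carrier := par A\<rparr>; N \<noteq> {\<one>\<^bsub>\<Gamma>\<^esub>}\<rbrakk> \<Longrightarrow> full_sized (\<Gamma>\<lparr>carrier := N\<rparr>)"
    and parabolic_centerless:
      "\<lbrakk>z \<in> par A; \<And>x. x \<in> par A \<Longrightarrow> z \<otimes>\<^bsub>\<Gamma>\<^esub> x = x \<otimes>\<^bsub>\<Gamma>\<^esub> z\<rbrakk> \<Longrightarrow> z = \<one>\<^bsub>\<Gamma>\<^esub>"
proof -
  let ?\<Gamma> = "graph_product A (induced_edges E A) G"
  let ?P = "\<Gamma>\<lparr>carrier := par A\<rparr>"
  interpret A: irreducible_graph_product A "induced_edges E A" G by (rule irr)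
  obtain j where j: "j \<in> hom ?\<Gamma> \<Gamma>" "inj_on j (carrier ?\<Gamma>)" "j ` carrier ?\<Gamma> = par A"
    using parabolic_embedding[OF A] by blast
  have jP: "j x \<in> par A" if "x \<in> carrier ?\<Gamma>" for x using j(3) that by blast
  have P: "group ?P" using subgroup.subgroup_is_group[OF subgroup_par GP.is_group] .
  interpret j: group_hom ?\<Gamma> ?P j
    using j(1) A.GP.is_group P jP by (simp add: group_hom_def group_hom_axioms_def hom_def)
  show "full_sized (\<Gamma>\<lparr>carrier := N\<rparr>)" if N: "N \<lhd> ?P" "N \<noteq> {\<one>\<^bsub>\<Gamma>\<^esub>}"
  proof -
    let ?M = "{x \<in> carrier ?\<Gamma>. j x \<in> N}"
    have subN: "subgroup N ?P" using N(1) by (rule normal_imp_subgroup)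
    have M: "?M \<lhd> ?\<Gamma>" using j.normal_preimage[OF N(1)] .
    obtain y where y: "y \<in> N" "y \<noteq> \<one>\<^bsub>\<Gamma>\<^esub>" using N(2) subgroup.one_closed[OF subN] by auto
    have "y \<in> par A" using subgroup.subset[OF subN] y(1) by auto
    then obtain x where x: "x \<in> carrier ?\<Gamma>" "y = j x" using j(3) by blast
    have "x \<noteq> \<one>\<^bsub>?\<Gamma>\<^esub>" using x y(2) j.hom_one by auto
    then have "?M \<noteq> {\<one>\<^bsub>?\<Gamma>\<^esub>}" using x y(1) by blast
    then have f: "full_sized (?\<Gamma>\<lparr>carrier := ?M\<rparr>)" by (rule A.normal_subgroup_full_sized[OF M])
    show ?thesis
    proof (rule full_sized_inj_hom[OF f])
      show "group (?\<Gamma>\<lparr>carrier := ?M\<rparr>)"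
        using subgroup.subgroup_is_group[OF normal_imp_subgroup[OF M] A.GP.is_group] .
      show "group (\<Gamma>\<lparr>carrier := N\<rparr>)" using subgroup.subgroup_is_group[OF subN P] by simp
      show "j \<in> hom (?\<Gamma>\<lparr>carrier := ?M\<rparr>) (\<Gamma>\<lparr>carrier := N\<rparr>)"
        by (rule homI) (simp_all add: hom_mult[OF j(1)])
      show "inj_on j (carrier (?\<Gamma>\<lparr>carrier := ?M\<rparr>))" using j(2) by (rule inj_on_subset) auto
    qed
  qed
  show "z = \<one>\<^bsub>\<Gamma>\<^esub>" if z: "z \<in> par A" "\<And>x. x \<in> par A \<Longrightarrow> z \<otimes>\<^bsub>\<Gamma>\<^esub> x = x \<otimes>\<^bsub>\<Gamma>\<^esub> z"
  proof -
    obtain y where y: "y \<in> carrier ?\<Gamma>" "z = j y" using j(3) z(1) by blast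
    have "y \<otimes>\<^bsub>?\<Gamma>\<^esub> x = x \<otimes>\<^bsub>?\<Gamma>\<^esub> y" if x: "x \<in> carrier ?\<Gamma>" for x
    proof -
      have "j (y \<otimes>\<^bsub>?\<Gamma>\<^esub> x) = j (x \<otimes>\<^bsub>?\<Gamma>\<^esub> y)"
        using z(2)[OF jP[OF x]] x y by (simp add: hom_mult[OF j(1)])
      then show ?thesis by (rule inj_onD[OF j(2)]) (use x y(1) in simp_all)
    qed
    then have "y = \<one>\<^bsub>?\<Gamma>\<^esub>" by (rule A.central_trivial[OF y(1)])
    then show ?thesis using y(2) j.hom_one by simp
  qed
qed

lemma special_parabolic_iso:
  assumes "A \<subseteq> V"
  shows "graph_product A (induced_edges E A) G \<cong> special_parabolic V E G A"
proof -
  obtain j where "j \<in> hom (graph_product A (induced_edges E A) G) \<Gamma>"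
    "inj_on j (carrier (graph_product A (induced_edges E A) G))"
    "j ` carrier (graph_product A (induced_edges E A) G) = par A"
    using parabolic_embedding[OF assms] by blast
  then have "j \<in> iso (graph_product A (induced_edges E A) G) (\<Gamma>\<lparr>carrier := par A\<rparr>)"
    by (auto simp: iso_def hom_def bij_betw_def)
  then show ?thesis unfolding special_parabolic_eq[OF assms] by (rule is_isoI)
qed

end

section \<open>Normal subgroups of the automorphism group of a decomposed graph product\<close>

locale indecomposable_decomposition = graph_product_data V E G
  for V :: "'v set" and E :: "'v set set" and G :: "'v \<Rightarrow> ('g, 'm) monoid_scheme" +
  fixes n :: nat and W :: "nat \<Rightarrow> 'v set"
  assumes finite_V: "finite V"
    and nontrivial: "\<And>v. v \<in> V \<Longrightarrow> \<not> trivial_group (G v)"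
    and decomposition: "parabolic_decomposition V E G n W"
    and indecomposable: "\<And>i. i \<in> {1..n} \<Longrightarrow> \<not> directly_decomposable (W i) (induced_edges E (W i)) G"
    and not_dihedral: "\<And>i. i \<in> {1..n} \<Longrightarrow> \<not> special_parabolic V E G (W i) \<cong> infinite_dihedral_group"
begin

lemma W_sub: "i \<in> {1..n} \<Longrightarrow> W i \<subseteq> V"
  using decomposition by (simp add: parabolic_decomposition_def)

lemma graph_product_data_W:
  assumes "i \<in> {1..n}"
  shows "graph_product_data (W i) (induced_edges E (W i)) G"
proof (rule graph_product_data.intro)
  show "simplicial_graph (W i) (induced_edges E (W i))"
    using simplicial by (auto simp: simplicial_graph_def induced_edges_def)
  show "group (G v)" if "v \<in> W i" for v using that W_sub[OF assms] vertex_group by blast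
qed

text \<open>An empty factor cannot occur, because the empty graph counts as decomposable.\<close>

lemma W_cases:
  assumes i: "i \<in> {1..n}"
  obtains v where "W i = {v}" "v \<in> V" | "card (W i) \<ge> 2"
proof -
  interpret Wi: graph_product_data "W i" "induced_edges E (W i)" G
    using i by (rule graph_product_data_W)
  have fin: "finite (W i)" using finite_subset[OF W_sub[OF i] finite_V] .
  have "W i \<noteq> {}" using Wi.empty_decomposable indecomposable[OF i] by blast
  then have "card (W i) \<noteq> 0" using fin by simp
  then consider "card (W i) = 1" | "card (W i) \<ge> 2" by linarith
  then show thesis
  proof cases
    case 1
    then obtain v where "W i = {v}" using card_1_singletonE by blast
    then show thesis using that(1) W_sub[OF i] by blast
  qed (rule that(2))
qed

lemma irreducible_W:
  assumes i: "i \<in> {1..n}" and card: "card (W i) \<ge> 2"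
  shows "irreducible_graph_product (W i) (induced_edges E (W i)) G"
proof -
  interpret Wi: graph_product_data "W i" "induced_edges E (W i)" G
    using i by (rule graph_product_data_W)
  show ?thesis
  proof
    show "finite (W i)" using finite_subset[OF W_sub[OF i] finite_V] .
    show "2 \<le> card (W i)" by (rule card)
    show "\<not> trivial_group (G v)" if "v \<in> W i" for v using that W_sub[OF i] nontrivial by blast
    show "\<not> directly_decomposable (W i) (induced_edges E (W i)) G" using indecomposable[OF i] .
    show "\<not> Wi.\<Gamma> \<cong> infinite_dihedral_group"
    proof
      assume "Wi.\<Gamma> \<cong> infinite_dihedral_group"
      moreover have "special_parabolic V E G (W i) \<cong> Wi.\<Gamma>"
        using Wi.GP.iso_sym[OF special_parabolic_iso[OF W_sub[OF i]]] .
      ultimately show False using not_dihedral[OF i] iso_trans by blast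
    qed
  qed
qed

definition \<pi> where
  "\<pi> = (SOME \<pi>. group_projections \<Gamma> {1..n} (\<lambda>i. par (W i)) \<pi>)"

sublocale pr: group_projections \<Gamma> "{1..n}" "\<lambda>i. par (W i)" \<pi>
proof -
  have H: "internal_direct_product \<Gamma> {1..n} (\<lambda>i. special_parabolic V E G (W i))"
    using decomposition by (simp add: parabolic_decomposition_def)
  have "internal_direct_product \<Gamma> {1..n} (\<lambda>i. \<Gamma>\<lparr>carrier := par (W i)\<rparr>)"
  proof -
    have eq: "special_parabolic V E G (W i) = \<Gamma>\<lparr>carrier := par (W i)\<rparr>" if "i \<in> {1..n}" for i
      using special_parabolic_eq[OF W_sub[OF that]] .
    have "product_group {1..n} (\<lambda>i. special_parabolic V E G (W i)) = product_group {1..n} (\<lambda>i. \<Gamma>\<lparr>carrier := par (W i)\<rparr>)"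
      using eq by (auto simp: product_group_def fun_eq_iff intro!: PiE_cong)
    moreover have "(\<lambda>j\<in>{1..n}. if j = i then x else \<one>\<^bsub>special_parabolic V E G (W j)\<^esub>) =
        (\<lambda>j\<in>{1..n}. if j = i then x else \<one>\<^bsub>\<Gamma>\<lparr>carrier := par (W j)\<rparr>\<^esub>)" for i x
      using eq by (intro restrict_ext) simp
    ultimately show ?thesis using H eq unfolding internal_direct_product_def by simp
  qed
  then have "\<exists>\<pi>. group_projections \<Gamma> {1..n} (\<lambda>i. par (W i)) \<pi>"
    using GP.internal_direct_product_projections[of "{1..n}" "\<lambda>i. par (W i)"] subgroup_par by metis
  then show "group_projections \<Gamma> {1..n} (\<lambda>i. par (W i)) \<pi>" unfolding \<pi>_def by (rule someI_ex)
qed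

abbreviation "\<A> \<equiv> AutoGroup \<Gamma>"

text \<open>The preimage of \<open>N\<close> under \<open>inner\<close> is normal and has a
  non-trivial \<open>i\<close>-th component, so it meets the centerless factor
  \<open>par (W i)\<close> non-trivially. The intersection is full-sized, and \<open>inner\<close>
  is injective on it because what is central in the whole group is central in the factor.\<close>

lemma full_sized_component:
  assumes N: "N \<lhd> \<A>" and i: "i \<in> {1..n}" and card: "card (W i) \<ge> 2"
    and m: "m \<in> carrier \<Gamma>" "GP.inner m \<in> N" "\<pi> i m \<noteq> \<one>\<^bsub>\<Gamma>\<^esub>"
  shows "full_sized (\<A>\<lparr>carrier := N\<rparr>)"
proof -
  let ?M = "{g \<in> carrier \<Gamma>. GP.inner g \<in> N}"
  interpret inner: group_hom \<Gamma> \<A> GP.inner by (rule GP.inner_group_hom)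
  have M: "?M \<lhd> \<Gamma>" using inner.normal_preimage[OF N] .
  note irr = irreducible_parabolic[OF W_sub[OF i] irreducible_W[OF i card]]
  have ne: "?M \<inter> par (W i) \<noteq> {\<one>\<^bsub>\<Gamma>\<^esub>}"
    using m irr(2) by (intro pr.normal_inter_nontrivial[OF M i, of m]) auto
  have sub: "subgroup (?M \<inter> par (W i)) \<Gamma>"
    using GP.subgroups_Inter_pair normal_imp_subgroup[OF M] subgroup_par by blast
  have "?M \<inter> par (W i) \<lhd> \<Gamma>\<lparr>carrier := par (W i)\<rparr>"
    using GP.normal_Int_subgroup[OF subgroup_par M] by (simp add: Int_commute)
  then have f: "full_sized (\<Gamma>\<lparr>carrier := ?M \<inter> par (W i)\<rparr>)" using ne by (rule irr(1))
  show ?thesis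
  proof (rule GP.inner_full_sized[OF N sub f])
    show "z = \<one>\<^bsub>\<Gamma>\<^esub>" if "z \<in> ?M \<inter> par (W i)" "\<And>x. x \<in> carrier \<Gamma> \<Longrightarrow> z \<otimes>\<^bsub>\<Gamma>\<^esub> x = x \<otimes>\<^bsub>\<Gamma>\<^esub> z" for z
      using that par_carrier by (intro irr(2)) auto
  qed simp
qed

text \<open>A non-trivial automorphism moves some \<open>g\<close>; the displacement is then
  non-trivial and so has a non-trivial component in some factor, each of which has at least two
  vertices.\<close>

lemma normal_subgroup_of_Aut_full_sized:
  assumes card: "\<And>i. i \<in> {1..n} \<Longrightarrow> card (W i) \<ge> 2"
    and N: "N \<lhd> \<A>" "N \<noteq> {\<one>\<^bsub>\<A>\<^esub>}"
  shows "full_sized (\<A>\<lparr>carrier := N\<rparr>)"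
proof -
  have sub: "subgroup N \<A>" using N(1) by (rule normal_imp_subgroup)
  obtain \<phi> where \<phi>: "\<phi> \<in> N" "\<phi> \<noteq> \<one>\<^bsub>\<A>\<^esub>" using N(2) subgroup.one_closed[OF sub] by blast
  have \<phi>a: "\<phi> \<in> auto \<Gamma>" using subgroup.subset[OF sub] \<phi>(1) by auto
  interpret \<phi>: group_hom \<Gamma> \<Gamma> \<phi> using \<phi>a by (rule GP.auto_hom)
  have "\<phi> \<in> extensional (carrier \<Gamma>)" using \<phi>a by (simp add: auto_def Bij_def)
  then have "\<exists>g\<in>carrier \<Gamma>. \<phi> g \<noteq> g"
    using \<phi>(2) extensionalityI[of \<phi> "carrier \<Gamma>" "\<lambda>x\<in>carrier \<Gamma>. x"] by (auto simp: GP.auto_one)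
  then obtain g where g: "g \<in> carrier \<Gamma>" "\<phi> g \<noteq> g" by blast
  let ?m = "\<phi> g \<otimes>\<^bsub>\<Gamma>\<^esub> inv\<^bsub>\<Gamma>\<^esub> g"
  have m: "?m \<in> carrier \<Gamma>" "GP.inner ?m \<in> N"
    using GP.inner_displacement[OF N(1) \<phi>(1) g(1)] by simp_all
  have m1: "?m \<noteq> \<one>\<^bsub>\<Gamma>\<^esub>" using g GP.inv_solve_right'[of "\<one>\<^bsub>\<Gamma>\<^esub>" "\<phi> g" g] by simp
  have "\<exists>i\<in>{1..n}. \<pi> i ?m \<noteq> \<one>\<^bsub>\<Gamma>\<^esub>"
  proof (rule ccontr)
    assume none: "\<not> ?thesis"
    have "?m = \<one>\<^bsub>\<Gamma>\<^esub>"
    proof (rule pr.proj_ext[OF m(1) GP.one_closed])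
      fix i assume i: "i \<in> {1..n}"
      then show "\<pi> i ?m = \<pi> i \<one>\<^bsub>\<Gamma>\<^esub>"
        using none group_hom.hom_one[OF pr.proj_group_hom[OF i]] by metis
    qed
    then show False using m1 by simp
  qed
  then obtain i where "i \<in> {1..n}" "\<pi> i ?m \<noteq> \<one>\<^bsub>\<Gamma>\<^esub>" by blast
  then show ?thesis using full_sized_component[OF N(1) _ card m] by blast
qed

text \<open>A factor with a single vertex would be an abelian direct factor, hence central in the
  whole group.\<close>

lemma centerless_abelian_card:
  assumes centerless: "centerless \<Gamma>" and ab: "\<And>v. v \<in> V \<Longrightarrow> comm_group (G v)" and i: "i \<in> {1..n}"
  shows "card (W i) \<ge> 2"
  using i
proof (cases rule: W_cases)
  case (1 v)
  interpret Gv: comm_group "G v" using ab 1(2) .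
  have "carrier (G v) \<noteq> {\<one>\<^bsub>G v\<^esub>}"
    using nontrivial[OF 1(2)] Gv.is_group by (simp add: trivial_group_def)
  then obtain g where g: "g \<in> carrier (G v)" "g \<noteq> \<one>\<^bsub>G v\<^esub>" using Gv.one_closed by blast
  have P: "par (W i) = \<iota> v ` carrier (G v)" using 1 par_singleton by simp
  have x: "\<iota> v g \<in> par (W i)" "\<iota> v g \<in> carrier \<Gamma>" using P g 1(2) by auto
  have "\<iota> v g \<otimes>\<^bsub>\<Gamma>\<^esub> y = y \<otimes>\<^bsub>\<Gamma>\<^esub> \<iota> v g" if y: "y \<in> carrier \<Gamma>" for y
  proof (rule pr.proj_ext)
    fix k assume k: "k \<in> {1..n}"
    interpret k: group_hom \<Gamma> \<Gamma> "\<pi> k" using k by (rule pr.proj_group_hom)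
    show "\<pi> k (\<iota> v g \<otimes>\<^bsub>\<Gamma>\<^esub> y) = \<pi> k (y \<otimes>\<^bsub>\<Gamma>\<^esub> \<iota> v g)"
    proof (cases "k = i")
      case True
      obtain h where h: "h \<in> carrier (G v)" "\<pi> k y = \<iota> v h"
        using pr.proj_mem[OF i y] P True by auto
      have "\<iota> v g \<otimes>\<^bsub>\<Gamma>\<^esub> \<iota> v h = \<iota> v h \<otimes>\<^bsub>\<Gamma>\<^esub> \<iota> v g"
        using g h 1(2) Gv.m_comm[of g h] incl_mult by metis
      moreover have "\<pi> k (\<iota> v g) = \<iota> v g" using pr.proj_id[OF i x(1)] True by simp
      ultimately show ?thesis using h(2) x(2) y by simp
    next
      case False
      then show ?thesis using pr.proj_other[OF k i False x(1)] x y by simp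
    qed
  qed (use x y in simp_all)
  then have "\<iota> v g \<in> group_center \<Gamma>" using x by (simp add: group_center_def)
  then show ?thesis using centerless incl_eq_one_iff[OF 1(2) g(1)] g(2) by (simp add: centerless_def)
qed

lemma normal_subgroup_of_Aut_finite_or_full_sized:
  assumes fin: "\<And>v. v \<in> V \<Longrightarrow> finite (carrier (G v))" and N: "N \<lhd> \<A>"
  shows "finite N \<or> full_sized (\<A>\<lparr>carrier := N\<rparr>)"
proof (rule disjCI)
  assume not_full: "\<not> full_sized (\<A>\<lparr>carrier := N\<rparr>)"
  have sub: "subgroup N \<A>" using N by (rule normal_imp_subgroup)
  have Na: "\<phi> \<in> auto \<Gamma>" if "\<phi> \<in> N" for \<phi> using subgroup.subset[OF sub] that by auto
  \<comment> \<open>The possible \<open>i\<close>-th components of a displacement by an element of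
    \<open>N\<close>, given that \<open>N\<close> is not full-sized.\<close>
  define F where "F = (\<lambda>i. if card (W i) \<ge> 2 then {\<one>\<^bsub>\<Gamma>\<^esub>} else par (W i))"
  have finF: "finite (F i)" if i: "i \<in> {1..n}" for i
    using i
  proof (cases rule: W_cases)
    case (1 v)
    then show ?thesis using fin par_singleton[of v] by (simp add: F_def)
  qed (simp add: F_def)
  define T where "T = {m \<in> carrier \<Gamma>. \<forall>i\<in>{1..n}. \<pi> i m \<in> F i}"
  have "finite T"
  proof (rule inj_on_finite)
    show "inj_on (\<lambda>m. \<lambda>i\<in>{1..n}. \<pi> i m) T"
    proof (rule inj_onI)
      fix x y assume "x \<in> T" "y \<in> T" and eq: "(\<lambda>i\<in>{1..n}. \<pi> i x) = (\<lambda>i\<in>{1..n}. \<pi> i y)"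
      then have "x \<in> carrier \<Gamma>" "y \<in> carrier \<Gamma>" by (simp_all add: T_def)
      then show "x = y"
      proof (rule pr.proj_ext)
        show "\<pi> i x = \<pi> i y" if "i \<in> {1..n}" for i using fun_cong[OF eq, of i] that by simp
      qed
    qed
    show "(\<lambda>m. \<lambda>i\<in>{1..n}. \<pi> i m) ` T \<subseteq> (\<Pi>\<^sub>E i\<in>{1..n}. F i)" by (auto simp: T_def)
    show "finite (\<Pi>\<^sub>E i\<in>{1..n}. F i)" using finF by (intro finite_PiE) simp_all
  qed
  have disp: "\<phi> g \<otimes>\<^bsub>\<Gamma>\<^esub> inv\<^bsub>\<Gamma>\<^esub> g \<in> T" if \<phi>: "\<phi> \<in> N" and g: "g \<in> carrier \<Gamma>" for \<phi> g
  proof -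
    let ?m = "\<phi> g \<otimes>\<^bsub>\<Gamma>\<^esub> inv\<^bsub>\<Gamma>\<^esub> g"
    have m: "?m \<in> carrier \<Gamma>" "GP.inner ?m \<in> N"
      using GP.inner_displacement[OF N \<phi> g] by simp_all
    have "\<pi> i ?m \<in> F i" if i: "i \<in> {1..n}" for i
      using full_sized_component[OF N i _ m] not_full pr.proj_mem[OF i m(1)] by (auto simp: F_def)
    then show ?thesis using m(1) by (simp add: T_def)
  qed
  define S where "S = (\<Union>v\<in>V. \<iota> v ` carrier (G v))"
  have finS: "finite S" unfolding S_def using fin finite_V by simp
  have Sc: "s \<in> carrier \<Gamma>" if "s \<in> S" for s using that by (auto simp: S_def)
  show "finite N"
  proof (rule inj_on_finite)
    \<comment> \<open>An automorphism is determined by its displacements on the finite generating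
      set \<open>S\<close>, and these lie in the finite set \<open>T\<close>.\<close>
    show "inj_on (\<lambda>\<phi>. \<lambda>s\<in>S. \<phi> s \<otimes>\<^bsub>\<Gamma>\<^esub> inv\<^bsub>\<Gamma>\<^esub> s) N"
    proof (rule inj_onI)
      fix \<phi> \<psi> assume \<phi>: "\<phi> \<in> N" and \<psi>: "\<psi> \<in> N"
        and eq: "(\<lambda>s\<in>S. \<phi> s \<otimes>\<^bsub>\<Gamma>\<^esub> inv\<^bsub>\<Gamma>\<^esub> s) = (\<lambda>s\<in>S. \<psi> s \<otimes>\<^bsub>\<Gamma>\<^esub> inv\<^bsub>\<Gamma>\<^esub> s)"
      interpret \<phi>: group_hom \<Gamma> \<Gamma> \<phi> using Na[OF \<phi>] by (rule GP.auto_hom)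
      interpret \<psi>: group_hom \<Gamma> \<Gamma> \<psi> using Na[OF \<psi>] by (rule GP.auto_hom)
      have S: "\<phi> s = \<psi> s" if s: "s \<in> S" for s
        using fun_cong[OF eq, of s] s Sc[OF s] by simp
      have "\<phi> x = \<psi> x" if "x \<in> carrier \<Gamma>" for x
        using that
      proof (induction rule: graph_product_induct)
        case (incl v g x)
        then have "\<phi> (\<iota> v g) = \<psi> (\<iota> v g)" by (intro S) (auto simp: S_def)
        then show ?case using incl by simp
      qed simp
      moreover have "\<phi> \<in> extensional (carrier \<Gamma>)" "\<psi> \<in> extensional (carrier \<Gamma>)"
        using Na[OF \<phi>] Na[OF \<psi>] by (simp_all add: auto_def Bij_def)
      ultimately show "\<phi> = \<psi>" by (intro extensionalityI)
    qed
    show "(\<lambda>\<phi>. \<lambda>s\<in>S. \<phi> s \<otimes>\<^bsub>\<Gamma>\<^esub> inv\<^bsub>\<Gamma>\<^esub> s) ` N \<subseteq> (\<Pi>\<^sub>E s\<in>S. T)" using disp Sc by auto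
    show "finite (\<Pi>\<^sub>E s\<in>S. T)" using finS \<open>finite T\<close> by (intro finite_PiE)
  qed
qed

end

theorem propositionE:
  fixes V :: "'v set" and E :: "'v set set"
    and G :: "'v \<Rightarrow> ('g, 'm) monoid_scheme"
    and n :: nat and W :: "nat \<Rightarrow> 'v set"
  assumes "finite V" and "simplicial_graph V E"
    and "\<And>v. v \<in> V \<Longrightarrow> group (G v)"
    and "\<And>v. v \<in> V \<Longrightarrow> \<not> trivial_group (G v)"
    and "parabolic_decomposition V E G n W"
    and "\<And>i. i \<in> {1..n} \<Longrightarrow> \<not> directly_decomposable (W i) (induced_edges E (W i)) G"
    and "\<And>i. i \<in> {1..n} \<Longrightarrow> \<not> special_parabolic V E G (W i) \<cong> infinite_dihedral_group"
  shows
    "((\<forall>i\<in>{1..n}. card (W i) \<ge> 2) \<longrightarrow>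
        (\<forall>N. N \<lhd> AutoGroup (graph_product V E G) \<and> N \<noteq> {\<one>\<^bsub>AutoGroup (graph_product V E G)\<^esub>} \<longrightarrow>
          full_sized (AutoGroup (graph_product V E G)\<lparr>carrier := N\<rparr>)))
     \<and> (centerless (graph_product V E G) \<and> (\<forall>v\<in>V. comm_group (G v)) \<longrightarrow>
        (\<forall>N. N \<lhd> AutoGroup (graph_product V E G) \<and> N \<noteq> {\<one>\<^bsub>AutoGroup (graph_product V E G)\<^esub>} \<longrightarrow>
          full_sized (AutoGroup (graph_product V E G)\<lparr>carrier := N\<rparr>)))
     \<and> ((\<forall>v\<in>V. finite (carrier (G v))) \<longrightarrow>
        (\<forall>N. N \<lhd> AutoGroup (graph_product V E G) \<longrightarrow>
          finite N \<or> full_sized (AutoGroup (graph_product V E G)\<lparr>carrier := N\<rparr>)))"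
proof -
  interpret indecomposable_decomposition V E G n W
    by (intro indecomposable_decomposition.intro indecomposable_decomposition_axioms.intro
        graph_product_data.intro) (fact assms)+
  show ?thesis
    using normal_subgroup_of_Aut_full_sized centerless_abelian_card
      normal_subgroup_of_Aut_finite_or_full_sized by simp
qed

end
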